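(* Let $\mathbb{F}$ be a field, $\mathsf{R}=\mathbb{F}[x]$, and $0\neq h\in\mathsf{R}$. (a) Assume $\mathrm{char}(\mathbb{F})=0$ and $h\notin\mathbb{F}^*$. A primitive ideal of $\mathsf{A}_h$ is $(0)$ or is the annihilator of an irreducible module $\mathsf{L}(\mathfrak{m},\bar g)$ for $\mathfrak{m}=\mathsf{R}f$, where $f$ is a prime factor of $h$, and $\bar g$ is a monic prime polynomial of $\mathsf{Q}_{\mathfrak{m}}=(\mathsf{R}/\mathfrak{m})[y]$. The primitive ideal $(0)$ is the annihilator of $\mathsf{U}(\mathfrak{m})$ for any maximal ideal $\mathfrak{m}$ of $\mathsf{R}$ which is not $\delta$-invariant. (b) Over any field $\mathbb{F}$, if $\mathfrak{m}=\mathsf{R}f$, where $f$ is a prime factor of $h$, and if $g=\sum_{j\geq 0}y^jg_j\in\mathsf{A}_h$ (where $g_j\in\mathsf{R}$ for all $j$) has the property that $\bar g=\sum_{j\geq 0}y^j\bar g_j$ is a monic prime polynomial in $\mathsf{Q}_{\mathfrak{m}}$, then $\mathrm{Ann}_{\mathsf{A}_h}(\mathsf{L}(\mathfrak{m},\bar g))=\mathsf{A}_hg+\mathsf{A}_h\mathfrak{m}$.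
   Context: $\mathsf{A}_h$ is the unital associative $\mathbb{F}$-algebra with generators $x,y$ and defining relation $yx=xy+h$; throughout $h\neq 0$. It is a free left and right module over $\mathsf{R}=\mathbb{F}[x]$ with basis $\{y^n\mid n\geq 0\}$. Let $\delta(r)=r'h$ for $r\in\mathsf{R}$; an ideal $\mathfrak{n}$ of $\mathsf{R}$ is $\delta$-invariant if $\delta(\mathfrak{n})\subseteq\mathfrak{n}$. Modules are left modules; "prime polynomial" means irreducible polynomial; a primitive ideal is the annihilator of an irreducible module. For a maximal ideal $\mathfrak{m}$ of $\mathsf{R}$, $\mathsf{U}(\mathfrak{m}):=\mathsf{A}_h\otimes_{\mathsf{R}}\mathsf{R}/\mathfrak{m}$, and $\mathsf{Q}_{\mathfrak{m}}=(\mathsf{R}/\mathfrak{m})[y]$ is the commutative polynomial ring in $y$ over $\mathsf{R}/\mathfrak{m}$; $\bar r$ denotes the class of $r\in \mathsf{R}$ in $\mathsf{R}/\mathfrak{m}$. If $\mathfrak{m}=\mathsf{R}f$ with $f$ a prime factor of $h$, and $\bar g=\sum_jy^j\bar g_j\in\mathsf{Q}_{\mathfrak{m}}$ is a monic prime polynomial with lift $g=\sum_jy^jg_j\in\mathsf{A}_h$ ($g_j\in\mathsf{R}$), put $\bar g\,\mathsf{U}(\mathfrak{m}):=g\,\mathsf{U}(\mathfrak{m})$ (a submodule depending only on $\bar g$) and $\mathsf{L}(\mathfrak{m},\bar g):=\mathsf{U}(\mathfrak{m})/\bar g\,\mathsf{U}(\mathfrak{m})$, which is an irreducible $\mathsf{A}_h$-module.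 *)

theory Defs
  imports "HOL-Algebra.Algebra" "HOL-Algebra.Algebraic_Closure_Type" "HOL-Library.Poly_Mapping"
begin

section \<open>Left modules over a ring that need not be commutative\<close>

text \<open>The locale \<open>module\<close> of HOL-Algebra assumes a commutative ring of scalars. We keep its
  record type and its locale \<open>submodule\<close>, which has no such assumption. The fields
  \<open>mult\<close> and \<open>one\<close> of a module record play no role.\<close>

locale left_module = A?: ring A + M?: abelian_group M
  for A :: "('r, 'k) ring_scheme" (structure) and M :: "('r, 'm, 'l) module_scheme" (structure) +
  assumes smult_closed:
      "\<lbrakk>a \<in> carrier A; u \<in> carrier M\<rbrakk> \<Longrightarrow> a \<odot>\<^bsub>M\<^esub> u \<in> carrier M"
    and smult_l_distr:
      "\<lbrakk>a \<in> carrier A; b \<in> carrier A; u \<in> carrier M\<rbrakk> \<Longrightarrow>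
        (a \<oplus>\<^bsub>A\<^esub> b) \<odot>\<^bsub>M\<^esub> u = a \<odot>\<^bsub>M\<^esub> u \<oplus>\<^bsub>M\<^esub> b \<odot>\<^bsub>M\<^esub> u"
    and smult_r_distr:
      "\<lbrakk>a \<in> carrier A; u \<in> carrier M; v \<in> carrier M\<rbrakk> \<Longrightarrow>
        a \<odot>\<^bsub>M\<^esub> (u \<oplus>\<^bsub>M\<^esub> v) = a \<odot>\<^bsub>M\<^esub> u \<oplus>\<^bsub>M\<^esub> a \<odot>\<^bsub>M\<^esub> v"
    and smult_assoc:
      "\<lbrakk>a \<in> carrier A; b \<in> carrier A; u \<in> carrier M\<rbrakk> \<Longrightarrow>
        (a \<otimes>\<^bsub>A\<^esub> b) \<odot>\<^bsub>M\<^esub> u = a \<odot>\<^bsub>M\<^esub> (b \<odot>\<^bsub>M\<^esub> u)"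
    and smult_one:
      "u \<in> carrier M \<Longrightarrow> \<one>\<^bsub>A\<^esub> \<odot>\<^bsub>M\<^esub> u = u"

definition irreducible_module :: "('r, 'k) ring_scheme \<Rightarrow> ('r, 'm, 'l) module_scheme \<Rightarrow> bool"
  where "irreducible_module A M \<longleftrightarrow>
    left_module A M \<and> carrier M \<noteq> {\<zero>\<^bsub>M\<^esub>} \<and>
    (\<forall>N. submodule N A M \<longrightarrow> N = {\<zero>\<^bsub>M\<^esub>} \<or> N = carrier M)"

definition Ann :: "('r, 'k) ring_scheme \<Rightarrow> ('r, 'm, 'l) module_scheme \<Rightarrow> 'r set"
  where "Ann A M = {a \<in> carrier A. \<forall>u \<in> carrier M. a \<odot>\<^bsub>M\<^esub> u = \<zero>\<^bsub>M\<^esub>}"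

text \<open>HOL cannot quantify over types inside a formula, so the type of the elements of the
  module is a parameter of the notion.\<close>

definition primitive_ideal :: "'m itself \<Rightarrow> ('r, 'k) ring_scheme \<Rightarrow> 'r set \<Rightarrow> bool"
  where "primitive_ideal (T :: 'm itself) A P \<longleftrightarrow>
    (\<exists>M :: ('r, 'm) module. irreducible_module A M \<and> P = Ann A M)"

definition regular_module :: "('r, 'k) ring_scheme \<Rightarrow> ('r, 'r) module"
  where "regular_module A =
    \<lparr>carrier = carrier A, monoid.mult = monoid.mult A, one = \<one>\<^bsub>A\<^esub>,
     ring.zero = \<zero>\<^bsub>A\<^esub>, add = add A, module.smult = monoid.mult A\<rparr>"

definition quotient_module :: "('r, 'm, 'l) module_scheme \<Rightarrow> 'm set \<Rightarrow> ('r, 'm set) module"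
  where "quotient_module M N =
    \<lparr>carrier = a_rcosets\<^bsub>M\<^esub> N, monoid.mult = undefined, one = undefined,
     ring.zero = N, add = set_add M,
     module.smult = (\<lambda>a C. \<Union>u\<in>C. N +>\<^bsub>M\<^esub> (a \<odot>\<^bsub>M\<^esub> u))\<rparr>"


section \<open>The left module obtained by extension of scalars\<close>

text \<open>For a ring homomorphism \<open>\<phi>\<close> from \<open>R\<close> to \<open>A\<close> and a left \<open>R\<close>-module \<open>N\<close>, the left
  \<open>A\<close>-module \<open>A \<otimes>\<^sub>R N\<close>: the free Abelian group on the pairs \<open>(b, n)\<close> modulo biadditivity and
  \<open>(b \<phi>(r), n) = (b, r n)\<close>, with \<open>A\<close> acting by left multiplication on the first factor.\<close>

definition tensor_relations ::
    "('s, 'k) ring_scheme \<Rightarrow> ('r, 'j) ring_scheme \<Rightarrow> ('r \<Rightarrow> 's) \<Rightarrow> ('r, 'n, 'l) module_scheme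
      \<Rightarrow> ('s \<times> 'n \<Rightarrow>\<^sub>0 int) set"
  where "tensor_relations A R \<phi> N =
      {frag_of (b \<oplus>\<^bsub>A\<^esub> c, n) - frag_of (b, n) - frag_of (c, n) | b c n.
         b \<in> carrier A \<and> c \<in> carrier A \<and> n \<in> carrier N} \<union>
      {frag_of (b, n \<oplus>\<^bsub>N\<^esub> p) - frag_of (b, n) - frag_of (b, p) | b n p.
         b \<in> carrier A \<and> n \<in> carrier N \<and> p \<in> carrier N} \<union>
      {frag_of (b \<otimes>\<^bsub>A\<^esub> \<phi> r, n) - frag_of (b, r \<odot>\<^bsub>N\<^esub> n) | b r n.
         b \<in> carrier A \<and> r \<in> carrier R \<and> n \<in> carrier N}"

definition extend_scalars ::
    "('s, 'k) ring_scheme \<Rightarrow> ('r, 'j) ring_scheme \<Rightarrow> ('r \<Rightarrow> 's) \<Rightarrow> ('r, 'n, 'l) module_scheme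
      \<Rightarrow> ('s, ('s \<times> 'n \<Rightarrow>\<^sub>0 int) set) module"
  where "extend_scalars A R \<phi> N =
    (let T = free_Abelian_group (carrier A \<times> carrier N);
         K = generate T (tensor_relations A R \<phi> N)
     in \<lparr>carrier = carrier (T Mod K), monoid.mult = undefined, one = undefined,
         ring.zero = \<one>\<^bsub>T Mod K\<^esub>, add = monoid.mult (T Mod K),
         module.smult = (\<lambda>a C. \<Union>w\<in>C.
           K #>\<^bsub>T\<^esub> frag_extend (\<lambda>(b, n). frag_of (a \<otimes>\<^bsub>A\<^esub> b, n)) w)\<rparr>)"


section \<open>The algebra generated by x and y with the relation yx = xy + h\<close>

datatype gen = gen_x | gen_y

text \<open>Words in the two generators, that is, the free monoid, written additively because the
  product of \<open>poly_mapping\<close> is the convolution product over an additive monoid. Hence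
  the type \<open>word \<Rightarrow>\<^sub>0 'a\<close> is the free associative unital \<open>'a\<close>-algebra on \<open>x\<close> and \<open>y\<close>.\<close>

datatype word = Word "gen list"

instantiation word :: monoid_add
begin

definition zero_word :: word where "zero_word = Word []"

fun plus_word :: "word \<Rightarrow> word \<Rightarrow> word" where "plus_word (Word u) (Word v) = Word (u @ v)"

instance
proof
  fix a b c :: word
  show "a + b + c = a + (b + c)" by (cases a; cases b; cases c) simp
  show "0 + a = a" by (cases a) (simp add: zero_word_def)
  show "a + 0 = a" by (cases a) (simp add: zero_word_def)
qed

end

type_synonym 'a free_algebra = "word \<Rightarrow>\<^sub>0 'a"

abbreviation free_x :: "'a::field free_algebra"
  where "free_x \<equiv> Poly_Mapping.single (Word [gen_x]) 1"

abbreviation free_y :: "'a::field free_algebra"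
  where "free_y \<equiv> Poly_Mapping.single (Word [gen_y]) 1"

definition poly_at_x :: "'a::field poly \<Rightarrow> 'a free_algebra"
  where "poly_at_x p =
    (\<Sum>i\<le>degree p. Poly_Mapping.single 0 (Polynomial.coeff p i) * free_x ^ i)"

definition Ah_relations :: "'a::field poly \<Rightarrow> 'a free_algebra set"
  where "Ah_relations h =
    Idl\<^bsub>ring_of_type_algebra\<^esub> {free_y * free_x - (free_x * free_y + poly_at_x h)}"

definition Ah :: "'a::field poly \<Rightarrow> 'a free_algebra set ring"
  where "Ah h = ring_of_type_algebra Quot (Ah_relations h)"

definition Ah_y :: "'a::field poly \<Rightarrow> 'a free_algebra set"
  where "Ah_y h = Ah_relations h +>\<^bsub>ring_of_type_algebra\<^esub> free_y"

definition Ah_emb :: "'a::field poly \<Rightarrow> 'a poly \<Rightarrow> 'a free_algebra set"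
  where "Ah_emb h r = Ah_relations h +>\<^bsub>ring_of_type_algebra\<^esub> poly_at_x r"

abbreviation Rx :: "'a::field poly ring"
  where "Rx \<equiv> ring_of_type_algebra"

definition delta :: "'a::field poly \<Rightarrow> 'a poly \<Rightarrow> 'a poly"
  where "delta h r = pderiv r * h"

definition delta_invariant :: "'a::field poly \<Rightarrow> 'a poly set \<Rightarrow> bool"
  where "delta_invariant h n \<longleftrightarrow> delta h ` n \<subseteq> n"

text \<open>A finitely supported sequence \<open>(g\<^sub>j)\<close> in \<open>F[x]\<close> is encoded as an element of
  \<open>'a poly poly\<close>. Only its coefficients are used, not the product of that type: \<open>Ah_elem\<close>
  is \<open>\<Sum>\<^sub>j y\<^sup>j g\<^sub>j\<close> in the algebra and \<open>reduce_coeffs\<close> is its reduction in \<open>(R/m)[y]\<close>.\<close>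

definition Ah_elem :: "'a::field poly \<Rightarrow> 'a poly poly \<Rightarrow> 'a free_algebra set"
  where "Ah_elem h g =
    (\<Oplus>\<^bsub>Ah h\<^esub> j \<in> {..degree g}.
      (Ah_y h [^]\<^bsub>Ah h\<^esub> j) \<otimes>\<^bsub>Ah h\<^esub> Ah_emb h (Polynomial.coeff g j))"

definition Qm :: "'a::field poly set \<Rightarrow> ('a poly set, nat \<Rightarrow> 'a poly set) up_ring"
  where "Qm m = UP (Rx Quot m)"

definition reduce_coeffs :: "'a::field poly set \<Rightarrow> 'a poly poly \<Rightarrow> nat \<Rightarrow> 'a poly set"
  where "reduce_coeffs m g = (\<lambda>j. m +>\<^bsub>Rx\<^esub> Polynomial.coeff g j)"

definition monic_prime :: "'a::field poly set \<Rightarrow> (nat \<Rightarrow> 'a poly set) \<Rightarrow> bool"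
  where "monic_prime m p \<longleftrightarrow>
    p \<in> carrier (Qm m) \<and> ring_irreducible\<^bsub>Qm m\<^esub> p \<and>
    up_ring.coeff (Qm m) p (deg (Rx Quot m) p) = \<one>\<^bsub>Rx Quot m\<^esub>"


section \<open>The modules U(m) and L(m, g)\<close>

type_synonym 'a Um_carrier = "('a free_algebra set \<times> 'a poly set \<Rightarrow>\<^sub>0 int) set"

definition Um :: "'a::field poly \<Rightarrow> 'a poly set \<Rightarrow> ('a free_algebra set, 'a Um_carrier) module"
  where "Um h m = extend_scalars (Ah h) Rx (Ah_emb h) (quotient_module (regular_module Rx) m)"

text \<open>If \<open>m\<close> is generated by a prime factor of \<open>h\<close>, the set \<open>g U(m)\<close> is a submodule that does
  not depend on the lift \<open>g\<close> of the given element of \<open>Qm m\<close>, so any lift may be chosen.\<close>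

definition gUm :: "'a::field poly \<Rightarrow> 'a poly set \<Rightarrow> (nat \<Rightarrow> 'a poly set) \<Rightarrow> 'a Um_carrier set"
  where "gUm h m gbar =
    (let g = Ah_elem h (SOME g. reduce_coeffs m g = gbar)
     in {g \<odot>\<^bsub>Um h m\<^esub> u | u. u \<in> carrier (Um h m)})"

definition Lm :: "'a::field poly \<Rightarrow> 'a poly set \<Rightarrow> (nat \<Rightarrow> 'a poly set)
    \<Rightarrow> ('a free_algebra set, 'a Um_carrier set) module"
  where "Lm h m gbar = quotient_module (Um h m) (gUm h m gbar)"

end

(* The ring A_h acts on polynomials in Y over R by left multiplication on the normal forms
   sum_j r_j y^j: x multiplies the coefficients and y sends p to Y p + delta(p). This action is
   faithful and identifies A_h with the additive group of R[Y] under a twisted product.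

   If f divides h, then f A_h = A_h f and the twisted product agrees with the commutative one
   modulo f. So A_h / A_h f is the commutative ring (R/f)[Y], U(m) is this ring regarded as a module
   over itself and L(m, g) is its quotient by the ideal of g, which gives (b).

   In characteristic 0, taking the commutator with x lowers the degree in y, so a nonzero ideal of
   A_h contains a nonzero r in R. For r of least degree, [y, r] = delta(r) forces r to divide r' h,
   and hence every prime factor f of r divides h. If the ideal annihilates an irreducible module M,
   the kernel of f on M is a submodule because f A_h = A_h f, so one of these f kills M. Then M is a
   simple module over (R/f)[Y], that is, M is some L(m, g). When f does not divide h,
   the commutator with f instead shows that U(Rf) is irreducible, and the same r shows that it is
   faithful. *)

theory Submission
  imports Defs
begin

section \<open>The twisted product on polynomials in Y\<close>

text \<open>The passage to R[Y] also turns modules into ideals. U(m) is built from a free Abelian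
  group modulo relations, but all that is retained of it is a generator u whose annihilator is
  exactly A_h f. Likewise L(m, g) is known through a generator whose annihilator is the commutative
  ideal (f, g) of R[Y]. Irreducibility and annihilators then become statements about subsets of
  R[Y].

  The delicate half is that the annihilator of u is no larger, since this requires a proof that
  tensors are nonzero. It comes from a homomorphism out of the free Abelian group that depends on
  arbitrary coset representatives. It is not well defined on the tensor product, but the choices
  only matter modulo A_h f.

  Characteristic 0 keeps the integer factors nonzero that commutators and derivatives of powers
  produce, and it prevents a prime f from dividing f'. A nonconstant h guarantees that h + 1 has a
  prime factor; such a factor does not divide h and yields a faithful irreducible U(m).\<close>

text \<open>The generator is a nonzero element of least degree, and division with remainder does the
  rest. D is a bare set with closure properties because the lemma serves ideals of three origins:
  (f, a), the constants in an ideal of A_h, and a maximal ideal of R.\<close>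

lemma poly_ideal_generator:
  fixes D :: "'a::field poly set"
  assumes add: "\<And>p q. p \<in> D \<Longrightarrow> q \<in> D \<Longrightarrow> p + q \<in> D" and mult: "\<And>p q. p \<in> D \<Longrightarrow> q * p \<in> D"
    and s: "s \<in> D" "s \<noteq> 0"
  obtains r where "r \<noteq> 0" "D = {t. r dvd t}"
proof -
  define r where "r = (ARG_MIN Polynomial.degree t. t \<noteq> 0 \<and> t \<in> D)"
  have r: "r \<noteq> 0 \<and> r \<in> D"
    unfolding r_def by (rule arg_min_natI) (use s in auto)
  have min: "Polynomial.degree r \<le> Polynomial.degree t" if "t \<noteq> 0" "t \<in> D" for t
    unfolding r_def by (rule arg_min_nat_le) (use that in auto)
  have "r dvd t" if t: "t \<in> D" for t
  proof (rule ccontr)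
    assume "\<not> r dvd t"
    then have "t mod r \<noteq> 0" by (simp add: dvd_eq_mod_eq_0)
    moreover have "t mod r = t + (- (t div r)) * r"
      by (simp add: minus_div_mult_eq_mod[symmetric])
    then have "t mod r \<in> D"
      using t r add mult by metis
    ultimately show False
      using min[of "t mod r"] degree_mod_less'[of r t] r by force
  qed
  moreover have "t \<in> D" if "r dvd t" for t
    using that mult[of r] r by (auto simp: dvd_def mult.commute)
  ultimately show thesis using that r by blast
qed

text \<open>The generator of the ideal (f, a) divides the prime f. It is not an associate of f, as f
  does not divide a, so it is a unit. The factor v is an inverse of a modulo f.\<close>

lemma irreducible_poly_bezout:
  fixes f a :: "'a::field poly"
  assumes "Factorial_Ring.irreducible f" "\<not> f dvd a"
  obtains u v where "u * f + v * a = 1"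
proof -
  define D where "D = {u * f + v * a | u v. True}"
  have add: "p + q \<in> D" if pq: "p \<in> D" "q \<in> D" for p q
  proof -
    obtain u v u' v' where "p = u * f + v * a" "q = u' * f + v' * a" using pq unfolding D_def by blast
    then have "p + q = (u + u') * f + (v + v') * a" by (simp add: algebra_simps)
    then show ?thesis by (auto simp: D_def)
  qed
  have mult: "q * p \<in> D" if pD: "p \<in> D" for p q
  proof -
    obtain u v where "p = u * f + v * a" using pD unfolding D_def by blast
    then have "q * p = (q * u) * f + (q * v) * a" by (simp add: algebra_simps)
    then show ?thesis by (auto simp: D_def)
  qed
  have f: "f \<in> D" unfolding D_def by (rule CollectI, rule exI[of _ 1], rule exI[of _ 0]) simp
  have a: "a \<in> D" unfolding D_def by (rule CollectI, rule exI[of _ 0], rule exI[of _ 1]) simp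
  obtain r where r: "D = {t. r dvd t}"
    using poly_ideal_generator[of D f] add mult f assms(1) by (metis not_irreducible_zero)
  have "r dvd f" "r dvd a" using f a r by auto
  then have "is_unit r"
    using assms by (meson dvd_trans irreducibleD')
  then have "1 \<in> D" using r by (simp add: is_unit_iff_degree)
  then show thesis using that by (auto simp: D_def)
qed

lemma irreducible_power_decompose:
  fixes f r :: "'a::field poly"
  assumes "Factorial_Ring.irreducible f" "r \<noteq> 0"
  obtains e s where "r = f ^ e * s" "\<not> f dvd s"
proof -
  have f: "Polynomial.degree f \<noteq> 0"
    using assms(1) by (metis is_unit_iff_degree irreducible_not_unit not_irreducible_zero)
  have "\<exists>e s. r = f ^ e * s \<and> \<not> f dvd s"
    using assms(2)
  proof (induction "Polynomial.degree r" arbitrary: r rule: less_induct)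
    case less
    show ?case
    proof (cases "f dvd r")
      case True
      then obtain t where t: "r = f * t" by auto
      then have "Polynomial.degree t < Polynomial.degree r"
        using f less.prems by (simp add: degree_mult_eq)
      then obtain e s where "t = f ^ e * s" "\<not> f dvd s"
        using less.hyps t less.prems by (metis mult_zero_right)
      then have "r = f ^ Suc e * s \<and> \<not> f dvd s" using t by (simp add: mult.assoc)
      then show ?thesis by blast
    next
      case False
      then show ?thesis by (metis mult_1 power_0)
    qed
  qed
  then show thesis using that by blast
qed

text \<open>In characteristic 0 the derivative of a nonconstant polynomial is nonzero, and its
  degree is too small for a multiple of f.\<close>

lemma irreducible_not_dvd_pderiv:
  fixes f :: "'a::field poly"
  assumes "CHAR('a) = 0" "Factorial_Ring.irreducible f"
  shows "\<not> f dvd pderiv f"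
proof
  have "Polynomial.degree f \<noteq> 0"
    using assms(2) by (metis is_unit_iff_degree irreducible_not_unit not_irreducible_zero)
  then obtain n where n: "Polynomial.degree f = Suc n" by (cases "Polynomial.degree f") auto
  have nz: "of_nat (Suc n) \<noteq> (0 :: 'a)"
    using assms(1) by (metis nat.distinct(1) of_nat_eq_0_iff_char_dvd dvd_0_left_iff)
  have "Polynomial.coeff (pderiv f) n = of_nat (Suc n) * Polynomial.lead_coeff f"
    by (simp add: coeff_pderiv n)
  also have "\<dots> \<noteq> 0" using nz n by (metis leading_coeff_0_iff degree_0 mult_eq_0_iff nat.distinct(1))
  finally have "pderiv f \<noteq> 0" by auto
  moreover assume "f dvd pderiv f"
  ultimately have "Polynomial.degree f \<le> Polynomial.degree (pderiv f)" by (rule dvd_imp_degree_le[rotated])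
  also have "\<dots> \<le> n" by (rule degree_le) (simp add: coeff_pderiv coeff_eq_0 n)
  finally show False using n by simp
qed

text \<open>A positive integer is a unit here, and f is not. This handles the integer factors in
  commutators and in derivatives of powers.\<close>

lemma irreducible_not_dvd_of_nat:
  fixes f :: "'a::field poly"
  assumes "CHAR('a) = 0" "Factorial_Ring.irreducible f"
  shows "\<not> f dvd of_nat (Suc n)"
proof
  have nz: "of_nat (Suc n) \<noteq> (0 :: 'a)"
    using assms(1) by (metis nat.distinct(1) of_nat_eq_0_iff_char_dvd dvd_0_left_iff)
  assume "f dvd of_nat (Suc n)"
  then have "is_unit f"
    using nz by (metis degree_of_nat dvd_trans is_unit_iff_degree of_nat_poly pCons_eq_0_iff)
  then show False using assms(2) irreducible_not_unit by blast
qed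

section \<open>The derivation delta and the twisted product\<close>

lemma delta_add: "delta h (p + q) = delta h p + delta h q"
  by (simp add: delta_def pderiv_add algebra_simps)

lemma delta_mult: "delta h (p * q) = delta h p * q + p * delta h q"
  by (simp add: delta_def pderiv_mult algebra_simps)

lemma delta_const [simp]: "delta h [:c:] = 0"
  by (simp add: delta_def pderiv_pCons)

lemma delta_0 [simp]: "delta h 0 = 0"
  by (simp add: delta_def)

definition left_y :: "'a::field poly \<Rightarrow> 'a poly poly \<Rightarrow> 'a poly poly"
  where "left_y h q = pCons 0 q + map_poly (delta h) q"

lemma coeff_map_poly_delta [simp]:
  "Polynomial.coeff (map_poly (delta h) q) i = delta h (Polynomial.coeff q i)"
  by (simp add: coeff_map_poly)

lemma left_y_0 [simp]: "left_y h 0 = 0"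
  by (simp add: left_y_def)

lemma left_y_add: "left_y h (p + q) = left_y h p + left_y h q"
  by (rule poly_eqI) (simp add: left_y_def delta_add coeff_pCons split: nat.split)

text \<open>This is the relation y a = a y + delta(a), read as an identity of operators on R[Y]; the
  associativity of the twisted product rests on it.\<close>

lemma left_y_smult: "left_y h (Polynomial.smult a q) = Polynomial.smult (delta h a) q + Polynomial.smult a (left_y h q)"
  by (rule poly_eqI) (simp add: left_y_def delta_mult coeff_pCons algebra_simps split: nat.split)

lemma left_y_scalar: "left_y h (Polynomial.smult [:c:] q) = Polynomial.smult [:c:] (left_y h q)"
  by (simp add: left_y_smult)

lemma left_y_pCons_0: "left_y h (pCons 0 q) = pCons 0 (left_y h q)"
  by (rule poly_eqI) (simp add: left_y_def coeff_pCons split: nat.split)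

lemma left_y_pCons: "left_y h (pCons a q) = [:delta h a:] + pCons 0 [:a:] + pCons 0 (left_y h q)"
  by (rule poly_eqI) (simp add: left_y_def coeff_pCons split: nat.split)

lemma left_y_const: "left_y h [:a:] = [:delta h a, a:]"
  by (rule poly_eqI) (simp add: left_y_def coeff_pCons split: nat.split)

text \<open>Horner's scheme: (a + p y) q = a q + p (y q). The accumulator is a function of q because
  the right factor changes along the recursion, which is why many inductions below keep q
  arbitrary.\<close>

definition tmul :: "'a::field poly \<Rightarrow> 'a poly poly \<Rightarrow> 'a poly poly \<Rightarrow> 'a poly poly"
  where "tmul h p = fold_coeffs (\<lambda>a acc q. Polynomial.smult a q + acc (left_y h q)) p (\<lambda>q. 0)"

lemma tmul_pCons: "tmul h (pCons a p) q = Polynomial.smult a q + tmul h p (left_y h q)"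
  by (cases "p = 0 \<and> a = 0") (auto simp: tmul_def)

lemma tmul_0_left [simp]: "tmul h 0 q = 0"
  by (simp add: tmul_def)

lemma tmul_0_right [simp]: "tmul h p 0 = 0"
  by (induction p) (simp_all add: tmul_pCons)

lemma tmul_add_right: "tmul h p (q + r) = tmul h p q + tmul h p r"
  by (induction p arbitrary: q r) (simp_all add: tmul_pCons left_y_add smult_add_right algebra_simps)

lemma tmul_add_left: "tmul h (p + q) r = tmul h p r + tmul h q r"
proof (induction p arbitrary: q r)
  case (pCons a p)
  show ?case
  proof (cases q)
    case (pCons b q')
    then show ?thesis
      using pCons.IH by (simp add: tmul_pCons smult_add_left)
  qed
qed simp

lemma tmul_const_left [simp]: "tmul h [:a:] q = Polynomial.smult a q"
  by (simp add: tmul_pCons)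

lemma tmul_1_left [simp]: "tmul h 1 q = q"
  using tmul_const_left[of h 1 q] by (simp del: tmul_const_left add: tmul_pCons flip: one_pCons)

lemma tmul_y_left: "tmul h [:0, 1:] q = left_y h q"
  by (simp add: tmul_pCons)

lemma tmul_smult_left: "tmul h (Polynomial.smult a p) q = Polynomial.smult a (tmul h p q)"
  by (induction p arbitrary: q) (simp_all add: tmul_pCons smult_add_right algebra_simps)

lemma tmul_scalar_right: "tmul h p (Polynomial.smult [:c:] q) = Polynomial.smult [:c:] (tmul h p q)"
proof (induction p arbitrary: q)
  case (pCons a p)
  show ?case
    by (simp add: tmul_pCons left_y_scalar pCons.IH smult_add_right mult.commute)
qed simp

text \<open>In a normal form the powers of y stand on the right, so right multiplication by y is a
  mere shift, and it commutes with left multiplications.\<close>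

lemma tmul_pCons_0_right: "tmul h p (pCons 0 q) = pCons 0 (tmul h p q)"
  by (induction p arbitrary: q) (simp_all add: tmul_pCons left_y_pCons_0)

lemma tmul_1_right [simp]: "tmul h p 1 = p"
proof (induction p)
  case (pCons a p)
  then show ?case
    by (simp add: tmul_pCons one_pCons left_y_const tmul_pCons_0_right)
qed simp

text \<open>Associativity with y as the first factor. The recursion for \<open>tmul\<close> reduces
  the general case \<open>tmul_assoc\<close> to this one.\<close>

lemma tmul_left_y_left: "tmul h (left_y h p) q = left_y h (tmul h p q)"
proof (induction p arbitrary: q)
  case (pCons a p)
  have "tmul h (left_y h (pCons a p)) q =
     Polynomial.smult (delta h a) q + Polynomial.smult a (left_y h q) + tmul h (left_y h p) (left_y h q)"
    unfolding left_y_pCons tmul_add_left by (simp add: tmul_pCons)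
  also have "\<dots> = left_y h (tmul h (pCons a p) q)"
    unfolding pCons.IH tmul_pCons left_y_add left_y_smult ..
  finally show ?case .
qed simp

lemma tmul_assoc: "tmul h (tmul h p q) r = tmul h p (tmul h q r)"
proof (induction p arbitrary: q r)
  case (pCons a p)
  then show ?case
    by (simp only: tmul_pCons tmul_add_left tmul_smult_left tmul_left_y_left)
qed simp

lemma tmul_minus_left: "tmul h (- p) q = - tmul h p q"
  by (simp add: eq_neg_iff_add_eq_0 flip: tmul_add_left)

lemma tmul_minus_right: "tmul h p (- q) = - tmul h p q"
  by (simp add: eq_neg_iff_add_eq_0 flip: tmul_add_right)

lemma tmul_diff_left: "tmul h (p - q) r = tmul h p r - tmul h q r"
  using tmul_add_left[of h p "- q" r] by (simp add: tmul_minus_left)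

lemma tmul_diff_right: "tmul h p (q - r) = tmul h p q - tmul h p r"
  using tmul_add_right[of h p q "- r"] by (simp add: tmul_minus_right)

text \<open>As f divides h, it divides every value of delta, so \<open>left_y h q\<close> and Y q
  differ by a multiple of f. This is the bridge to the commutative product of R[Y].\<close>

lemma tmul_cong_mult:
  assumes "f dvd h"
  shows "[:f:] dvd tmul h p q - p * q"
proof (induction p arbitrary: q)
  case (pCons a p)
  have 1: "[:f:] dvd map_poly (delta h) q"
    using assms by (simp add: const_poly_dvd_iff delta_def)
  have 2: "left_y h q = pCons 0 q + map_poly (delta h) q"
    by (simp add: left_y_def)
  have "tmul h (pCons a p) q - pCons a p * q =
      (tmul h p (left_y h q) - p * left_y h q) + p * map_poly (delta h) q"
    by (simp add: tmul_pCons 2 algebra_simps)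
  then show ?case
    using pCons.IH[of "left_y h q"] 1 by (metis dvd_add dvd_mult)
qed simp

text \<open>Moving f to the left through y^n only creates terms of lower degree in y. The hypothesis
  is an inequality so that coefficients beyond the degree of p are covered and the induction
  applies.\<close>

lemma coeff_tmul_const:
  "Polynomial.degree p \<le> n \<Longrightarrow> Polynomial.coeff (tmul h p [:f:]) n = Polynomial.coeff p n * f"
proof (induction p arbitrary: n f)
  case (pCons a p)
  \<comment> \<open>This uses y f = f y + delta(f), with the right factor y turned into a
    shift.\<close>
  have eq: "tmul h (pCons a p) [:f:] = [:a * f:] + pCons 0 (tmul h p [:f:]) + tmul h p [:delta h f:]"
    using tmul_add_right[of h p "[:delta h f:]" "[:0, f:]"]
    by (simp add: tmul_pCons left_y_const tmul_pCons_0_right mult.commute)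
  show ?case
  proof (cases n)
    case 0
    then have "p = 0" using pCons.prems by (auto split: if_splits)
    then show ?thesis using 0 by (simp add: mult.commute)
  next
    case (Suc m)
    then have "Polynomial.degree p \<le> m" using pCons.prems by (auto split: if_splits)
    then show ?thesis using Suc pCons.IH[of m] pCons.IH[of n "delta h f"]
      unfolding eq by (simp add: coeff_eq_0)
  qed
qed simp

text \<open>The term next to the top: y^(n+1) f = f y^(n+1) + (n+1) delta(f) y^n + lower terms. In
  the induction, n of the n + 1 copies of delta(f) come from the shifted summand and one from the
  summand with \<open>delta h f\<close>.\<close>

lemma coeff_tmul_const':
  "Polynomial.degree p \<le> Suc n \<Longrightarrow> Polynomial.coeff (tmul h p [:f:]) n
     = Polynomial.coeff p n * f + of_nat (Suc n) * Polynomial.coeff p (Suc n) * delta h f"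
proof (induction p arbitrary: n f)
  case (pCons a p)
  have eq: "tmul h (pCons a p) [:f:] = [:a * f:] + pCons 0 (tmul h p [:f:]) + tmul h p [:delta h f:]"
    using tmul_add_right[of h p "[:delta h f:]" "[:0, f:]"]
    by (simp add: tmul_pCons left_y_const tmul_pCons_0_right mult.commute)
  have d: "Polynomial.degree p \<le> n" using pCons.prems by (auto split: if_splits)
  note c = coeff_tmul_const[OF d, of h "delta h f"]
  show ?case
  proof (cases n)
    case 0
    then show ?thesis unfolding eq using c by simp
  next
    case (Suc m)
    then show ?thesis unfolding eq using c pCons.IH[of m] d by (simp add: algebra_simps)
  qed
qed simp

text \<open>As R is commutative, the coefficients of p f and f p at the degree of p cancel, and the
  next one survives. The formula is applied with f = x, where delta(x) = h, and with f a prime not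
  dividing h; the degree bound alone drives \<open>range_tmul_const\<close>.\<close>

lemma coeff_commutator:
  fixes h f :: "'a::field poly"
  assumes "Polynomial.degree p = Suc n"
  defines "c \<equiv> tmul h p [:f:] - Polynomial.smult f p"
  shows "Polynomial.degree c \<le> n"
    and "Polynomial.coeff c n = of_nat (Suc n) * Polynomial.lead_coeff p * delta h f"
proof -
  show "Polynomial.degree c \<le> n"
  proof (rule degree_le, intro allI impI)
    fix i assume "n < i"
    then show "Polynomial.coeff c i = 0"
      using assms(1) by (simp add: c_def coeff_tmul_const)
  qed
  show "Polynomial.coeff c n = of_nat (Suc n) * Polynomial.lead_coeff p * delta h f"
    using assms(1) by (simp add: c_def coeff_tmul_const')
qed

section \<open>One-sided and two-sided ideals of A_h in normal form\<close>

locale left_ideal_tmul =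
  fixes h :: "'a::field poly" and J :: "'a poly poly set"
  assumes add_mem: "p \<in> J \<Longrightarrow> q \<in> J \<Longrightarrow> p + q \<in> J"
    and left_mem: "p \<in> J \<Longrightarrow> tmul h q p \<in> J"
begin

lemma smult_mem: "p \<in> J \<Longrightarrow> Polynomial.smult a p \<in> J"
  using left_mem[of p "[:a:]"] by simp

lemma minus_mem: "p \<in> J \<Longrightarrow> - p \<in> J"
  using smult_mem[of p "- 1"] by simp

lemma diff_mem: "p \<in> J \<Longrightarrow> q \<in> J \<Longrightarrow> p - q \<in> J"
  using add_mem[of p "- q"] minus_mem[of q] by simp

end

locale ideal_tmul = left_ideal_tmul +
  assumes right_mem: "p \<in> J \<Longrightarrow> tmul h p q \<in> J"
begin

lemma delta_mem:
  assumes "[:r:] \<in> J"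
  shows "[:delta h r:] \<in> J"
proof -
  have "tmul h [:0, 1:] [:r:] - tmul h [:r:] [:0, 1:] = [:delta h r:]"
    by (simp add: tmul_y_left left_y_const)
  then show ?thesis
    using assms diff_mem left_mem right_mem by metis
qed

lemma const_mem:
  assumes "CHAR('a) = 0" "h \<noteq> 0" "p \<in> J" "p \<noteq> 0"
  shows "\<exists>r. r \<noteq> 0 \<and> [:r:] \<in> J"
  using assms(3,4)
proof (induction "Polynomial.degree p" arbitrary: p rule: less_induct)
  case less
  show ?case
  proof (cases "Polynomial.degree p")
    case 0
    then obtain r where "p = [:r:]" by (rule degree_eq_zeroE)
    then show ?thesis using less.prems by auto
  next
    case (Suc n)
    \<comment> \<open>The commutator of p with x; its coefficient at n is (n + 1) lc(p) h, which is
      nonzero in characteristic 0.\<close>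
    define c where "c = tmul h p [:[:0, 1:]:] - Polynomial.smult [:0, 1:] p"
    note cc = coeff_commutator[OF Suc, where h = h and f = "[:0, 1:]", folded c_def]
    have "of_nat (Suc n) \<noteq> (0 :: 'a poly)"
      using assms(1) by (metis semiring_char_poly nat.distinct(1) of_nat_eq_0_iff_char_dvd dvd_0_left_iff)
    moreover have "delta h [:0, 1:] \<noteq> 0"
      using assms(2) by (simp add: delta_def pderiv_pCons)
    ultimately have "Polynomial.coeff c n \<noteq> 0"
      unfolding cc(2) using less.prems by simp
    then have "c \<noteq> 0" by auto
    moreover have "c \<in> J"
      unfolding c_def using less.prems by (intro diff_mem right_mem smult_mem)
    ultimately show ?thesis
      using less.hyps[of c] cc(1) Suc by simp
  qed
qed

text \<open>The constants in J form an ideal of R with generator r, and this ideal contains delta(r)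
  = [y, r]. That r divides every constant of J is what later forbids removing a prime factor from
  r.\<close>

lemma const_mem_minimal:
  assumes "[:s:] \<in> J" "s \<noteq> 0"
  obtains r where "r \<noteq> 0" "[:r:] \<in> J" "r dvd delta h r" "\<And>t. [:t:] \<in> J \<Longrightarrow> r dvd t"
proof -
  obtain r where r: "r \<noteq> 0" "{t. [:t:] \<in> J} = {t. r dvd t}"
  proof (rule poly_ideal_generator[of "{t. [:t:] \<in> J}" s])
    show "p + q \<in> {t. [:t:] \<in> J}" if "p \<in> {t. [:t:] \<in> J}" "q \<in> {t. [:t:] \<in> J}" for p q
      using that add_mem[of "[:p:]" "[:q:]"] by simp
    show "q * p \<in> {t. [:t:] \<in> J}" if "p \<in> {t. [:t:] \<in> J}" for p q
      using that smult_mem[of "[:p:]" q] by simp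
  qed (use assms in auto)
  then have "[:t:] \<in> J \<longleftrightarrow> r dvd t" for t by blast
  then show thesis
    using that[of r] r(1) delta_mem[of r] by simp
qed

end

text \<open>Write r = f^(k+1) s with f not dividing s. Then r' = f^k ((k+1) f' s + f s'), so after
  cancelling f^k the hypothesis makes f divide (k+1) f' s h, and f divides none of k+1, f' and
  s.\<close>

lemma irreducible_dvd_of_dvd_delta:
  fixes f h r :: "'a::field poly"
  assumes "CHAR('a) = 0" "r \<noteq> 0" "r dvd delta h r" "Factorial_Ring.irreducible f" "f dvd r"
  shows "f dvd h"
proof -
  have pf: "prime_elem f"
    using assms(4) by (rule field_poly_irreducible_imp_prime)
  obtain e s where s: "r = f ^ e * s" "\<not> f dvd s"
    using irreducible_power_decompose[OF assms(4,2)] .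
  then obtain k where k: "e = Suc k"
    using assms(5) by (cases e) auto
  have r: "r = f ^ k * (f * s)" using s k by (simp add: mult_ac)
  have "pderiv (f ^ Suc k) = of_nat (Suc k) * f ^ k * pderiv f"
    by (simp add: pderiv_power_Suc of_nat_poly del: of_nat_Suc power_Suc)
  then have "pderiv r = f ^ k * (of_nat (Suc k) * pderiv f * s + f * pderiv s)"
    unfolding s(1) k pderiv_mult by (simp add: algebra_simps del: of_nat_Suc)
  then have "f ^ k * (f * s) dvd f ^ k * ((of_nat (Suc k) * pderiv f * s + f * pderiv s) * h)"
    using assms(3) r by (simp add: delta_def mult.assoc)
  then have "f * s dvd (of_nat (Suc k) * pderiv f * s + f * pderiv s) * h"
    using pf by (simp only: dvd_mult_cancel_left) auto
  then have "f dvd of_nat (Suc k) * pderiv f * s * h + f * (pderiv s * h)"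
    by (metis (no_types, lifting) distrib_right dvd_mult_left mult.assoc)
  then have "f dvd of_nat (Suc k) * pderiv f * s * h"
    by (metis dvd_add_left_iff dvd_triv_left)
  moreover have "\<not> f dvd of_nat (Suc k) * pderiv f"
    using pf irreducible_not_dvd_pderiv[OF assms(1,4)] irreducible_not_dvd_of_nat[OF assms(1,4)]
    by (simp add: prime_elem_dvd_mult_iff del: of_nat_Suc)
  ultimately show ?thesis
    using pf s(2) by (metis prime_elem_dvd_mult_iff)
qed

text \<open>Descent on the degree of an element p of J outside A_h f. If f divides lc(p), a left
  multiple of f removes the leading term. Otherwise the commutator with f has smaller degree, and
  its leading coefficient (n + 1) lc(p) f' h is again not divisible by f. At degree 0 Bezout's
  identity ends the descent. This is the irreducibility of U(Rf) in terms of left ideals.\<close>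

lemma (in left_ideal_tmul) one_mem_of_irreducible:
  assumes char: "CHAR('a) = 0" and f: "Factorial_Ring.irreducible f" "\<not> f dvd h" "[:f:] \<in> J"
    and p: "p \<in> J" "p \<notin> range (\<lambda>q. tmul h q [:f:])"
  shows "1 \<in> J"
  using p
proof (induction "Polynomial.degree p" arbitrary: p rule: less_induct)
  case less
  have pf: "prime_elem f"
    using f(1) by (rule field_poly_irreducible_imp_prime)
  show ?case
  proof (cases "f dvd Polynomial.lead_coeff p")
    case True
    then obtain s where s: "Polynomial.lead_coeff p = f * s" by auto
    define p' where "p' = p - tmul h (Polynomial.monom s (Polynomial.degree p)) [:f:]"
    have "p' \<in> J"
      unfolding p'_def using less.prems f(3) by (intro diff_mem left_mem)
    moreover have "p' \<notin> range (\<lambda>q. tmul h q [:f:])"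
    proof
      assume "p' \<in> range (\<lambda>q. tmul h q [:f:])"
      then obtain q where "p' = tmul h q [:f:]" by auto
      then have "p = tmul h (q + Polynomial.monom s (Polynomial.degree p)) [:f:]"
        by (simp add: p'_def tmul_add_left algebra_simps)
      then show False using less.prems by auto
    qed
    moreover have "Polynomial.degree p' < Polynomial.degree p"
    proof (cases "Polynomial.degree p")
      case 0
      then obtain a where "p = [:a:]" by (rule degree_eq_zeroE)
      \<comment> \<open>This case is contradictory: p is itself a multiple of f, and p' = 0 lies in
        A_h f.\<close>
      then have "p' = 0" using s by (simp add: p'_def monom_0 mult.commute)
      then have "p' = tmul h 0 [:f:]" by simp
      then show ?thesis using \<open>p' \<notin> _\<close> by blast
    next
      case (Suc n)
      have "Polynomial.degree p' \<le> n"
      proof (rule degree_le, intro allI impI)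
        fix i assume i: "n < i"
        show "Polynomial.coeff p' i = 0"
          using Suc s i coeff_tmul_const[of "Polynomial.monom s (Polynomial.degree p)" i h f]
            Polynomial.degree_monom_le[of s "Polynomial.degree p"]
          by (cases "i = Suc n") (auto simp: p'_def coeff_eq_0)
      qed
      then show ?thesis using Suc by simp
    qed
    ultimately show ?thesis using less.hyps by blast
  next
    case False
    show ?thesis
    proof (cases "Polynomial.degree p")
      case 0
      then obtain a where a: "p = [:a:]" by (rule degree_eq_zeroE)
      then have "\<not> f dvd a" using False by simp
      then obtain u v where "u * f + v * a = 1"
        using irreducible_poly_bezout f(1) by metis
      then have "1 = Polynomial.smult u [:f:] + Polynomial.smult v p" by (simp add: a one_pCons)
      then show ?thesis
        using f(3) less.prems add_mem smult_mem by metis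
    next
      case (Suc n)
      define c where "c = tmul h p [:f:] - Polynomial.smult f p"
      note cc = coeff_commutator[OF Suc, where h = h and f = f, folded c_def]
      have "c \<in> J"
        unfolding c_def using less.prems f(3) by (intro diff_mem left_mem smult_mem)
      have nd: "\<not> f dvd Polynomial.coeff c n"
        unfolding cc(2) using pf f(2) False irreducible_not_dvd_pderiv[OF char f(1)] irreducible_not_dvd_of_nat[OF char f(1)]
        by (simp add: prime_elem_dvd_mult_iff delta_def del: of_nat_Suc)
      \<comment> \<open>If c = q f, then q has degree at most n, because q f has a nonzero
        coefficient at the degree of q; so the coefficient of c at n would be a multiple of
        f.\<close>
      have "c \<notin> range (\<lambda>q. tmul h q [:f:])"
      proof
        assume "c \<in> range (\<lambda>q. tmul h q [:f:])"
        then obtain q where q: "c = tmul h q [:f:]" by auto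
        have "f \<noteq> 0" using pf by auto
        have "q \<noteq> 0" using q nd by auto
        then have "Polynomial.coeff c (Polynomial.degree q) \<noteq> 0"
          using \<open>f \<noteq> 0\<close> by (simp add: q coeff_tmul_const)
        then have "Polynomial.degree q \<le> n"
          using cc(1) by (meson le_degree le_trans)
        then have "f dvd Polynomial.coeff c n"
          by (simp add: q coeff_tmul_const)
        then show False using nd by simp
      qed
      then show ?thesis
        using less.hyps[of c] cc(1) Suc \<open>c \<in> J\<close> by simp
    qed
  qed
qed

section \<open>Normal forms in the algebra\<close>

lemma ring_of_type_algebra_simps [simp]:
  "carrier ring_of_type_algebra = UNIV"
  "add ring_of_type_algebra = (+)"
  "monoid.mult ring_of_type_algebra = (*)"
  "\<zero>\<^bsub>ring_of_type_algebra\<^esub> = 0"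
  "\<one>\<^bsub>ring_of_type_algebra\<^esub> = 1"
  by (simp_all add: ring_of_type_algebra_def)

lemma (in ring_1) ring_of_type_algebra_ring: "ring (ring_of_type_algebra :: 'a ring)"
proof -
  have "\<exists>y. x + y = 0" for x :: 'a
    using add.right_inverse by blast
  then show ?thesis
    unfolding ring_of_type_algebra_def using add.right_inverse
    by unfold_locales (auto simp: algebra_simps Units_def)
qed

lemma a_inv_ring_of_type_algebra [simp]:
  "\<ominus>\<^bsub>ring_of_type_algebra\<^esub> a = - (a :: 'b::ring_1)"
proof -
  interpret ring "ring_of_type_algebra :: 'b ring" by (rule ring_of_type_algebra_ring)
  show ?thesis by (rule minus_equality) simp_all
qed

lemma a_minus_ring_of_type_algebra [simp]:
  "a \<ominus>\<^bsub>ring_of_type_algebra\<^esub> b = a - (b :: 'b::ring_1)"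
  by (simp add: a_minus_def)

lemma poly_mapping_add_induct [case_names zero single add]:
  assumes "P 0" "\<And>k c. P (Poly_Mapping.single k c)" "\<And>a b. P a \<Longrightarrow> P b \<Longrightarrow> P (a + b)"
  shows "P (a :: 'k \<Rightarrow>\<^sub>0 'b::monoid_add)"
proof (induction a rule: update_induct)
  case (update p k v)
  have "Poly_Mapping.update k v p = p + Poly_Mapping.single k v"
    using update by (intro poly_mapping_eqI) (auto simp: lookup_update lookup_add lookup_single when_def in_keys_iff)
  then show ?case using assms update by simp
qed (rule assms)

lemma single_0_commute:
  fixes a :: "'k::monoid_add \<Rightarrow>\<^sub>0 'b::comm_ring_1"
  shows "Poly_Mapping.single 0 c * a = a * Poly_Mapping.single 0 c"
  by (induction a rule: poly_mapping_add_induct) (simp_all add: mult_single algebra_simps)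

lemma single_0_left_commute:
  fixes a b :: "'k::monoid_add \<Rightarrow>\<^sub>0 'b::comm_ring_1"
  shows "a * (Poly_Mapping.single 0 c * b) = Poly_Mapping.single 0 c * (a * b)"
  using single_0_commute[of c a] by (simp flip: mult.assoc)

section \<open>The normal form homomorphism on the free algebra\<close>

fun list_val :: "'a::field poly \<Rightarrow> gen list \<Rightarrow> 'a poly poly" where
  "list_val h [] = 1"
| "list_val h (gen_x # w) = Polynomial.smult [:0, 1:] (list_val h w)"
| "list_val h (gen_y # w) = left_y h (list_val h w)"

fun word_val :: "'a::field poly \<Rightarrow> word \<Rightarrow> 'a poly poly" where
  "word_val h (Word w) = list_val h w"

lemma list_val_append: "list_val h (u @ v) = tmul h (list_val h u) (list_val h v)"
  by (induction h u rule: list_val.induct) (simp_all add: tmul_smult_left tmul_left_y_left)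

lemma word_val_add: "word_val h (u + v) = tmul h (word_val h u) (word_val h v)"
  by (cases u; cases v) (simp add: list_val_append)

lemma word_val_0 [simp]: "word_val h 0 = 1"
  by (simp add: zero_word_def)

text \<open>The linear extension of \<open>word_val\<close>, which lets the letters of a word act on
  1. As \<open>word_val\<close> turns concatenation into \<open>tmul\<close>, this is the algebra
  homomorphism to R[Y] with the twisted product that sends x to x and y to Y. Scalars enter as
  \<open>[:c:]\<close> and are central because delta kills them.\<close>

definition normal_form :: "'a::field poly \<Rightarrow> 'a free_algebra \<Rightarrow> 'a poly poly"
  where "normal_form h a =
    (\<Sum>w\<in>Poly_Mapping.keys a. Polynomial.smult [:Poly_Mapping.lookup a w:] (word_val h w))"

lemma normal_form_0 [simp]: "normal_form h 0 = 0"
  by (simp add: normal_form_def)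

lemma normal_form_single: "normal_form h (Poly_Mapping.single w c) = Polynomial.smult [:c:] (word_val h w)"
  by (simp add: normal_form_def)

lemma normal_form_add: "normal_form h (a + b) = normal_form h a + normal_form h b"
  unfolding normal_form_def
  by (rule setsum_keys_plus_distrib[where f = "\<lambda>w c. Polynomial.smult [:c:] (word_val h w)"])
     (simp_all flip: smult_add_left)

lemma normal_form_mult: "normal_form h (a * b) = tmul h (normal_form h a) (normal_form h b)"
proof (induction a rule: poly_mapping_add_induct)
  case (single k c)
  show ?case
  proof (induction b rule: poly_mapping_add_induct)
    case (single l d)
    show ?case
      by (simp add: mult_single normal_form_single word_val_add tmul_smult_left tmul_scalar_right)
  qed (simp_all add: normal_form_add distrib_left tmul_add_right)
qed (simp_all add: normal_form_add distrib_right tmul_add_left)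

lemma normal_form_diff: "normal_form h (a - b) = normal_form h a - normal_form h b"
  using normal_form_add[of h "a - b" b] by simp

lemma normal_form_1 [simp]: "normal_form h 1 = 1"
proof -
  have "normal_form h (Poly_Mapping.single 0 1) = 1"
    unfolding normal_form_single by (simp flip: one_pCons)
  then show ?thesis by simp
qed

lemma normal_form_x: "normal_form h free_x = [:[:0, 1:]:]"
  by (simp add: normal_form_single one_pCons)

lemma normal_form_y: "normal_form h free_y = [:0, 1:]"
  by (simp add: normal_form_single flip: one_pCons) (simp add: one_pCons left_y_const)

lemma poly_at_x_eq_sum:
  assumes "Polynomial.degree p \<le> n"
  shows "poly_at_x p = (\<Sum>i\<le>n. Poly_Mapping.single 0 (Polynomial.coeff p i) * free_x ^ i)"
  unfolding poly_at_x_def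
  by (rule sum.mono_neutral_left) (use assms in \<open>auto simp: coeff_eq_0\<close>)

lemma poly_at_x_0 [simp]: "poly_at_x 0 = 0"
  by (simp add: poly_at_x_def)

lemma poly_at_x_const: "poly_at_x [:c:] = Poly_Mapping.single 0 c"
  by (simp add: poly_at_x_def)

lemma poly_at_x_add: "poly_at_x (p + q) = poly_at_x p + poly_at_x q"
proof -
  define n where "n = max (Polynomial.degree p) (Polynomial.degree q)"
  have "Polynomial.degree (p + q) \<le> n" unfolding n_def by (rule degree_add_le_max)
  then show ?thesis
    by (simp add: poly_at_x_eq_sum[of _ n] n_def single_add distrib_right sum.distrib)
qed

lemma poly_at_x_pCons: "poly_at_x (pCons a p) = Poly_Mapping.single 0 a + free_x * poly_at_x p"
proof -
  have "poly_at_x (pCons a p) =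
      (\<Sum>i\<le>Suc (Polynomial.degree p). Poly_Mapping.single 0 (Polynomial.coeff (pCons a p) i) * free_x ^ i)"
    by (rule poly_at_x_eq_sum) (rule degree_pCons_le)
  also have "\<dots> = Poly_Mapping.single 0 a +
      (\<Sum>i\<le>Polynomial.degree p. Poly_Mapping.single 0 (Polynomial.coeff p i) * free_x ^ Suc i)"
    by (simp add: sum.atMost_Suc_shift del: sum.atMost_Suc)
  also have "(\<Sum>i\<le>Polynomial.degree p. Poly_Mapping.single 0 (Polynomial.coeff p i) * free_x ^ Suc i)
      = free_x * poly_at_x p"
    by (simp add: poly_at_x_def sum_distrib_left single_0_left_commute[of free_x])
  finally show ?thesis .
qed

lemma poly_at_x_smult: "poly_at_x (Polynomial.smult c p) = Poly_Mapping.single 0 c * poly_at_x p"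
  by (induction p) (simp_all add: poly_at_x_pCons distrib_left mult_single single_0_left_commute[of free_x])

lemma poly_at_x_mult: "poly_at_x (p * q) = poly_at_x p * poly_at_x q"
  by (induction p) (simp_all add: poly_at_x_pCons poly_at_x_add poly_at_x_smult distrib_right mult.assoc)

lemma normal_form_poly_at_x: "normal_form h (poly_at_x r) = [:r:]"
proof (induction r)
  case (pCons a r)
  then show ?case
    by (simp add: poly_at_x_pCons normal_form_add normal_form_mult normal_form_single normal_form_x)
qed simp

text \<open>A linear section of \<open>normal_form\<close>. It is multiplicative only modulo the
  relations, since a product of lifts need not have its powers of y on the right.\<close>

definition lift :: "'a::field poly poly \<Rightarrow> 'a free_algebra"
  where "lift p = (\<Sum>j\<le>Polynomial.degree p. poly_at_x (Polynomial.coeff p j) * free_y ^ j)"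

lemma lift_eq_sum:
  assumes "Polynomial.degree p \<le> n"
  shows "lift p = (\<Sum>j\<le>n. poly_at_x (Polynomial.coeff p j) * free_y ^ j)"
  unfolding lift_def
  by (rule sum.mono_neutral_left) (use assms in \<open>auto simp: coeff_eq_0\<close>)

lemma lift_0 [simp]: "lift 0 = 0"
  by (simp add: lift_def)

lemma lift_add: "lift (p + q) = lift p + lift q"
proof -
  define n where "n = max (Polynomial.degree p) (Polynomial.degree q)"
  have "Polynomial.degree (p + q) \<le> n" unfolding n_def by (rule degree_add_le_max)
  then show ?thesis
    by (simp add: lift_eq_sum[of _ n] n_def poly_at_x_add distrib_right sum.distrib)
qed

lemma lift_pCons: "lift (pCons a p) = poly_at_x a + lift p * free_y"
proof -
  have "lift (pCons a p) =
      (\<Sum>j\<le>Suc (Polynomial.degree p). poly_at_x (Polynomial.coeff (pCons a p) j) * free_y ^ j)"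
    by (rule lift_eq_sum) (rule degree_pCons_le)
  also have "\<dots> = poly_at_x a +
      (\<Sum>j\<le>Polynomial.degree p. poly_at_x (Polynomial.coeff p j) * free_y ^ Suc j)"
    by (simp add: sum.atMost_Suc_shift del: sum.atMost_Suc)
  also have "(\<Sum>j\<le>Polynomial.degree p. poly_at_x (Polynomial.coeff p j) * free_y ^ Suc j) = lift p * free_y"
    by (simp add: lift_def sum_distrib_right power_Suc2 mult.assoc del: power_Suc)
  finally show ?thesis .
qed

lemma lift_smult: "lift (Polynomial.smult a p) = poly_at_x a * lift p"
  by (induction p) (simp_all add: lift_pCons distrib_left poly_at_x_mult mult.assoc)

lemma normal_form_lift [simp]: "normal_form h (lift p) = p"
proof (induction p)
  case (pCons a p)
  have "tmul h p [:0, 1:] = pCons 0 p"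
    using tmul_pCons_0_right[of h p 1] by (simp flip: one_pCons)
  then show ?case
    using pCons by (simp add: lift_pCons normal_form_add normal_form_mult normal_form_poly_at_x normal_form_y)
qed simp

context
  fixes h :: "'a::field poly"
begin

lemma ideal_Ah_relations: "ideal (Ah_relations h) ring_of_type_algebra"
  unfolding Ah_relations_def by (rule ring.genideal_ideal[OF ring_of_type_algebra_ring]) simp

lemma Ah_relation_mem: "free_y * free_x - (free_x * free_y + poly_at_x h) \<in> Ah_relations h"
  unfolding Ah_relations_def by (rule ring.genideal_self'[OF ring_of_type_algebra_ring]) simp

lemma Ah_relations_add: "a \<in> Ah_relations h \<Longrightarrow> b \<in> Ah_relations h \<Longrightarrow> a + b \<in> Ah_relations h"
  using additive_subgroup.a_closed[OF ideal.axioms(1)[OF ideal_Ah_relations]] by simp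

lemma Ah_relations_left: "a \<in> Ah_relations h \<Longrightarrow> b * a \<in> Ah_relations h"
  using ideal.I_l_closed[OF ideal_Ah_relations] by simp

lemma Ah_relations_right: "a \<in> Ah_relations h \<Longrightarrow> a * b \<in> Ah_relations h"
  using ideal.I_r_closed[OF ideal_Ah_relations] by simp

lemma Ah_relations_0: "0 \<in> Ah_relations h"
  using additive_subgroup.zero_closed[OF ideal.axioms(1)[OF ideal_Ah_relations]] by simp

text \<open>The kernel of \<open>normal_form\<close> is an ideal, so it suffices that it contains
  the generator of the relations. This is the computation y x = x y + delta(x) with delta(x) =
  h.\<close>

lemma normal_form_Ah_relations:
  assumes "a \<in> Ah_relations h"
  shows "normal_form h a = 0"
proof -
  interpret ring "ring_of_type_algebra :: 'a free_algebra ring" by (rule ring_of_type_algebra_ring)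
  define K where "K = {a. normal_form h a = 0}"
  have "ideal K ring_of_type_algebra"
  proof (rule idealI)
    show "subgroup K (add_monoid ring_of_type_algebra)"
    proof (rule add.subgroupI)
      show "K \<noteq> {}" by (auto simp: K_def intro: exI[of _ 0])
      fix a b assume "a \<in> K" "b \<in> K"
      then show "a \<oplus>\<^bsub>ring_of_type_algebra\<^esub> b \<in> K" by (simp add: K_def normal_form_add)
    next
      fix a assume "a \<in> K"
      then show "\<ominus>\<^bsub>ring_of_type_algebra\<^esub> a \<in> K"
        using normal_form_diff[of h 0 a] by (simp add: K_def)
    qed simp
  qed (auto simp: K_def normal_form_mult ring_axioms)
  moreover have "free_y * free_x - (free_x * free_y + poly_at_x h) \<in> K"
    by (simp add: K_def normal_form_diff normal_form_add normal_form_mult normal_form_x normal_form_y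
        normal_form_poly_at_x tmul_y_left left_y_const) (simp add: delta_def pderiv_pCons)
  ultimately have "Ah_relations h \<subseteq> K"
    unfolding Ah_relations_def by (intro genideal_minimal) auto
  then show ?thesis using assms by (auto simp: K_def)
qed

text \<open>The defining relation propagates from x to all of R by the Leibniz rule: for x r it is
  used once to move y past x, and the induction hypothesis moves y past r.\<close>

lemma y_poly_at_x_cong:
  "free_y * poly_at_x r - (poly_at_x r * free_y + poly_at_x (delta h r)) \<in> Ah_relations h"
proof (induction r)
  case (pCons a r)
  have d: "delta h (pCons a r) = h * r + [:0, 1:] * delta h r"
    by (simp add: delta_def pderiv_pCons algebra_simps)
  have e: "poly_at_x (delta h (pCons a r)) = poly_at_x h * poly_at_x r + free_x * poly_at_x (delta h r)"
    unfolding d by (simp add: poly_at_x_add poly_at_x_mult poly_at_x_pCons)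
  have "free_y * poly_at_x (pCons a r) - (poly_at_x (pCons a r) * free_y + poly_at_x (delta h (pCons a r)))
    = (free_y * free_x - (free_x * free_y + poly_at_x h)) * poly_at_x r
      + free_x * (free_y * poly_at_x r - (poly_at_x r * free_y + poly_at_x (delta h r)))"
    unfolding e poly_at_x_pCons
    by (simp add: algebra_simps flip: single_0_commute[of a free_y])
  then show ?case
    using pCons Ah_relation_mem by (simp only: Ah_relations_add Ah_relations_left Ah_relations_right)
qed (simp add: Ah_relations_0)

lemma y_lift_cong: "free_y * lift p - lift (left_y h p) \<in> Ah_relations h"
proof (induction p)
  case (pCons a p)
  have "free_y * lift (pCons a p) - lift (left_y h (pCons a p))
    = (free_y * poly_at_x a - (poly_at_x a * free_y + poly_at_x (delta h a)))
     + (free_y * lift p - lift (left_y h p)) * free_y"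
    by (simp add: left_y_pCons lift_add lift_pCons algebra_simps mult.assoc)
  then show ?case
    using pCons y_poly_at_x_cong by (simp only: Ah_relations_add Ah_relations_right)
qed (simp add: Ah_relations_0)

text \<open>A word is rewritten letter by letter: x needs nothing, and y enters a normal form by
  \<open>y_lift_cong\<close>. So the monomials x^i y^j span A_h; their independence comes from
  \<open>normal_form_lift\<close> and \<open>normal_form_Ah_relations\<close>.\<close>

lemma lift_normal_form_cong: "a - lift (normal_form h a) \<in> Ah_relations h"
proof (induction a rule: poly_mapping_add_induct)
  case (single k c)
  obtain w where k: "k = Word w" by (cases k)
  have w: "Poly_Mapping.single (Word w) 1 - lift (list_val h w) \<in> Ah_relations h"
  proof (induction w)
    case Nil
    then show ?case
      by (simp add: one_pCons lift_pCons poly_at_x_const Ah_relations_0 flip: zero_word_def)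
  next
    case (Cons g w)
    show ?case
    proof (cases g)
      case gen_x
      have "Poly_Mapping.single (Word (g # w)) 1 - lift (list_val h (g # w)) =
         free_x * (Poly_Mapping.single (Word w) 1 - lift (list_val h w))"
        by (simp add: gen_x lift_smult poly_at_x_pCons right_diff_distrib mult_single)
      then show ?thesis using Cons Ah_relations_left by simp
    next
      case gen_y
      have "Poly_Mapping.single (Word (g # w)) 1 - lift (list_val h (g # w)) =
         free_y * (Poly_Mapping.single (Word w) 1 - lift (list_val h w))
         + (free_y * lift (list_val h w) - lift (left_y h (list_val h w)))"
        by (simp add: gen_y right_diff_distrib mult_single)
      then show ?thesis
        using Cons y_lift_cong by (simp only: Ah_relations_left Ah_relations_add)
    qed
  qed
  have "Poly_Mapping.single k c - lift (normal_form h (Poly_Mapping.single k c))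
    = Poly_Mapping.single 0 c * (Poly_Mapping.single (Word w) 1 - lift (list_val h w))"
    by (simp add: k normal_form_single lift_smult poly_at_x_const right_diff_distrib mult_single)
  then show ?case using w Ah_relations_left by simp
next
  case (add a b)
  have "a + b - lift (normal_form h (a + b)) = (a - lift (normal_form h a)) + (b - lift (normal_form h b))"
    by (simp add: normal_form_add lift_add)
  then show ?case using add Ah_relations_add by metis
qed (simp add: Ah_relations_0)

lemma Ah_relations_eq: "Ah_relations h = {a. normal_form h a = 0}"
  proof -
  have "a \<in> Ah_relations h" if "normal_form h a = 0" for a
    using lift_normal_form_cong[of a] that by simp
  then show ?thesis using normal_form_Ah_relations by blast
qed

end

section \<open>The algebra A_h as R[Y] with the twisted product\<close>

definition nf_elem :: "'a::field poly \<Rightarrow> 'a poly poly \<Rightarrow> 'a free_algebra set"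
  where "nf_elem h p = Ah_relations h +>\<^bsub>ring_of_type_algebra\<^esub> lift p"

context
  fixes h :: "'a::field poly"
begin

interpretation ideal "Ah_relations h" "ring_of_type_algebra :: 'a free_algebra ring"
  by (rule ideal_Ah_relations)

lemma ring_Ah: "ring (Ah h)"
  unfolding Ah_def by (rule quotient_is_ring)

lemma coset_eq_nf_elem: "Ah_relations h +>\<^bsub>ring_of_type_algebra\<^esub> a = nf_elem h (normal_form h a)"
  unfolding nf_elem_def
  using lift_normal_form_cong[of a h] quotient_eq_iff_same_a_r_cos[OF ideal_Ah_relations, of a "lift (normal_form h a)"]
  by simp

text \<open>Uniqueness of normal forms: \<open>normal_form\<close> recovers p from the class of
  \<open>lift p\<close>. With \<open>carrier_Ah\<close>, \<open>nf_elem_add\<close> and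
  \<open>nf_elem_mult\<close> this identifies A_h with R[Y] under \<open>tmul\<close>.\<close>

lemma nf_elem_inject: "nf_elem h p = nf_elem h q \<longleftrightarrow> p = q"
proof
  assume "nf_elem h p = nf_elem h q"
  then have "lift p - lift q \<in> Ah_relations h"
    unfolding nf_elem_def
    using quotient_eq_iff_same_a_r_cos[OF ideal_Ah_relations, of "lift p" "lift q"] by simp
  then show "p = q" by (simp add: Ah_relations_eq normal_form_diff)
qed simp

lemma carrier_Ah: "carrier (Ah h) = range (nf_elem h)"
proof -
  have "carrier (Ah h) = range (\<lambda>a. nf_elem h (normal_form h a))"
    by (auto simp: Ah_def FactRing_def A_RCOSETS_def' coset_eq_nf_elem)
  moreover have "nf_elem h p \<in> range (\<lambda>a. nf_elem h (normal_form h a))" for p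
    by (rule range_eqI[of _ _ "lift p"]) simp
  ultimately show ?thesis by auto
qed

lemma nf_elem_closed [simp]: "nf_elem h p \<in> carrier (Ah h)"
  by (simp add: carrier_Ah)

lemma nf_elem_add: "nf_elem h p \<oplus>\<^bsub>Ah h\<^esub> nf_elem h q = nf_elem h (p + q)"
  unfolding nf_elem_def Ah_def FactRing_def
  by (simp add: a_rcos_sum[simplified] lift_add)

lemma nf_elem_mult: "nf_elem h p \<otimes>\<^bsub>Ah h\<^esub> nf_elem h q = nf_elem h (tmul h p q)"
proof -
  have "nf_elem h p \<otimes>\<^bsub>Ah h\<^esub> nf_elem h q = Ah_relations h +>\<^bsub>ring_of_type_algebra\<^esub> (lift p * lift q)"
    unfolding nf_elem_def Ah_def FactRing_def by (simp add: rcoset_mult_add[simplified])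
  then show ?thesis by (simp add: coset_eq_nf_elem normal_form_mult)
qed

lemma nf_elem_0: "\<zero>\<^bsub>Ah h\<^esub> = nf_elem h 0"
  unfolding nf_elem_def Ah_def FactRing_def
  using a_rcos_const[of 0] by (simp add: Ah_relations_0)

lemma nf_elem_1: "\<one>\<^bsub>Ah h\<^esub> = nf_elem h 1"
  unfolding Ah_def FactRing_def by (simp add: coset_eq_nf_elem)

lemma Ah_emb_eq: "Ah_emb h r = nf_elem h [:r:]"
  by (simp add: Ah_emb_def coset_eq_nf_elem normal_form_poly_at_x)

lemma Ah_y_eq: "Ah_y h = nf_elem h [:0, 1:]"
  by (simp add: Ah_y_def coset_eq_nf_elem normal_form_y)

lemma Ah_y_pow: "Ah_y h [^]\<^bsub>Ah h\<^esub> (j::nat) = nf_elem h (Polynomial.monom 1 j)"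
proof (induction j)
  case 0
  then show ?case by (simp add: nf_elem_1 monom_0 one_pCons)
next
  case (Suc j)
  have "tmul h (Polynomial.monom 1 j) [:0, 1:] = Polynomial.monom 1 (Suc j)"
    using tmul_pCons_0_right[of h "Polynomial.monom 1 j" 1] by (simp add: monom_Suc flip: one_pCons)
  then show ?case using Suc by (simp add: Ah_y_eq nf_elem_mult)
qed

lemma nf_elem_sum: "(\<Oplus>\<^bsub>Ah h\<^esub>j\<in>S. nf_elem h (p j)) = nf_elem h (\<Sum>j\<in>S. p j)" if "finite S"
  using that
proof (induction S rule: finite_induct)
  case empty
  then show ?case by (simp add: nf_elem_0 finsum_def finprod_def)
next
  interpret A: ring "Ah h" by (rule ring_Ah)
  case (insert x S)
  then show ?case by (simp add: A.finsum_insert nf_elem_add)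
qed

text \<open>The coefficients of \<open>Ah_elem h g\<close> stand to the right of the powers of y; \<open>right_form h g\<close>
  is its normal form, with coefficients to the left.\<close>

definition right_form :: "'a poly poly \<Rightarrow> 'a poly poly"
  where "right_form g = (\<Sum>j\<le>Polynomial.degree g. tmul h (Polynomial.monom 1 j) [:Polynomial.coeff g j:])"

lemma Ah_elem_eq: "Ah_elem h g = nf_elem h (right_form g)"
  unfolding Ah_elem_def right_form_def by (simp add: Ah_y_pow Ah_emb_eq nf_elem_mult nf_elem_sum)

text \<open>Modulo f the powers of y may be moved across the coefficients, so
  \<open>Ah_elem h g\<close> may be replaced by g wherever only its class modulo f matters.\<close>

lemma right_form_cong:
  assumes "f dvd h"
  shows "[:f:] dvd right_form g - g"
proof -
  have "right_form g - g = (\<Sum>j\<le>Polynomial.degree g.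
      tmul h (Polynomial.monom 1 j) [:Polynomial.coeff g j:] - Polynomial.monom 1 j * [:Polynomial.coeff g j:])"
    unfolding right_form_def sum_subtractf
    by (subst (4) poly_as_sum_of_monoms[symmetric]) (simp add: smult_monom mult.commute)
  then show ?thesis
    by (simp only:) (intro dvd_sum tmul_cong_mult[OF assms])
qed

end

section \<open>Left modules and extension of scalars\<close>

context left_module
begin

lemma smult_l_zero: "u \<in> carrier M \<Longrightarrow> \<zero>\<^bsub>A\<^esub> \<odot>\<^bsub>M\<^esub> u = \<zero>\<^bsub>M\<^esub>"
  using smult_l_distr[of "\<zero>\<^bsub>A\<^esub>" "\<zero>\<^bsub>A\<^esub>" u] smult_closed[of "\<zero>\<^bsub>A\<^esub>" u]
  by (metis A.zero_closed A.r_zero M.add.r_cancel_one)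

lemma smult_r_zero: "a \<in> carrier A \<Longrightarrow> a \<odot>\<^bsub>M\<^esub> \<zero>\<^bsub>M\<^esub> = \<zero>\<^bsub>M\<^esub>"
  using smult_r_distr[of a "\<zero>\<^bsub>M\<^esub>" "\<zero>\<^bsub>M\<^esub>"] smult_closed[of a "\<zero>\<^bsub>M\<^esub>"]
  by (metis M.zero_closed M.r_zero M.add.r_cancel_one)

lemma smult_l_minus:
  "a \<in> carrier A \<Longrightarrow> u \<in> carrier M \<Longrightarrow> (\<ominus>\<^bsub>A\<^esub> a) \<odot>\<^bsub>M\<^esub> u = \<ominus>\<^bsub>M\<^esub> (a \<odot>\<^bsub>M\<^esub> u)"
  using smult_l_distr[of "\<ominus>\<^bsub>A\<^esub> a" a u] smult_l_zero[of u]
  by (metis A.a_inv_closed A.l_neg M.minus_equality smult_closed)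

lemma submoduleI:
  assumes "N \<subseteq> carrier M" "\<zero>\<^bsub>M\<^esub> \<in> N"
    and "\<And>u v. u \<in> N \<Longrightarrow> v \<in> N \<Longrightarrow> u \<oplus>\<^bsub>M\<^esub> v \<in> N"
    and "\<And>a u. a \<in> carrier A \<Longrightarrow> u \<in> N \<Longrightarrow> a \<odot>\<^bsub>M\<^esub> u \<in> N"
  shows "submodule N A M"
proof -
  have "\<ominus>\<^bsub>M\<^esub> u \<in> N" if "u \<in> N" for u
  proof -
    have "\<ominus>\<^bsub>M\<^esub> u = (\<ominus>\<^bsub>A\<^esub> \<one>\<^bsub>A\<^esub>) \<odot>\<^bsub>M\<^esub> u"
      using that assms(1) by (auto simp: smult_l_minus smult_one)
    then show ?thesis using assms(4) that by simp
  qed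
  then have "subgroup N (add_monoid M)"
    using assms by (intro M.add.subgroupI) auto
  then show ?thesis
    using assms(4) by (simp add: submodule_def submodule_axioms_def)
qed

text \<open>A nonzero submodule contains some a u \<noteq> 0, hence u itself by \<open>inv\<close>,
  hence everything. Both U(m) and L(m, g) are treated with this criterion.\<close>

lemma irreducible_moduleI_cyclic:
  assumes u: "u \<in> carrier M" "u \<noteq> \<zero>\<^bsub>M\<^esub>"
    and cyc: "\<And>v. v \<in> carrier M \<Longrightarrow> \<exists>a\<in>carrier A. v = a \<odot>\<^bsub>M\<^esub> u"
    and inv: "\<And>a. a \<in> carrier A \<Longrightarrow> a \<odot>\<^bsub>M\<^esub> u \<noteq> \<zero>\<^bsub>M\<^esub> \<Longrightarrow> \<exists>b\<in>carrier A. b \<odot>\<^bsub>M\<^esub> (a \<odot>\<^bsub>M\<^esub> u) = u"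
  shows "irreducible_module A M"
  unfolding irreducible_module_def
proof (intro conjI allI impI)
  show "left_module A M" by (rule left_module_axioms)
  show "carrier M \<noteq> {\<zero>\<^bsub>M\<^esub>}" using u by auto
  fix N assume "submodule N A M"
  then interpret N: submodule N A M .
  have sub: "N \<subseteq> carrier M" using N.subset by simp
  have zero: "\<zero>\<^bsub>M\<^esub> \<in> N" using N.one_closed by simp
  show "N = {\<zero>\<^bsub>M\<^esub>} \<or> N = carrier M"
  proof (cases "N = {\<zero>\<^bsub>M\<^esub>}")
    case False
    then obtain v where v: "v \<in> N" "v \<noteq> \<zero>\<^bsub>M\<^esub>" using zero by auto
    then obtain a where a: "a \<in> carrier A" "v = a \<odot>\<^bsub>M\<^esub> u" using cyc sub by blast
    then obtain b where "b \<in> carrier A" "b \<odot>\<^bsub>M\<^esub> v = u" using inv v by blast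
    then have "u \<in> N" using v N.smult_closed by blast
    then have "carrier M \<subseteq> N" using cyc N.smult_closed by blast
    then show ?thesis using sub by blast
  qed simp
qed

end

text \<open>The multiples of u form a submodule, which is nonzero because it contains u.\<close>

lemma irreducible_module_cyclic:
  assumes "irreducible_module A M" "u \<in> carrier M" "u \<noteq> \<zero>\<^bsub>M\<^esub>" "v \<in> carrier M"
  obtains a where "a \<in> carrier A" "a \<odot>\<^bsub>M\<^esub> u = v"
proof -
  interpret left_module A M using assms(1) by (simp add: irreducible_module_def)
  define N where "N = {a \<odot>\<^bsub>M\<^esub> u | a. a \<in> carrier A}"
  have "submodule N A M"
  proof (rule submoduleI)
    show "N \<subseteq> carrier M" using assms(2) smult_closed by (auto simp: N_def)
    show "\<zero>\<^bsub>M\<^esub> \<in> N" using smult_l_zero[OF assms(2)] by (force simp: N_def)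
    fix v w assume "v \<in> N" "w \<in> N"
    then obtain a b where "a \<in> carrier A" "b \<in> carrier A" "v = a \<odot>\<^bsub>M\<^esub> u" "w = b \<odot>\<^bsub>M\<^esub> u"
      by (auto simp: N_def)
    then show "v \<oplus>\<^bsub>M\<^esub> w \<in> N"
      using smult_l_distr[of a b u] assms(2) by (auto simp: N_def intro!: exI[of _ "a \<oplus>\<^bsub>A\<^esub> b"])
  next
    fix a v assume "a \<in> carrier A" "v \<in> N"
    then obtain b where "a \<in> carrier A" "b \<in> carrier A" "v = b \<odot>\<^bsub>M\<^esub> u"
      by (auto simp: N_def)
    then show "a \<odot>\<^bsub>M\<^esub> v \<in> N"
      using smult_assoc[of a b u] assms(2) by (auto simp: N_def intro!: exI[of _ "a \<otimes>\<^bsub>A\<^esub> b"])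
  qed
  moreover have "u \<in> N" using smult_one[OF assms(2)] by (force simp: N_def)
  ultimately have "N = carrier M"
    using assms(1,3) by (auto simp: irreducible_module_def)
  then have "v \<in> N" using assms(4) by simp
  then obtain a where "a \<in> carrier A" "v = a \<odot>\<^bsub>M\<^esub> u" unfolding N_def by blast
  then show thesis using that by simp
qed

lemma left_module_image:
  assumes "left_module A M"
    and Q_carr: "carrier Q = \<pi> ` carrier M"
    and Q_add: "\<And>u v. u \<in> carrier M \<Longrightarrow> v \<in> carrier M \<Longrightarrow> \<pi> u \<oplus>\<^bsub>Q\<^esub> \<pi> v = \<pi> (u \<oplus>\<^bsub>M\<^esub> v)"
    and Q_zero: "\<zero>\<^bsub>Q\<^esub> = \<pi> \<zero>\<^bsub>M\<^esub>"
    and Q_smult: "\<And>a u. a \<in> carrier A \<Longrightarrow> u \<in> carrier M \<Longrightarrow> a \<odot>\<^bsub>Q\<^esub> \<pi> u = \<pi> (a \<odot>\<^bsub>M\<^esub> u)"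
  shows "left_module A Q"
proof -
  interpret left_module A M by fact
  have "abelian_group Q"
  proof (rule abelian_groupI)
    fix x assume "x \<in> carrier Q"
    then obtain u where u: "u \<in> carrier M" "x = \<pi> u" using Q_carr by auto
    then have "\<pi> (\<ominus>\<^bsub>M\<^esub> u) \<oplus>\<^bsub>Q\<^esub> x = \<zero>\<^bsub>Q\<^esub>" by (simp add: Q_add Q_zero M.l_neg)
    then show "\<exists>y\<in>carrier Q. y \<oplus>\<^bsub>Q\<^esub> x = \<zero>\<^bsub>Q\<^esub>" using u Q_carr by auto
  qed (auto simp: Q_carr Q_add Q_zero M.a_ac)
  then show ?thesis
    by (intro left_module.intro left_module_axioms.intro A.ring_axioms)
      (auto simp: Q_carr Q_smult Q_add smult_closed smult_l_distr smult_r_distr smult_assoc smult_one)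
qed

context
  fixes A :: "('r, 'k) ring_scheme" and M :: "('r, 'm, 'l) module_scheme" and N
  assumes lm: "left_module A M" and sub: "submodule N A M"
begin

interpretation left_module A M by (rule lm)

interpretation N: abelian_subgroup N M
  using sub by (intro abelian_subgroupI3 additive_subgroup.intro M.abelian_group_axioms)
    (simp add: submodule_def)

lemma carrier_quotient_module: "carrier (quotient_module M N) = (\<lambda>u. N +>\<^bsub>M\<^esub> u) ` carrier M"
  by (auto simp: quotient_module_def A_RCOSETS_def')

lemma zero_quotient_module: "\<zero>\<^bsub>quotient_module M N\<^esub> = N"
  by (simp add: quotient_module_def)

lemma quotient_module_coset_eq_zero_iff:
  assumes "u \<in> carrier M"
  shows "N +>\<^bsub>M\<^esub> u = N \<longleftrightarrow> u \<in> N"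
  using N.a_rcos_self[OF assms] N.a_rcos_const by auto

lemma add_quotient_module:
  assumes "u \<in> carrier M" "v \<in> carrier M"
  shows "(N +>\<^bsub>M\<^esub> u) \<oplus>\<^bsub>quotient_module M N\<^esub> (N +>\<^bsub>M\<^esub> v) = N +>\<^bsub>M\<^esub> (u \<oplus>\<^bsub>M\<^esub> v)"
  using N.a_rcos_sum[OF assms] by (simp add: quotient_module_def)

text \<open>The product in the quotient is a union over all representatives. Stability of N under a
  makes the members of the union equal, so that it collapses to a single coset.\<close>

lemma smult_quotient_module:
  assumes "a \<in> carrier A" "u \<in> carrier M"
  shows "a \<odot>\<^bsub>quotient_module M N\<^esub> (N +>\<^bsub>M\<^esub> u) = N +>\<^bsub>M\<^esub> (a \<odot>\<^bsub>M\<^esub> u)"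
proof -
  have "N +>\<^bsub>M\<^esub> (a \<odot>\<^bsub>M\<^esub> w) = N +>\<^bsub>M\<^esub> (a \<odot>\<^bsub>M\<^esub> u)" if w: "w \<in> N +>\<^bsub>M\<^esub> u" for w
  proof -
    obtain n where n: "n \<in> N" "w = n \<oplus>\<^bsub>M\<^esub> u"
      using w by (auto simp: a_r_coset_def')
    have nc: "n \<in> carrier M" using n N.a_subset by auto
    have an: "a \<odot>\<^bsub>M\<^esub> n \<in> N"
      using submodule.smult_closed[OF sub assms(1) n(1)] .
    have "a \<odot>\<^bsub>M\<^esub> w = a \<odot>\<^bsub>M\<^esub> n \<oplus>\<^bsub>M\<^esub> a \<odot>\<^bsub>M\<^esub> u"
      using n nc assms smult_r_distr by simp
    then have "a \<odot>\<^bsub>M\<^esub> w \<in> N +>\<^bsub>M\<^esub> (a \<odot>\<^bsub>M\<^esub> u)"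
      using an by (auto simp: a_r_coset_def')
    then show ?thesis
      using N.a_repr_independence'[of "a \<odot>\<^bsub>M\<^esub> w" "a \<odot>\<^bsub>M\<^esub> u"] assms smult_closed by simp
  qed
  then have "(\<Union>w\<in>N +>\<^bsub>M\<^esub> u. N +>\<^bsub>M\<^esub> (a \<odot>\<^bsub>M\<^esub> w)) = (\<Union>w\<in>N +>\<^bsub>M\<^esub> u. N +>\<^bsub>M\<^esub> (a \<odot>\<^bsub>M\<^esub> u))"
    by (rule SUP_cong[OF refl])
  also have "\<dots> = N +>\<^bsub>M\<^esub> (a \<odot>\<^bsub>M\<^esub> u)"
    using N.a_rcos_self[OF assms(2)] by (metis SUP_const empty_iff)
  finally show ?thesis by (simp add: quotient_module_def)
qed

lemma left_module_quotient: "left_module A (quotient_module M N)"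
proof (rule left_module_image[OF lm, where \<pi> = "\<lambda>u. N +>\<^bsub>M\<^esub> u"])
  show "\<zero>\<^bsub>quotient_module M N\<^esub> = N +>\<^bsub>M\<^esub> \<zero>\<^bsub>M\<^esub>"
    using quotient_module_coset_eq_zero_iff[of "\<zero>\<^bsub>M\<^esub>"] N.zero_closed
    by (simp add: zero_quotient_module)
qed (simp_all add: carrier_quotient_module add_quotient_module smult_quotient_module)

end

lemma left_module_regular:
  assumes "ring A"
  shows "left_module A (regular_module A)"
proof -
  interpret ring A by fact
  have "abelian_group (regular_module A)"
  proof (rule abelian_groupI)
    fix x assume "x \<in> carrier (regular_module A)"
    then have "\<ominus>\<^bsub>A\<^esub> x \<in> carrier A" "\<ominus>\<^bsub>A\<^esub> x \<oplus>\<^bsub>A\<^esub> x = \<zero>\<^bsub>A\<^esub>"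
      by (simp_all add: regular_module_def l_neg)
    then show "\<exists>y\<in>carrier (regular_module A). y \<oplus>\<^bsub>regular_module A\<^esub> x = \<zero>\<^bsub>regular_module A\<^esub>"
      by (auto simp: regular_module_def)
  qed (simp_all add: regular_module_def a_ac)
  then show ?thesis
    by (intro left_module.intro left_module_axioms.intro)
      (auto simp: regular_module_def l_distr r_distr m_assoc ring_axioms)
qed


section \<open>The tensor product over R as a left module\<close>

locale scalar_extension =
  fixes A :: "('s, 'k) ring_scheme" and R :: "('r, 'j) ring_scheme" and \<phi> :: "'r \<Rightarrow> 's"
    and N :: "('r, 'n, 'l) module_scheme"
  assumes ring_A: "ring A" and module_N: "left_module R N"
    and \<phi>_closed: "r \<in> carrier R \<Longrightarrow> \<phi> r \<in> carrier A"
begin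

interpretation A: ring A by (rule ring_A)
interpretation N: left_module R N by (rule module_N)

definition S where "S = carrier A \<times> carrier N"
definition T where "T = free_Abelian_group S"
definition K where "K = generate T (tensor_relations A R \<phi> N)"
definition cls where "cls w = K #>\<^bsub>T\<^esub> w"
definition act where "act a w = frag_extend (\<lambda>(b, n). frag_of (a \<otimes>\<^bsub>A\<^esub> b, n)) w"

abbreviation E where "E \<equiv> extend_scalars A R \<phi> N"

lemma T_simps [simp]: "w \<in> carrier T \<longleftrightarrow> Poly_Mapping.keys w \<subseteq> S" "\<one>\<^bsub>T\<^esub> = 0" "v \<otimes>\<^bsub>T\<^esub> w = v + w"
  by (simp_all add: T_def)

lemma inv_T [simp]: "Poly_Mapping.keys w \<subseteq> S \<Longrightarrow> inv\<^bsub>T\<^esub> w = - w"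
  by (simp add: T_def)

lemma mem_S_iff: "(b, n) \<in> S \<longleftrightarrow> b \<in> carrier A \<and> n \<in> carrier N"
  by (simp add: S_def)

lemma keys_add_S: "Poly_Mapping.keys v \<subseteq> S \<Longrightarrow> Poly_Mapping.keys w \<subseteq> S \<Longrightarrow> Poly_Mapping.keys (v + w) \<subseteq> S"
  using Poly_Mapping.keys_add[of v w] by blast

lemma keys_diff_S: "Poly_Mapping.keys v \<subseteq> S \<Longrightarrow> Poly_Mapping.keys w \<subseteq> S \<Longrightarrow> Poly_Mapping.keys (v - w) \<subseteq> S"
  using keys_diff[of v w] by blast

sublocale T: comm_group T
  unfolding T_def by (rule abelian_free_Abelian_group)

lemma relations_subset: "tensor_relations A R \<phi> N \<subseteq> carrier T"
  unfolding tensor_relations_def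
  by (safe; unfold T_simps; intro keys_diff_S; simp add: keys_frag_of S_def \<phi>_closed N.smult_closed)

lemma keys_S_induct [consumes 1, case_names zero diff frag]:
  assumes "Poly_Mapping.keys w \<subseteq> S" "P 0"
    "\<And>v w. Poly_Mapping.keys v \<subseteq> S \<Longrightarrow> Poly_Mapping.keys w \<subseteq> S \<Longrightarrow> P v \<Longrightarrow> P w \<Longrightarrow> P (v - w)"
    "\<And>b n. b \<in> carrier A \<Longrightarrow> n \<in> carrier N \<Longrightarrow> P (frag_of (b, n))"
  shows "P w"
  using assms(1) by (rule free_Abelian_group_induct) (use assms(2-) in \<open>auto simp: S_def\<close>)

lemma K_subgroup: "subgroup K T"
  unfolding K_def by (rule T.generate_is_subgroup[OF relations_subset])

lemma K_normal: "normal K T"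
  using K_subgroup by (rule T.subgroup_imp_normal)

lemma K_subset: "K \<subseteq> carrier T"
  using K_subgroup by (rule subgroup.subset)

lemma K_keys: "w \<in> K \<Longrightarrow> Poly_Mapping.keys w \<subseteq> S"
  by (drule subsetD[OF K_subset]) simp

lemma K_add: "v \<in> K \<Longrightarrow> w \<in> K \<Longrightarrow> v + w \<in> K"
  using subgroup.m_closed[OF K_subgroup] by simp

lemma K_minus: "v \<in> K \<Longrightarrow> - v \<in> K"
  using subgroup.m_inv_closed[OF K_subgroup] by (simp add: K_keys)

lemma K_diff: "v \<in> K \<Longrightarrow> w \<in> K \<Longrightarrow> v - w \<in> K"
  using K_add[of v "- w"] K_minus by simp

lemma K_0: "0 \<in> K"
  using subgroup.one_closed[OF K_subgroup] by simp

lemma K_relation: "v \<in> tensor_relations A R \<phi> N \<Longrightarrow> v \<in> K"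
  unfolding K_def by (rule generate.incl)

text \<open>Closure under differences together with 0 covers both the products and the inverses in
  \<open>generate\<close>, so additive maps need only be checked on the relations.\<close>

lemma K_induct [consumes 1, case_names zero rel diff]:
  assumes "w \<in> K" "P 0" "\<And>v. v \<in> tensor_relations A R \<phi> N \<Longrightarrow> P v"
    "\<And>v w. v \<in> K \<Longrightarrow> w \<in> K \<Longrightarrow> P v \<Longrightarrow> P w \<Longrightarrow> P (v - w)"
  shows "P w"
proof -
  have "w \<in> K \<and> P w"
    using assms(1) unfolding K_def
  proof (induction rule: generate.induct)
    case one
    then show ?case using K_0 assms by (simp add: K_def)
  next
    case (incl v)
    then show ?case using K_relation assms by (simp add: K_def)
  next
    case (inv v)
    then show ?case
      using assms(4)[of 0 v] K_0 K_relation[of v] assms(2,3) K_minus[of v] by (simp add: K_keys flip: K_def)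
  next
    case (eng v w)
    then have "- w \<in> K \<and> P (- w)"
      using assms(4)[of 0 w] K_0 K_minus[of w] assms(2) by (simp flip: K_def)
    then show ?case
      using eng assms(4)[of v "- w"] K_add[of v w] by (simp flip: K_def)
  qed
  then show ?thesis ..
qed

lemma cls_eq_iff:
  assumes "Poly_Mapping.keys v \<subseteq> S" "Poly_Mapping.keys w \<subseteq> S"
  shows "cls v = cls w \<longleftrightarrow> v - w \<in> K"
proof -
  have "cls v = cls w \<longleftrightarrow> v \<in> cls w"
    using T.rcos_self[OF _ K_subgroup, of v] T.repr_independence[OF _ _ K_subgroup, of v w] assms
    by (auto simp: cls_def)
  also have "\<dots> \<longleftrightarrow> v - w \<in> K"
    using subgroup.rcos_module[OF K_subgroup T.is_group, of w v] assms by (simp add: cls_def)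
  finally show ?thesis .
qed

lemma carrier_E: "carrier E = cls ` carrier T"
  unfolding extend_scalars_def Let_def cls_def K_def
  by (simp add: carrier_FactGroup flip: T_def S_def)

lemma cls_closed: "Poly_Mapping.keys w \<subseteq> S \<Longrightarrow> cls w \<in> carrier E"
  by (auto simp: carrier_E)

lemma cls_0: "cls 0 = K"
  unfolding cls_def using T.coset_join2[OF _ K_subgroup] K_0 by simp

lemma zero_E: "\<zero>\<^bsub>E\<^esub> = cls 0"
  unfolding cls_0 extend_scalars_def Let_def K_def
  by (simp flip: T_def S_def)

lemma add_E:
  assumes "Poly_Mapping.keys v \<subseteq> S" "Poly_Mapping.keys w \<subseteq> S"
  shows "cls v \<oplus>\<^bsub>E\<^esub> cls w = cls (v + w)"
proof -
  have "cls v \<oplus>\<^bsub>E\<^esub> cls w = cls v <#>\<^bsub>T\<^esub> cls w"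
    unfolding extend_scalars_def Let_def by (simp add: FactGroup_def T_def S_def)
  then show ?thesis
    unfolding cls_def using normal.rcos_sum[OF K_normal] assms by simp
qed

lemma act_of [simp]: "act a (frag_of (b, n)) = frag_of (a \<otimes>\<^bsub>A\<^esub> b, n)"
  by (simp add: act_def)

lemma act_0 [simp]: "act a 0 = 0"
  by (simp add: act_def)

lemma act_diff: "act a (v - w) = act a v - act a w"
  by (simp add: act_def frag_extend_diff)

lemma act_add: "act a (v + w) = act a v + act a w"
  by (simp add: act_def frag_extend_add)

lemma act_keys:
  assumes "a \<in> carrier A" "Poly_Mapping.keys w \<subseteq> S"
  shows "Poly_Mapping.keys (act a w) \<subseteq> S"
  using assms(2)
  by (induction w rule: keys_S_induct)
     (use assms(1) in \<open>simp_all add: act_diff keys_diff_S keys_frag_of mem_S_iff\<close>)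

text \<open>Left multiplication maps each of the three families into itself: the first by
  distributivity, the second because only the first component changes, the third by associativity.
  Hence the action descends to classes.\<close>

lemma act_relation:
  assumes "a \<in> carrier A" "v \<in> tensor_relations A R \<phi> N"
  shows "act a v \<in> tensor_relations A R \<phi> N"
  using assms(2) unfolding tensor_relations_def
proof (elim UnE)
  assume "v \<in> {frag_of (b \<oplus>\<^bsub>A\<^esub> c, n) - frag_of (b, n) - frag_of (c, n) | b c n.
         b \<in> carrier A \<and> c \<in> carrier A \<and> n \<in> carrier N}"
  then obtain b c n where "v = frag_of (b \<oplus>\<^bsub>A\<^esub> c, n) - frag_of (b, n) - frag_of (c, n)"
    and bc: "b \<in> carrier A" "c \<in> carrier A" "n \<in> carrier N" by blast
  then have "act a v = frag_of (a \<otimes>\<^bsub>A\<^esub> b \<oplus>\<^bsub>A\<^esub> a \<otimes>\<^bsub>A\<^esub> c, n) - frag_of (a \<otimes>\<^bsub>A\<^esub> b, n) - frag_of (a \<otimes>\<^bsub>A\<^esub> c, n)"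
    using assms(1) by (simp add: act_diff A.r_distr)
  moreover have "a \<otimes>\<^bsub>A\<^esub> b \<in> carrier A" "a \<otimes>\<^bsub>A\<^esub> c \<in> carrier A" using assms(1) bc by simp_all
  ultimately show "act a v \<in> ({frag_of (b \<oplus>\<^bsub>A\<^esub> c, n) - frag_of (b, n) - frag_of (c, n) | b c n.
         b \<in> carrier A \<and> c \<in> carrier A \<and> n \<in> carrier N} \<union>
      {frag_of (b, n \<oplus>\<^bsub>N\<^esub> p) - frag_of (b, n) - frag_of (b, p) | b n p.
         b \<in> carrier A \<and> n \<in> carrier N \<and> p \<in> carrier N}) \<union>
      {frag_of (b \<otimes>\<^bsub>A\<^esub> \<phi> r, n) - frag_of (b, r \<odot>\<^bsub>N\<^esub> n) | b r n.
         b \<in> carrier A \<and> r \<in> carrier R \<and> n \<in> carrier N}"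
    using bc(3) by blast
next
  assume "v \<in> {frag_of (b, n \<oplus>\<^bsub>N\<^esub> p) - frag_of (b, n) - frag_of (b, p) | b n p.
         b \<in> carrier A \<and> n \<in> carrier N \<and> p \<in> carrier N}"
  then obtain b n p where "v = frag_of (b, n \<oplus>\<^bsub>N\<^esub> p) - frag_of (b, n) - frag_of (b, p)"
    and bc: "b \<in> carrier A" "n \<in> carrier N" "p \<in> carrier N" by blast
  then have "act a v = frag_of (a \<otimes>\<^bsub>A\<^esub> b, n \<oplus>\<^bsub>N\<^esub> p) - frag_of (a \<otimes>\<^bsub>A\<^esub> b, n) - frag_of (a \<otimes>\<^bsub>A\<^esub> b, p)"
    by (simp add: act_diff)
  moreover have "a \<otimes>\<^bsub>A\<^esub> b \<in> carrier A" using assms(1) bc by simp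
  ultimately show "act a v \<in> ({frag_of (b \<oplus>\<^bsub>A\<^esub> c, n) - frag_of (b, n) - frag_of (c, n) | b c n.
         b \<in> carrier A \<and> c \<in> carrier A \<and> n \<in> carrier N} \<union>
      {frag_of (b, n \<oplus>\<^bsub>N\<^esub> p) - frag_of (b, n) - frag_of (b, p) | b n p.
         b \<in> carrier A \<and> n \<in> carrier N \<and> p \<in> carrier N}) \<union>
      {frag_of (b \<otimes>\<^bsub>A\<^esub> \<phi> r, n) - frag_of (b, r \<odot>\<^bsub>N\<^esub> n) | b r n.
         b \<in> carrier A \<and> r \<in> carrier R \<and> n \<in> carrier N}"
    using bc by blast
next
  assume "v \<in> {frag_of (b \<otimes>\<^bsub>A\<^esub> \<phi> r, n) - frag_of (b, r \<odot>\<^bsub>N\<^esub> n) | b r n.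
         b \<in> carrier A \<and> r \<in> carrier R \<and> n \<in> carrier N}"
  then obtain b r n where "v = frag_of (b \<otimes>\<^bsub>A\<^esub> \<phi> r, n) - frag_of (b, r \<odot>\<^bsub>N\<^esub> n)"
    and bc: "b \<in> carrier A" "r \<in> carrier R" "n \<in> carrier N" by blast
  then have "act a v = frag_of (a \<otimes>\<^bsub>A\<^esub> b \<otimes>\<^bsub>A\<^esub> \<phi> r, n) - frag_of (a \<otimes>\<^bsub>A\<^esub> b, r \<odot>\<^bsub>N\<^esub> n)"
    using assms(1) by (simp add: act_diff A.m_assoc \<phi>_closed)
  moreover have "a \<otimes>\<^bsub>A\<^esub> b \<in> carrier A" using assms(1) bc by simp
  ultimately show "act a v \<in> ({frag_of (b \<oplus>\<^bsub>A\<^esub> c, n) - frag_of (b, n) - frag_of (c, n) | b c n.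
         b \<in> carrier A \<and> c \<in> carrier A \<and> n \<in> carrier N} \<union>
      {frag_of (b, n \<oplus>\<^bsub>N\<^esub> p) - frag_of (b, n) - frag_of (b, p) | b n p.
         b \<in> carrier A \<and> n \<in> carrier N \<and> p \<in> carrier N}) \<union>
      {frag_of (b \<otimes>\<^bsub>A\<^esub> \<phi> r, n) - frag_of (b, r \<odot>\<^bsub>N\<^esub> n) | b r n.
         b \<in> carrier A \<and> r \<in> carrier R \<and> n \<in> carrier N}"
    using bc by blast
qed

lemma act_K:
  assumes "a \<in> carrier A" "w \<in> K"
  shows "act a w \<in> K"
  using assms(2)
  by (induction w rule: K_induct)
     (use assms(1) in \<open>auto simp: act_diff K_0 intro: K_diff K_relation act_relation\<close>)

lemma smult_E:
  assumes "a \<in> carrier A" "Poly_Mapping.keys w \<subseteq> S"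
  shows "a \<odot>\<^bsub>E\<^esub> cls w = cls (act a w)"
proof -
  have eq: "cls (act a v) = cls (act a w)" if v: "v \<in> cls w" for v
  proof -
    obtain k where k: "k \<in> K" "v = k + w"
      using v by (auto simp: cls_def r_coset_def)
    then have "Poly_Mapping.keys v \<subseteq> S" using assms(2) K_keys keys_add_S by blast
    moreover have "act a v - act a w \<in> K" using k act_K[OF assms(1)] by (simp add: act_add)
    ultimately show ?thesis using assms by (simp add: cls_eq_iff act_keys)
  qed
  have "a \<odot>\<^bsub>E\<^esub> cls w = (\<Union>v\<in>cls w. cls (act a v))"
    unfolding extend_scalars_def Let_def cls_def act_def K_def T_def S_def by simp
  also have "\<dots> = (\<Union>v\<in>cls w. cls (act a w))"
    by (rule SUP_cong[OF refl eq])
  also have "\<dots> = cls (act a w)"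
    using T.rcos_self[OF _ K_subgroup, of w] assms(2) unfolding cls_def
    by (metis SUP_const T_simps(1) empty_iff)
  finally show ?thesis .
qed

text \<open>Additivity in the scalar holds only modulo K, being an instance of the first family of
  relations. In contrast, \<open>act_mult\<close> and \<open>act_one\<close> are identities in the
  free group.\<close>

lemma act_plus:
  assumes "a \<in> carrier A" "b \<in> carrier A" "Poly_Mapping.keys w \<subseteq> S"
  shows "act (a \<oplus>\<^bsub>A\<^esub> b) w - act a w - act b w \<in> K"
  using assms(3)
proof (induction w rule: keys_S_induct)
  case zero
  then show ?case by (simp add: K_0)
next
  case (diff v w)
  have "act (a \<oplus>\<^bsub>A\<^esub> b) (v - w) - act a (v - w) - act b (v - w) =
      (act (a \<oplus>\<^bsub>A\<^esub> b) v - act a v - act b v) - (act (a \<oplus>\<^bsub>A\<^esub> b) w - act a w - act b w)"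
    by (simp add: act_diff)
  then show ?case using diff by (simp only: K_diff)
next
  case (frag c n)
  have "frag_of (a \<otimes>\<^bsub>A\<^esub> c \<oplus>\<^bsub>A\<^esub> b \<otimes>\<^bsub>A\<^esub> c, n) - frag_of (a \<otimes>\<^bsub>A\<^esub> c, n) - frag_of (b \<otimes>\<^bsub>A\<^esub> c, n)
      \<in> tensor_relations A R \<phi> N"
    unfolding tensor_relations_def using assms(1,2) frag A.m_closed by blast
  then show ?case using assms frag by (simp add: A.l_distr K_relation)
qed

lemma act_mult:
  assumes "a \<in> carrier A" "b \<in> carrier A" "Poly_Mapping.keys w \<subseteq> S"
  shows "act (a \<otimes>\<^bsub>A\<^esub> b) w = act a (act b w)"
  using assms(3)
  by (induction w rule: keys_S_induct)
     (use assms(1,2) in \<open>simp_all add: act_diff A.m_assoc\<close>)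

lemma act_one:
  assumes "Poly_Mapping.keys w \<subseteq> S"
  shows "act \<one>\<^bsub>A\<^esub> w = w"
  using assms by (induction w rule: keys_S_induct) (simp_all add: act_diff)

lemma left_module_E: "left_module A E"
proof -
  have "abelian_group E"
  proof (rule abelian_groupI)
    fix x assume "x \<in> carrier E"
    then obtain w where w: "Poly_Mapping.keys w \<subseteq> S" "x = cls w" by (auto simp: carrier_E)
    then have "cls (- w) \<oplus>\<^bsub>E\<^esub> x = \<zero>\<^bsub>E\<^esub>" by (simp add: add_E zero_E)
    then show "\<exists>y\<in>carrier E. y \<oplus>\<^bsub>E\<^esub> x = \<zero>\<^bsub>E\<^esub>" using w cls_closed[of "- w"] by auto
  qed (auto simp: carrier_E add_E zero_E keys_add_S add_ac)
  moreover have "cls (act (a \<oplus>\<^bsub>A\<^esub> b) w) = cls (act a w + act b w)"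
    if "a \<in> carrier A" "b \<in> carrier A" "Poly_Mapping.keys w \<subseteq> S" for a b w
    using act_plus[OF that] that by (subst cls_eq_iff) (auto simp: act_keys keys_add_S algebra_simps)
  ultimately show ?thesis
    by (intro left_module.intro left_module_axioms.intro A.ring_axioms)
      (auto simp: carrier_E smult_E add_E act_keys keys_add_S act_add act_mult act_one)
qed

definition tensor where "tensor b n = cls (frag_of (b, n))"

context
  fixes b n
  assumes b: "b \<in> carrier A" and n: "n \<in> carrier N"
begin

lemma tensor_keys: "Poly_Mapping.keys (frag_of (b, n)) \<subseteq> S"
  using b n by (simp add: keys_frag_of S_def)

lemma tensor_closed: "tensor b n \<in> carrier E"
  unfolding tensor_def by (rule cls_closed[OF tensor_keys])

lemma smult_tensor: "a \<in> carrier A \<Longrightarrow> a \<odot>\<^bsub>E\<^esub> tensor b n = tensor (a \<otimes>\<^bsub>A\<^esub> b) n"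
  unfolding tensor_def by (subst smult_E[OF _ tensor_keys]) simp_all

lemma tensor_balanced: "r \<in> carrier R \<Longrightarrow> tensor (b \<otimes>\<^bsub>A\<^esub> \<phi> r) n = tensor b (r \<odot>\<^bsub>N\<^esub> n)"
proof -
  assume r: "r \<in> carrier R"
  have "frag_of (b \<otimes>\<^bsub>A\<^esub> \<phi> r, n) - frag_of (b, r \<odot>\<^bsub>N\<^esub> n) \<in> tensor_relations A R \<phi> N"
    unfolding tensor_relations_def using b n r by blast
  then show ?thesis
    unfolding tensor_def using b n r
    by (subst cls_eq_iff) (auto simp: K_relation keys_frag_of S_def \<phi>_closed N.smult_closed)
qed

end

lemma tensor_zero:
  assumes "b \<in> carrier A"
  shows "tensor b \<zero>\<^bsub>N\<^esub> = \<zero>\<^bsub>E\<^esub>"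
proof -
  have "frag_of (b, \<zero>\<^bsub>N\<^esub> \<oplus>\<^bsub>N\<^esub> \<zero>\<^bsub>N\<^esub>) - frag_of (b, \<zero>\<^bsub>N\<^esub>) - frag_of (b, \<zero>\<^bsub>N\<^esub>) \<in> tensor_relations A R \<phi> N"
    unfolding tensor_relations_def using assms N.zero_closed by blast
  then have "- frag_of (b, \<zero>\<^bsub>N\<^esub>) \<in> K" by (simp add: K_relation)
  then have "frag_of (b, \<zero>\<^bsub>N\<^esub>) \<in> K" using K_minus by fastforce
  then show ?thesis
    unfolding tensor_def zero_E using assms
    by (subst cls_eq_iff) (auto simp: keys_frag_of S_def)
qed

text \<open>A pure tensor b \<otimes> r n0 equals (b \<phi>(r)) (1 \<otimes> n0), and differences of
  such multiples keep this form.\<close>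

lemma tensor_cyclic:
  assumes n0: "n0 \<in> carrier N" and gen: "\<And>n. n \<in> carrier N \<Longrightarrow> \<exists>r\<in>carrier R. n = r \<odot>\<^bsub>N\<^esub> n0"
    and v: "v \<in> carrier E"
  shows "\<exists>a\<in>carrier A. v = a \<odot>\<^bsub>E\<^esub> tensor \<one>\<^bsub>A\<^esub> n0"
proof -
  interpret E: left_module A E by (rule left_module_E)
  let ?u = "tensor \<one>\<^bsub>A\<^esub> n0"
  have u: "?u \<in> carrier E" using n0 tensor_closed by simp
  obtain w where w: "Poly_Mapping.keys w \<subseteq> S" "v = cls w" using v by (auto simp: carrier_E)
  have "\<exists>a\<in>carrier A. cls w = a \<odot>\<^bsub>E\<^esub> ?u"
    using w(1)
  proof (induction w rule: keys_S_induct)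
    case zero
    then show ?case using E.smult_l_zero[OF u] by (auto simp: zero_E)
  next
    case (diff x y)
    then obtain a b where ab: "a \<in> carrier A" "b \<in> carrier A" "cls x = a \<odot>\<^bsub>E\<^esub> ?u" "cls y = b \<odot>\<^bsub>E\<^esub> ?u"
      by auto
    have "cls (x - y) \<oplus>\<^bsub>E\<^esub> cls y = cls x"
      using diff(1,2) by (simp add: add_E keys_diff_S)
    moreover have "(a \<ominus>\<^bsub>A\<^esub> b) \<odot>\<^bsub>E\<^esub> ?u \<oplus>\<^bsub>E\<^esub> b \<odot>\<^bsub>E\<^esub> ?u = a \<odot>\<^bsub>E\<^esub> ?u"
      using ab(1,2) u
      by (simp add: A.minus_eq A.a_assoc A.l_neg flip: E.smult_l_distr)
    ultimately have "cls (x - y) \<oplus>\<^bsub>E\<^esub> b \<odot>\<^bsub>E\<^esub> ?u = (a \<ominus>\<^bsub>A\<^esub> b) \<odot>\<^bsub>E\<^esub> ?u \<oplus>\<^bsub>E\<^esub> b \<odot>\<^bsub>E\<^esub> ?u"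
      by (simp only: ab(3,4))
    moreover have "b \<odot>\<^bsub>E\<^esub> ?u \<in> carrier E" "(a \<ominus>\<^bsub>A\<^esub> b) \<odot>\<^bsub>E\<^esub> ?u \<in> carrier E"
      using ab(1,2) u by (simp_all add: E.smult_closed)
    moreover have "cls (x - y) \<in> carrier E" by (rule cls_closed[OF keys_diff_S[OF diff(1,2)]])
    ultimately have "cls (x - y) = (a \<ominus>\<^bsub>A\<^esub> b) \<odot>\<^bsub>E\<^esub> ?u"
      using E.add.right_cancel by blast
    then show ?case using A.minus_closed[OF ab(1,2)] by blast
  next
    case (frag b n)
    obtain r where r: "r \<in> carrier R" "n = r \<odot>\<^bsub>N\<^esub> n0" using gen frag by blast
    have "cls (frag_of (b, n)) = tensor (b \<otimes>\<^bsub>A\<^esub> \<phi> r) n0"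
      using tensor_balanced[of b n0 r] frag r n0 by (simp add: tensor_def)
    also have "\<dots> = (b \<otimes>\<^bsub>A\<^esub> \<phi> r) \<odot>\<^bsub>E\<^esub> ?u"
      using smult_tensor[of "\<one>\<^bsub>A\<^esub>" n0 "b \<otimes>\<^bsub>A\<^esub> \<phi> r"] frag r n0 \<phi>_closed by simp
    finally show ?case using frag r \<phi>_closed by blast
  qed
  then show ?thesis using w by simp
qed

lemma tensor_eq_zero_iff:
  assumes "b \<in> carrier A" "n \<in> carrier N"
  shows "tensor b n = \<zero>\<^bsub>E\<^esub> \<longleftrightarrow> frag_of (b, n) \<in> K"
  unfolding tensor_def zero_E using cls_eq_iff[of "frag_of (b, n)" 0] tensor_keys[OF assms] by simp

end


section \<open>The module U(Rf) as A_h modulo A_h f\<close>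

lemma PIdl_Rx: "PIdl\<^bsub>Rx\<^esub> f = {t :: 'a::field poly. f dvd t}"
  by (auto simp: cgenideal_def dvd_def mult.commute)

lemma coset_Rx_self: "r \<in> PIdl\<^bsub>Rx\<^esub> f +>\<^bsub>Rx\<^esub> (r :: 'a::field poly)"
  by (force simp: PIdl_Rx a_r_coset_def')

lemma coset_Rx_eq_iff:
  "PIdl\<^bsub>Rx\<^esub> f +>\<^bsub>Rx\<^esub> r = PIdl\<^bsub>Rx\<^esub> f +>\<^bsub>Rx\<^esub> s \<longleftrightarrow> f dvd r - (s :: 'a::field poly)"
  using ring.quotient_eq_iff_same_a_r_cos[OF cring.axioms(1)[OF cring_from_type_algebra]
    cring.cgenideal_ideal[OF cring_from_type_algebra], of f r s]
  by (simp add: PIdl_Rx)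

lemma mem_coset_Rx: "s \<in> PIdl\<^bsub>Rx\<^esub> f +>\<^bsub>Rx\<^esub> r \<Longrightarrow> f dvd s - (r :: 'a::field poly)"
  by (auto simp: PIdl_Rx a_r_coset_def')

context
  fixes h f :: "'a::field poly"
begin

abbreviation (input) residue_module where
  "residue_module \<equiv> quotient_module (regular_module Rx) (PIdl\<^bsub>Rx\<^esub> f)"

lemma left_module_Rx: "left_module Rx (regular_module (Rx :: 'a poly ring))"
  by (rule left_module_regular[OF ring_of_type_algebra_ring])

lemma submodule_PIdl: "submodule (PIdl\<^bsub>Rx\<^esub> f) Rx (regular_module Rx)"
  by (rule left_module.submoduleI[OF left_module_Rx]) (auto simp: PIdl_Rx regular_module_def)

lemma coset_regular: "PIdl\<^bsub>Rx\<^esub> f +>\<^bsub>regular_module Rx\<^esub> r = PIdl\<^bsub>Rx\<^esub> f +>\<^bsub>Rx\<^esub> r"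
  by (simp add: a_r_coset_def' regular_module_def)

lemma carrier_residue: "carrier residue_module = range (\<lambda>r. PIdl\<^bsub>Rx\<^esub> f +>\<^bsub>Rx\<^esub> r)"
  using carrier_quotient_module[OF left_module_Rx submodule_PIdl]
  by (simp add: coset_regular) (simp add: regular_module_def)

lemma add_residue:
  "(PIdl\<^bsub>Rx\<^esub> f +>\<^bsub>Rx\<^esub> r) \<oplus>\<^bsub>residue_module\<^esub> (PIdl\<^bsub>Rx\<^esub> f +>\<^bsub>Rx\<^esub> s) = PIdl\<^bsub>Rx\<^esub> f +>\<^bsub>Rx\<^esub> (r + s)"
  using add_quotient_module[OF left_module_Rx submodule_PIdl, of r s]
  by (simp add: coset_regular) (simp add: regular_module_def)

lemma smult_residue:
  "t \<odot>\<^bsub>residue_module\<^esub> (PIdl\<^bsub>Rx\<^esub> f +>\<^bsub>Rx\<^esub> r) = PIdl\<^bsub>Rx\<^esub> f +>\<^bsub>Rx\<^esub> (t * r)"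
  using smult_quotient_module[OF left_module_Rx submodule_PIdl, of t r]
  by (simp add: coset_regular) (simp add: regular_module_def)

lemma zero_residue: "\<zero>\<^bsub>residue_module\<^esub> = PIdl\<^bsub>Rx\<^esub> f +>\<^bsub>Rx\<^esub> f"
proof -
  have "PIdl\<^bsub>Rx\<^esub> f +>\<^bsub>regular_module Rx\<^esub> f = PIdl\<^bsub>Rx\<^esub> f"
    using quotient_module_coset_eq_zero_iff[OF left_module_Rx submodule_PIdl, of f]
    by (simp add: PIdl_Rx) (simp add: regular_module_def)
  then show ?thesis
    using zero_quotient_module[OF left_module_Rx submodule_PIdl] by (simp add: coset_regular)
qed

interpretation U: scalar_extension "Ah h" Rx "Ah_emb h" residue_module
  by (rule scalar_extension.intro)
    (simp_all add: ring_Ah left_module_quotient[OF left_module_Rx submodule_PIdl] Ah_emb_eq)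

lemma Um_eq: "Um h (PIdl\<^bsub>Rx\<^esub> f) = U.E"
  by (simp add: Um_def)

text \<open>The map \<eta> sends (p, class of r) to p s for some representative s of the class. It
  need not kill the relations, but changing s costs only an element of A_h f, so all relations land
  in A_h f. This bounds the annihilator of 1 \<otimes> 1 from above.\<close>

lemma hom_tensor_relations_mem:
  assumes w: "w \<in> U.K"
    and \<eta>: "\<eta> \<in> hom U.T \<lparr>carrier = (UNIV :: 'a poly poly set), monoid.mult = (+), one = (0 :: 'a poly poly)\<rparr>"
    and \<eta>_of: "\<And>p r. \<exists>s. f dvd s - r \<and> \<eta> (frag_of (nf_elem h p, PIdl\<^bsub>Rx\<^esub> f +>\<^bsub>Rx\<^esub> r)) = tmul h p [:s:]"
  shows "\<eta> w \<in> range (\<lambda>q. tmul h q [:f:])"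
proof -
  define J where "J = range (\<lambda>q. tmul h q [:f:])"
  have J_const: "tmul h p [:s:] \<in> J" if "f dvd s" for p s
  proof -
    obtain t where "s = t * f" using \<open>f dvd s\<close> by (metis dvdE mult.commute)
    then have "tmul h p [:s:] = tmul h (tmul h p [:t:]) [:f:]"
      by (simp add: tmul_assoc mult.commute)
    then show ?thesis by (auto simp: J_def)
  qed
  have J_diff: "p - q \<in> J" if "p \<in> J" "q \<in> J" for p q
    using that by (auto simp: J_def simp flip: tmul_diff_left)
  have J_add: "p + q \<in> J" if "p \<in> J" "q \<in> J" for p q
    using that by (auto simp: J_def simp flip: tmul_add_left)
  \<comment> \<open>The error caused by the choice of representative. Each relation below reduces to
    a combination of such errors, because the product p r is biadditive and associative.\<close>
  have \<eta>_cong: "\<eta> (frag_of (nf_elem h p, PIdl\<^bsub>Rx\<^esub> f +>\<^bsub>Rx\<^esub> r)) - tmul h p [:r:] \<in> J" for p r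
  proof -
    obtain s where "f dvd s - r" "\<eta> (frag_of (nf_elem h p, PIdl\<^bsub>Rx\<^esub> f +>\<^bsub>Rx\<^esub> r)) = tmul h p [:s:]"
      using \<eta>_of by blast
    then show ?thesis using J_const[of "s - r" p] by (simp flip: tmul_diff_right)
  qed
  have \<eta>_add: "\<eta> (v + w) = \<eta> v + \<eta> w" if "Poly_Mapping.keys v \<subseteq> U.S" "Poly_Mapping.keys w \<subseteq> U.S" for v w
    using hom_mult[OF \<eta>, of v w] that by simp
  have \<eta>_diff: "\<eta> (v - w) = \<eta> v - \<eta> w" if "Poly_Mapping.keys v \<subseteq> U.S" "Poly_Mapping.keys w \<subseteq> U.S" for v w
    using \<eta>_add[OF U.keys_diff_S[OF that] that(2)] by simp
  have S: "Poly_Mapping.keys (frag_of (nf_elem h p, PIdl\<^bsub>Rx\<^esub> f +>\<^bsub>Rx\<^esub> r)) \<subseteq> U.S" for p r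
    by (simp add: keys_frag_of U.mem_S_iff carrier_residue)
  let ?e = "\<lambda>p r. \<eta> (frag_of (nf_elem h p, PIdl\<^bsub>Rx\<^esub> f +>\<^bsub>Rx\<^esub> r))"
  have rel: "\<eta> v \<in> J" if v: "v \<in> tensor_relations (Ah h) Rx (Ah_emb h) residue_module" for v
    using v unfolding tensor_relations_def carrier_Ah carrier_residue
  proof (elim UnE CollectE exE conjE rangeE)
    fix b c n p q r
    assume *: "b = nf_elem h p" "c = nf_elem h q" "n = PIdl\<^bsub>Rx\<^esub> f +>\<^bsub>Rx\<^esub> r"
      and v: "v = frag_of (b \<oplus>\<^bsub>Ah h\<^esub> c, n) - frag_of (b, n) - frag_of (c, n)"
    have "\<eta> v = ?e (p + q) r - ?e p r - ?e q r"
      unfolding v * nf_elem_add by (simp add: \<eta>_diff U.keys_diff_S U.mem_S_iff carrier_residue)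
    also have "\<dots> = (?e (p + q) r - tmul h (p + q) [:r:]) - (?e p r - tmul h p [:r:]) - (?e q r - tmul h q [:r:])"
      by (simp add: tmul_add_left)
    also have "\<dots> \<in> J" by (intro J_diff \<eta>_cong)
    finally show ?thesis .
  next
    fix b n n' p r s
    assume *: "b = nf_elem h p" "n = PIdl\<^bsub>Rx\<^esub> f +>\<^bsub>Rx\<^esub> r" "n' = PIdl\<^bsub>Rx\<^esub> f +>\<^bsub>Rx\<^esub> s"
      and v: "v = frag_of (b, n \<oplus>\<^bsub>residue_module\<^esub> n') - frag_of (b, n) - frag_of (b, n')"
    have "\<eta> v = ?e p (r + s) - ?e p r - ?e p s"
      unfolding v * add_residue by (simp add: \<eta>_diff U.keys_diff_S U.mem_S_iff carrier_residue)
    also have "\<dots> = (?e p (r + s) - tmul h p [:r + s:]) - (?e p r - tmul h p [:r:]) - (?e p s - tmul h p [:s:])"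
      using tmul_add_right[of h p "[:r:]" "[:s:]"] by simp
    also have "\<dots> \<in> J" by (intro J_diff \<eta>_cong)
    finally show ?thesis .
  next
    fix b t n p r
    assume *: "b = nf_elem h p" "n = PIdl\<^bsub>Rx\<^esub> f +>\<^bsub>Rx\<^esub> r"
      and v: "v = frag_of (b \<otimes>\<^bsub>Ah h\<^esub> Ah_emb h t, n) - frag_of (b, t \<odot>\<^bsub>residue_module\<^esub> n)"
    have "\<eta> v = ?e (tmul h p [:t:]) r - ?e p (t * r)"
      unfolding v * smult_residue Ah_emb_eq nf_elem_mult by (simp add: \<eta>_diff U.keys_diff_S U.mem_S_iff carrier_residue)
    also have "\<dots> = (?e (tmul h p [:t:]) r - tmul h (tmul h p [:t:]) [:r:]) - (?e p (t * r) - tmul h p [:t * r:])"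
      by (simp add: tmul_assoc)
    also have "\<dots> \<in> J" by (intro J_diff \<eta>_cong)
    finally show ?thesis .
  qed
  have "\<eta> 0 = 0" using \<eta>_diff[of 0 0] by simp
  with w show ?thesis
    unfolding J_def[symmetric]
    by (induction w rule: U.K_induct) (simp_all add: rel \<eta>_diff U.K_keys J_diff J_const[of 0 0, simplified])
qed

text \<open>From here on U(m) is used only through this description, which says that it is A_h / A_h
  f with u the class of 1.\<close>

lemma Um_cyclic:
  obtains u where "left_module (Ah h) (Um h (PIdl\<^bsub>Rx\<^esub> f))" "u \<in> carrier (Um h (PIdl\<^bsub>Rx\<^esub> f))"
    "\<And>v. v \<in> carrier (Um h (PIdl\<^bsub>Rx\<^esub> f)) \<Longrightarrow> \<exists>p. v = nf_elem h p \<odot>\<^bsub>Um h (PIdl\<^bsub>Rx\<^esub> f)\<^esub> u"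
    "\<And>p. nf_elem h p \<odot>\<^bsub>Um h (PIdl\<^bsub>Rx\<^esub> f)\<^esub> u = \<zero>\<^bsub>Um h (PIdl\<^bsub>Rx\<^esub> f)\<^esub>
      \<longleftrightarrow> p \<in> range (\<lambda>q. tmul h q [:f:])"
proof -
  define n where "n = PIdl\<^bsub>Rx\<^esub> f +>\<^bsub>Rx\<^esub> (1 :: 'a poly)"
  have n: "n \<in> carrier residue_module" by (simp add: n_def carrier_residue)
  have one: "\<one>\<^bsub>Ah h\<^esub> \<in> carrier (Ah h)" by (simp add: nf_elem_1)
  define u where "u = U.tensor \<one>\<^bsub>Ah h\<^esub> n"
  have act_u: "nf_elem h p \<odot>\<^bsub>U.E\<^esub> u = U.tensor (nf_elem h p) n" for p
    using U.smult_tensor[OF one n, of "nf_elem h p"] by (simp add: u_def nf_elem_1 nf_elem_mult)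
  have gen: "\<exists>r\<in>carrier Rx. n' = r \<odot>\<^bsub>residue_module\<^esub> n" if "n' \<in> carrier residue_module" for n'
    using that by (auto simp: carrier_residue n_def smult_residue)
  have "U.tensor (nf_elem h p) n = \<zero>\<^bsub>U.E\<^esub> \<longleftrightarrow> p \<in> range (\<lambda>q. tmul h q [:f:])" for p
  proof
    assume "p \<in> range (\<lambda>q. tmul h q [:f:])"
    then obtain q where q: "p = tmul h q [:f:]" by blast
    have "U.tensor (nf_elem h p) n = U.tensor (nf_elem h q \<otimes>\<^bsub>Ah h\<^esub> Ah_emb h f) n"
      by (simp add: q nf_elem_mult Ah_emb_eq)
    also have "\<dots> = U.tensor (nf_elem h q) \<zero>\<^bsub>residue_module\<^esub>"
      using U.tensor_balanced[of "nf_elem h q" n f] n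
      by (simp add: n_def smult_residue zero_residue)
    also have "\<dots> = \<zero>\<^bsub>U.E\<^esub>" by (rule U.tensor_zero) simp
    finally show "U.tensor (nf_elem h p) n = \<zero>\<^bsub>U.E\<^esub>" .
  next
    assume "U.tensor (nf_elem h p) n = \<zero>\<^bsub>U.E\<^esub>"
    then have K: "frag_of (nf_elem h p, n) \<in> U.K"
      using n by (simp add: U.tensor_eq_zero_iff)
    \<comment> \<open>The additive group of R[Y], as target for the universal property of the free
      Abelian group.\<close>
    define G where "G = \<lparr>carrier = (UNIV :: 'a poly poly set), monoid.mult = (+), one = (0 :: 'a poly poly)\<rparr>"
    have "comm_group G"
      unfolding G_def by (rule comm_groupI) (auto simp: add_ac intro: exI[of _ "- _"] left_minus)
    then interpret G: comm_group G .
    \<comment> \<open>Any representative of the coset may serve, since the values only matter modulo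
      A_h f.\<close>
    define \<theta> where "\<theta> = (\<lambda>(b, n). tmul h (the_inv (nf_elem h) b) [:SOME s. s \<in> n:])"
    obtain \<eta> where \<eta>: "\<eta> \<in> hom U.T G" "\<And>x. x \<in> U.S \<Longrightarrow> \<eta> (frag_of x) = \<theta> x"
      using G.free_Abelian_group_universal[of \<theta> U.S] by (auto simp: G_def U.T_def)
    have "inj (nf_elem h)" by (simp add: inj_def nf_elem_inject)
    then have "\<theta> (nf_elem h p, m) = tmul h p [:SOME s. s \<in> m:]" for p m
      by (simp add: \<theta>_def the_inv_f_f)
    then have \<eta>_of: "\<exists>s. f dvd s - r \<and> \<eta> (frag_of (nf_elem h p, PIdl\<^bsub>Rx\<^esub> f +>\<^bsub>Rx\<^esub> r)) = tmul h p [:s:]" for p r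
      using \<eta>(2)[of "(nf_elem h p, PIdl\<^bsub>Rx\<^esub> f +>\<^bsub>Rx\<^esub> r)"] someI[of "\<lambda>s. s \<in> PIdl\<^bsub>Rx\<^esub> f +>\<^bsub>Rx\<^esub> r", OF coset_Rx_self]
      by (auto simp: U.mem_S_iff carrier_residue intro: mem_coset_Rx)
    obtain s where s: "f dvd s - 1" "\<eta> (frag_of (nf_elem h p, n)) = tmul h p [:s:]"
      using \<eta>_of[of 1 p] by (auto simp: n_def)
    obtain q where q: "tmul h p [:s:] = tmul h q [:f:]"
      using hom_tensor_relations_mem[OF K \<eta>(1)[unfolded G_def] \<eta>_of] s(2) by auto
    \<comment> \<open>The representative s of the class of 1 need not be 1; p s and p differ by (p
      t) f.\<close>
    obtain t where "s - 1 = t * f" using s(1) by (metis dvdE mult.commute)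
    then have "[:s:] = 1 + tmul h [:t:] [:f:]" by (simp add: one_pCons algebra_simps)
    then have "tmul h p [:s:] = p + tmul h (tmul h p [:t:]) [:f:]"
      by (simp only: tmul_add_right tmul_assoc tmul_1_right)
    then have "p = tmul h (q - tmul h p [:t:]) [:f:]"
      using q by (simp add: tmul_diff_left algebra_simps)
    then show "p \<in> range (\<lambda>q. tmul h q [:f:])" by blast
  qed
  moreover have "\<exists>p. v = nf_elem h p \<odot>\<^bsub>U.E\<^esub> u" if "v \<in> carrier U.E" for v
    using U.tensor_cyclic[OF n gen that] by (auto simp: carrier_Ah u_def)
  ultimately show thesis
    using that[of u] U.left_module_E U.tensor_closed[OF one n] by (simp add: Um_eq act_u flip: u_def)
qed

end

section \<open>The modules L(m, g)\<close>

lemma irreducible_factor_exists: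
  fixes r :: "'a::field poly"
  assumes "r \<noteq> 0" "\<not> is_unit r"
  obtains f where "Factorial_Ring.irreducible f" "f dvd r"
proof -
  have "\<exists>f. Factorial_Ring.irreducible f \<and> f dvd r"
    using assms
  proof (induction "Polynomial.degree r" arbitrary: r rule: less_induct)
    case less
    show ?case
    proof (cases "Factorial_Ring.irreducible r")
      case False
      then obtain a b where ab: "r = a * b" "\<not> is_unit a" "\<not> is_unit b"
        using less.prems by (auto simp: Factorial_Ring.irreducible_def)
      then have nz: "a \<noteq> 0" "b \<noteq> 0" using less.prems by auto
      then have "Polynomial.degree b \<noteq> 0" using ab by (simp add: is_unit_iff_degree)
      then have "Polynomial.degree a < Polynomial.degree r" using ab nz by (simp add: degree_mult_eq)
      then show ?thesis using less.hyps[of a] ab nz by (auto intro: dvd_mult2)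
    qed auto
  qed
  then show thesis using that by blast
qed

text \<open>For the inclusion from right to left, write f s = s f - [s, f]. The commutator is again
  divisible by f and has smaller degree in y, so induction applies. Thus A_h f is the two-sided
  ideal f R[Y].\<close>

lemma range_tmul_const:
  assumes "f dvd h"
  shows "range (\<lambda>q. tmul h q [:f:]) = {p. [:f:] dvd p}"
proof (intro equalityI subsetI)
  fix p assume "p \<in> range (\<lambda>q. tmul h q [:f:])"
  then obtain q where "p = tmul h q [:f:]" by blast
  then have "[:f:] dvd p - q * [:f:]" using tmul_cong_mult[OF assms] by blast
  then show "p \<in> {p. [:f:] dvd p}"
    by (metis dvd_diff_commute dvd_diffD1 dvd_triv_right mem_Collect_eq dvd_add_left_iff diff_add_cancel)
next
  fix p assume "p \<in> {p. [:f:] dvd p}"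
  then have "[:f:] dvd p" by simp
  then show "p \<in> range (\<lambda>q. tmul h q [:f:])"
  proof (induction "Polynomial.degree p" arbitrary: p rule: less_induct)
    case less
    show ?case
    proof (cases "p = 0")
      case True
      then show ?thesis using tmul_0_left[of h "[:f:]"] by (metis range_eqI)
    next
      case False
      obtain s where s: "p = Polynomial.smult f s" using less.prems by (auto simp: dvd_def)
      have f: "f \<noteq> 0" "s \<noteq> 0" using False s by auto
      define c where "c = tmul h s [:f:] - Polynomial.smult f s"
      have "[:f:] dvd c"
        using tmul_cong_mult[OF assms, of s "[:f:]"] by (simp add: c_def)
      have "c \<in> range (\<lambda>q. tmul h q [:f:])"
      proof (cases "Polynomial.degree s")
        case 0
        then obtain a where "s = [:a:]" by (rule degree_eq_zeroE)
        then have "c = tmul h 0 [:f:]" by (simp add: c_def mult.commute)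
        then show ?thesis by blast
      next
        case (Suc n)
        then show ?thesis
          using coeff_commutator(1)[OF Suc, of h f] f s \<open>[:f:] dvd c\<close>
          by (intro less.hyps) (simp_all add: c_def)
      qed
      then obtain q where "c = tmul h q [:f:]" by blast
      then have "p = tmul h (s - q) [:f:]" by (simp add: s c_def tmul_diff_left algebra_simps)
      then show ?thesis by blast
    qed
  qed
qed

text \<open>The product q f has coefficient lc(q) f at the degree of q, so q must be constant: A_h f
  meets R in R f.\<close>

lemma dvd_of_const_mem_range:
  assumes "[:r:] \<in> range (\<lambda>q. tmul h q [:f:])"
  shows "f dvd r"
proof (cases "f = 0")
  case True
  then show ?thesis using assms by auto
next
  case False
  obtain q where q: "[:r:] = tmul h q [:f:]" using assms by blast
  have "Polynomial.coeff [:r:] (Polynomial.degree q) = Polynomial.lead_coeff q * f"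
    unfolding q by (simp add: coeff_tmul_const)
  then have "q = 0 \<or> Polynomial.degree q = 0"
    using False by (auto simp: coeff_pCons split: nat.splits) (metis leading_coeff_0_iff)
  then obtain a where "q = [:a:]" by (metis degree_0 degree_eq_zeroE)
  then show ?thesis using q by simp
qed

lemma tmul_commute_cong:
  assumes "f dvd h"
  shows "[:f:] dvd tmul h p q - tmul h q p"
  using dvd_diff[OF tmul_cong_mult[OF assms, of p q] tmul_cong_mult[OF assms, of q p]]
  by (simp add: mult.commute)

lemma reduce_coeffs_eq_iff:
  "reduce_coeffs (PIdl\<^bsub>Rx\<^esub> f) g = reduce_coeffs (PIdl\<^bsub>Rx\<^esub> f) g' \<longleftrightarrow> [:f:] dvd g - g'"
  by (simp add: reduce_coeffs_def fun_eq_iff coset_Rx_eq_iff const_poly_dvd_iff)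

text \<open>The ideal (f, g) of the commutative ring R[Y], that is, the preimage of the ideal
  generated by the reduction of g in (R/f)[Y]. It lets L(m, g) and \<open>Qm m\<close> be compared
  without computing in the quotient ring.\<close>

definition ideal_mod :: "'a::field poly \<Rightarrow> 'a poly poly \<Rightarrow> 'a poly poly set"
  where "ideal_mod f g = {p. \<exists>a. [:f:] dvd p - a * g}"

lemma ideal_mod_cong_imp:
  assumes "p \<in> ideal_mod f g" and d: "[:f:] dvd p - q"
  shows "q \<in> ideal_mod f g"
proof -
  obtain a where "[:f:] dvd p - a * g" using assms(1) by (auto simp: ideal_mod_def)
  then have "[:f:] dvd (p - a * g) - (p - q)" using d by (rule dvd_diff)
  then show ?thesis by (auto simp: ideal_mod_def)
qed

lemma ideal_mod_cong:
  assumes "[:f:] dvd p - q"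
  shows "p \<in> ideal_mod f g \<longleftrightarrow> q \<in> ideal_mod f g"
proof -
  have "[:f:] dvd - (p - q)" using assms by (simp only: dvd_minus_iff)
  then have "[:f:] dvd q - p" by simp
  then show ?thesis using assms ideal_mod_cong_imp by blast
qed

lemma ideal_mod_add: "p \<in> ideal_mod f g \<Longrightarrow> q \<in> ideal_mod f g \<Longrightarrow> p + q \<in> ideal_mod f g"
proof -
  assume "p \<in> ideal_mod f g" "q \<in> ideal_mod f g"
  then obtain a b where "[:f:] dvd p - a * g" "[:f:] dvd q - b * g" by (auto simp: ideal_mod_def)
  then have "[:f:] dvd (p - a * g) + (q - b * g)" by (rule dvd_add)
  moreover have "(p - a * g) + (q - b * g) = p + q - (a + b) * g" by (simp add: algebra_simps)
  ultimately show ?thesis unfolding ideal_mod_def by auto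
qed

lemma ideal_mod_mult: "p \<in> ideal_mod f g \<Longrightarrow> q * p \<in> ideal_mod f g"
proof -
  assume "p \<in> ideal_mod f g"
  then obtain a where "[:f:] dvd p - a * g" by (auto simp: ideal_mod_def)
  then have "[:f:] dvd q * (p - a * g)" by (rule dvd_mult)
  moreover have "q * (p - a * g) = q * p - (q * a) * g" by (simp add: algebra_simps)
  ultimately show ?thesis unfolding ideal_mod_def by auto
qed

context
  fixes h f :: "'a::field poly"
  assumes fh: "f dvd h"
begin

lemma ideal_mod_tmul_left: "p \<in> ideal_mod f g \<Longrightarrow> tmul h q p \<in> ideal_mod f g"
  using ideal_mod_cong[OF tmul_cong_mult[OF fh]] ideal_mod_mult by blast

text \<open>Products in the two orders agree modulo f, so (f, g) is two-sided for
  \<open>tmul\<close>. This is why an element that kills the generator of L(m, g) kills the whole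
  module.\<close>

lemma ideal_mod_tmul_right: "p \<in> ideal_mod f g \<Longrightarrow> tmul h p q \<in> ideal_mod f g"
  using ideal_mod_cong[OF tmul_commute_cong[OF fh]] ideal_mod_tmul_left by blast

text \<open>The lift of g acts on p u as p g modulo f, hence g U(m) consists of the p u with p in
  (f, g). The generator of L(m, g) is the class of u.\<close>

lemma Lm_cyclic:
  fixes g :: "'a poly poly"
  defines "L \<equiv> Lm h (PIdl\<^bsub>Rx\<^esub> f) (reduce_coeffs (PIdl\<^bsub>Rx\<^esub> f) g)"
  obtains v where "left_module (Ah h) L" "v \<in> carrier L"
    "\<And>w. w \<in> carrier L \<Longrightarrow> \<exists>p. w = nf_elem h p \<odot>\<^bsub>L\<^esub> v"
    "\<And>p. nf_elem h p \<odot>\<^bsub>L\<^esub> v = \<zero>\<^bsub>L\<^esub> \<longleftrightarrow> p \<in> ideal_mod f g"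
proof -
  define U where "U = Um h (PIdl\<^bsub>Rx\<^esub> f)"
  obtain u where lm: "left_module (Ah h) U" and u: "u \<in> carrier U"
    and cyc: "\<And>v. v \<in> carrier U \<Longrightarrow> \<exists>p. v = nf_elem h p \<odot>\<^bsub>U\<^esub> u"
    and ann: "\<And>p. nf_elem h p \<odot>\<^bsub>U\<^esub> u = \<zero>\<^bsub>U\<^esub> \<longleftrightarrow> [:f:] dvd p"
    using Um_cyclic[of h f] range_tmul_const[OF fh] unfolding U_def by auto
  interpret U: left_module "Ah h" U by (rule lm)
  have add: "nf_elem h p \<odot>\<^bsub>U\<^esub> u \<oplus>\<^bsub>U\<^esub> nf_elem h q \<odot>\<^bsub>U\<^esub> u = nf_elem h (p + q) \<odot>\<^bsub>U\<^esub> u" for p q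
    using u by (simp flip: U.smult_l_distr nf_elem_add)
  have mult: "nf_elem h p \<odot>\<^bsub>U\<^esub> (nf_elem h q \<odot>\<^bsub>U\<^esub> u) = nf_elem h (tmul h p q) \<odot>\<^bsub>U\<^esub> u" for p q
    using u by (simp flip: U.smult_assoc nf_elem_mult)
  have closed [simp]: "nf_elem h p \<odot>\<^bsub>U\<^esub> u \<in> carrier U" for p
    using u by (simp add: U.smult_closed)
  have eq: "nf_elem h p \<odot>\<^bsub>U\<^esub> u = nf_elem h q \<odot>\<^bsub>U\<^esub> u" if "[:f:] dvd p - q" for p q
    using add[of "p - q" q] ann[of "p - q"] that by simp
  \<comment> \<open>The lift chosen in \<open>gUm\<close>; it differs from g by a multiple of f,
    which kills u.\<close>
  define g0 where "g0 = (SOME g'. reduce_coeffs (PIdl\<^bsub>Rx\<^esub> f) g' = reduce_coeffs (PIdl\<^bsub>Rx\<^esub> f) g)"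
  have g0: "[:f:] dvd g0 - g"
    unfolding g0_def reduce_coeffs_eq_iff by (rule someI[of _ g]) simp
  define G where "G = right_form h g0"
  have G: "[:f:] dvd G - g"
    using dvd_add[OF right_form_cong[OF fh, of g0] g0] by (simp add: G_def)
  have Gt: "[:f:] dvd tmul h G p - p * g" for p
  proof -
    have "[:f:] dvd (tmul h G p - G * p) + p * (G - g)"
      using tmul_cong_mult[OF fh] G by (intro dvd_add dvd_mult)
    then show ?thesis by (simp add: algebra_simps)
  qed
  define N where "N = gUm h (PIdl\<^bsub>Rx\<^esub> f) (reduce_coeffs (PIdl\<^bsub>Rx\<^esub> f) g)"
  have "N = {nf_elem h G \<odot>\<^bsub>U\<^esub> w | w. w \<in> carrier U}"
    by (simp add: N_def gUm_def U_def G_def g0_def Ah_elem_eq)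
  also have "\<dots> = {nf_elem h (tmul h G p) \<odot>\<^bsub>U\<^esub> u | p. True}"
    by (auto simp flip: mult dest: cyc)
  also have "\<dots> = {nf_elem h p \<odot>\<^bsub>U\<^esub> u | p. p \<in> ideal_mod f g}"
  proof (intro equalityI subsetI)
    fix w assume "w \<in> {nf_elem h (tmul h G p) \<odot>\<^bsub>U\<^esub> u | p. True}"
    then show "w \<in> {nf_elem h p \<odot>\<^bsub>U\<^esub> u | p. p \<in> ideal_mod f g}"
      using Gt by (auto simp: ideal_mod_def)
  next
    fix w assume "w \<in> {nf_elem h p \<odot>\<^bsub>U\<^esub> u | p. p \<in> ideal_mod f g}"
    then obtain p a where w: "w = nf_elem h p \<odot>\<^bsub>U\<^esub> u" and a: "[:f:] dvd p - a * g"
      by (auto simp: ideal_mod_def)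
    have "[:f:] dvd (p - a * g) - (tmul h G a - a * g)" using a Gt by (rule dvd_diff)
    then have "w = nf_elem h (tmul h G a) \<odot>\<^bsub>U\<^esub> u" unfolding w by (intro eq) simp
    then show "w \<in> {nf_elem h (tmul h G p) \<odot>\<^bsub>U\<^esub> u | p. True}" by blast
  qed
  finally have N: "N = {nf_elem h p \<odot>\<^bsub>U\<^esub> u | p. p \<in> ideal_mod f g}" .
  have N_iff: "nf_elem h p \<odot>\<^bsub>U\<^esub> u \<in> N \<longleftrightarrow> p \<in> ideal_mod f g" for p
  proof
    assume "nf_elem h p \<odot>\<^bsub>U\<^esub> u \<in> N"
    then obtain q where q: "nf_elem h p \<odot>\<^bsub>U\<^esub> u = nf_elem h q \<odot>\<^bsub>U\<^esub> u" "q \<in> ideal_mod f g"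
      by (auto simp: N)
    have "nf_elem h (p - q) \<odot>\<^bsub>U\<^esub> u \<oplus>\<^bsub>U\<^esub> nf_elem h q \<odot>\<^bsub>U\<^esub> u = \<zero>\<^bsub>U\<^esub> \<oplus>\<^bsub>U\<^esub> nf_elem h q \<odot>\<^bsub>U\<^esub> u"
      by (simp add: add q(1))
    then have "nf_elem h (p - q) \<odot>\<^bsub>U\<^esub> u = \<zero>\<^bsub>U\<^esub>"
      using U.add.right_cancel[OF closed closed U.zero_closed] by blast
    then show "p \<in> ideal_mod f g" using ann ideal_mod_cong q(2) by blast
  qed (auto simp: N)
  have sub: "submodule N (Ah h) U"
  proof (rule U.submoduleI)
    show "N \<subseteq> carrier U" by (auto simp: N)
    have "0 \<in> ideal_mod f g" by (auto simp: ideal_mod_def intro: exI[of _ 0])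
    then show "\<zero>\<^bsub>U\<^esub> \<in> N" using ann[of 0] by (force simp: N)
  next
    fix v w assume "v \<in> N" "w \<in> N"
    then show "v \<oplus>\<^bsub>U\<^esub> w \<in> N" by (auto simp: N add intro: ideal_mod_add)
  next
    fix a v assume "a \<in> carrier (Ah h)" "v \<in> N"
    then show "a \<odot>\<^bsub>U\<^esub> v \<in> N" by (auto simp: carrier_Ah N mult intro: ideal_mod_tmul_left)
  qed
  have L: "L = quotient_module U N" by (simp add: L_def Lm_def U_def N_def)
  show thesis
  proof (rule that[of "N +>\<^bsub>U\<^esub> u"])
    show "left_module (Ah h) L" unfolding L by (rule left_module_quotient[OF lm sub])
    show "N +>\<^bsub>U\<^esub> u \<in> carrier L" using u by (simp add: L carrier_quotient_module[OF lm sub])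
    fix p
    have act: "nf_elem h p \<odot>\<^bsub>L\<^esub> (N +>\<^bsub>U\<^esub> u) = N +>\<^bsub>U\<^esub> (nf_elem h p \<odot>\<^bsub>U\<^esub> u)" for p
      using u by (simp add: L smult_quotient_module[OF lm sub])
    show "nf_elem h p \<odot>\<^bsub>L\<^esub> (N +>\<^bsub>U\<^esub> u) = \<zero>\<^bsub>L\<^esub> \<longleftrightarrow> p \<in> ideal_mod f g"
      unfolding act unfolding L zero_quotient_module[OF lm sub]
      by (simp add: quotient_module_coset_eq_zero_iff[OF lm sub] N_iff)
    fix w assume "w \<in> carrier L"
    then show "\<exists>p. w = nf_elem h p \<odot>\<^bsub>L\<^esub> (N +>\<^bsub>U\<^esub> u)"
      unfolding act unfolding L carrier_quotient_module[OF lm sub] using cyc by blast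
  qed
qed

lemma Ann_Lm:
  "Ann (Ah h) (Lm h (PIdl\<^bsub>Rx\<^esub> f) (reduce_coeffs (PIdl\<^bsub>Rx\<^esub> f) g)) = nf_elem h ` ideal_mod f g"
proof -
  define L where "L = Lm h (PIdl\<^bsub>Rx\<^esub> f) (reduce_coeffs (PIdl\<^bsub>Rx\<^esub> f) g)"
  obtain v where lm: "left_module (Ah h) L" and v: "v \<in> carrier L"
    and cyc: "\<And>w. w \<in> carrier L \<Longrightarrow> \<exists>p. w = nf_elem h p \<odot>\<^bsub>L\<^esub> v"
    and ann: "\<And>p. nf_elem h p \<odot>\<^bsub>L\<^esub> v = \<zero>\<^bsub>L\<^esub> \<longleftrightarrow> p \<in> ideal_mod f g"
    using Lm_cyclic[of g] unfolding L_def by blast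
  interpret L: left_module "Ah h" L by (rule lm)
  have "(\<forall>w\<in>carrier L. nf_elem h p \<odot>\<^bsub>L\<^esub> w = \<zero>\<^bsub>L\<^esub>) \<longleftrightarrow> p \<in> ideal_mod f g" for p
  proof
    assume p: "p \<in> ideal_mod f g"
    show "\<forall>w\<in>carrier L. nf_elem h p \<odot>\<^bsub>L\<^esub> w = \<zero>\<^bsub>L\<^esub>"
    proof
      fix w assume "w \<in> carrier L"
      then obtain q where q: "w = nf_elem h q \<odot>\<^bsub>L\<^esub> v" using cyc by blast
      have "nf_elem h p \<odot>\<^bsub>L\<^esub> w = nf_elem h (tmul h p q) \<odot>\<^bsub>L\<^esub> v"
        using v by (simp add: q flip: L.smult_assoc nf_elem_mult)
      also have "\<dots> = \<zero>\<^bsub>L\<^esub>" using ann p ideal_mod_tmul_right by blast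
      finally show "nf_elem h p \<odot>\<^bsub>L\<^esub> w = \<zero>\<^bsub>L\<^esub>" .
    qed
  qed (use v ann in blast)
  then show ?thesis
    unfolding Ann_def L_def[symmetric] by (auto simp: carrier_Ah)
qed

text \<open>The hypotheses say that R[Y] modulo (f, g) is a field. A commutative inverse q of p also
  inverts p for \<open>tmul\<close> modulo (f, g), so q brings p v back to the generator v.\<close>

lemma irreducible_Lm:
  assumes "1 \<notin> ideal_mod f g" "\<And>p. p \<notin> ideal_mod f g \<Longrightarrow> \<exists>q. q * p - 1 \<in> ideal_mod f g"
  shows "irreducible_module (Ah h) (Lm h (PIdl\<^bsub>Rx\<^esub> f) (reduce_coeffs (PIdl\<^bsub>Rx\<^esub> f) g))"
proof -
  define L where "L = Lm h (PIdl\<^bsub>Rx\<^esub> f) (reduce_coeffs (PIdl\<^bsub>Rx\<^esub> f) g)"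
  obtain v where lm: "left_module (Ah h) L" and v: "v \<in> carrier L"
    and cyc: "\<And>w. w \<in> carrier L \<Longrightarrow> \<exists>p. w = nf_elem h p \<odot>\<^bsub>L\<^esub> v"
    and ann: "\<And>p. nf_elem h p \<odot>\<^bsub>L\<^esub> v = \<zero>\<^bsub>L\<^esub> \<longleftrightarrow> p \<in> ideal_mod f g"
    using Lm_cyclic[of g] unfolding L_def by blast
  interpret L: left_module "Ah h" L by (rule lm)
  have one: "nf_elem h 1 \<odot>\<^bsub>L\<^esub> v = v" using L.smult_one[OF v] by (simp add: nf_elem_1)
  have "irreducible_module (Ah h) L"
  proof (rule L.irreducible_moduleI_cyclic[OF v])
    show "v \<noteq> \<zero>\<^bsub>L\<^esub>" using one ann[of 1] assms(1) by simp
    fix a assume "a \<in> carrier (Ah h)" and nz: "a \<odot>\<^bsub>L\<^esub> v \<noteq> \<zero>\<^bsub>L\<^esub>"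
    then obtain p where p: "a = nf_elem h p" by (auto simp: carrier_Ah)
    then have "p \<notin> ideal_mod f g" using nz ann by blast
    then obtain q where "q * p - 1 \<in> ideal_mod f g" using assms(2) by blast
    moreover have "[:f:] dvd (tmul h q p - 1) - (q * p - 1)"
      using tmul_cong_mult[OF fh, of q p] by simp
    ultimately have "tmul h q p - 1 \<in> ideal_mod f g" using ideal_mod_cong by blast
    then have z: "nf_elem h (tmul h q p - 1) \<odot>\<^bsub>L\<^esub> v = \<zero>\<^bsub>L\<^esub>" using ann by blast
    have "nf_elem h q \<odot>\<^bsub>L\<^esub> (a \<odot>\<^bsub>L\<^esub> v) = nf_elem h (tmul h q p - 1 + 1) \<odot>\<^bsub>L\<^esub> v"
      using v by (simp add: p flip: L.smult_assoc nf_elem_mult)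
    also have "\<dots> = nf_elem h (tmul h q p - 1) \<odot>\<^bsub>L\<^esub> v \<oplus>\<^bsub>L\<^esub> nf_elem h 1 \<odot>\<^bsub>L\<^esub> v"
      using v by (simp only: L.smult_l_distr nf_elem_closed flip: nf_elem_add)
    also have "\<dots> = v" using v by (simp add: z one)
    finally show "\<exists>b\<in>carrier (Ah h). b \<odot>\<^bsub>L\<^esub> (a \<odot>\<^bsub>L\<^esub> v) = v" using nf_elem_closed by blast
  next
    fix w assume "w \<in> carrier L"
    then show "\<exists>a\<in>carrier (Ah h). w = a \<odot>\<^bsub>L\<^esub> v" using cyc nf_elem_closed by blast
  qed
  then show ?thesis by (simp add: L_def)
qed

text \<open>A product p (t f) equals (p t) f, so A_h m is A_h f, which is f R[Y].\<close>

lemma ideal_prod_PIdl: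
  "carrier (Ah h) \<cdot>\<^bsub>Ah h\<^esub> (Ah_emb h ` (PIdl\<^bsub>Rx\<^esub> f)) = nf_elem h ` {p. [:f:] dvd p}"
proof (intro equalityI subsetI)
  fix x assume "x \<in> carrier (Ah h) \<cdot>\<^bsub>Ah h\<^esub> (Ah_emb h ` (PIdl\<^bsub>Rx\<^esub> f))"
  then show "x \<in> nf_elem h ` {p. [:f:] dvd p}"
  proof (induction x rule: ideal_prod.induct)
    case (prod i j)
    then obtain p t where "i = nf_elem h p" "j = nf_elem h [:t * f:]"
      by (auto simp: carrier_Ah PIdl_Rx Ah_emb_eq dvd_def mult.commute)
    moreover have "tmul h p [:t * f:] = tmul h (tmul h p [:t:]) [:f:]" by (simp add: tmul_assoc)
    moreover have "[:f:] dvd tmul h (tmul h p [:t:]) [:f:]" using range_tmul_const[OF fh] by blast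
    ultimately show ?case by (auto simp: nf_elem_mult)
  next
    case (sum s t)
    then show ?case by (auto simp: nf_elem_add)
  qed
next
  fix x assume "x \<in> nf_elem h ` {p. [:f:] dvd p}"
  then obtain q where "x = nf_elem h (tmul h q [:f:])" unfolding range_tmul_const[OF fh, symmetric] by blast
  then have "x = nf_elem h q \<otimes>\<^bsub>Ah h\<^esub> Ah_emb h f" by (simp add: nf_elem_mult Ah_emb_eq)
  then show "x \<in> carrier (Ah h) \<cdot>\<^bsub>Ah h\<^esub> (Ah_emb h ` (PIdl\<^bsub>Rx\<^esub> f))"
    by (auto simp: PIdl_Rx intro: ideal_prod.prod)
qed

text \<open>Modulo f the products a g in A_h are commutative products, and A_h m supplies all
  multiples of f; so the sum is (f, g).\<close>

lemma left_ideal_sum_eq: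
  "{a \<otimes>\<^bsub>Ah h\<^esub> Ah_elem h g | a. a \<in> carrier (Ah h)}
      <+>\<^bsub>Ah h\<^esub> (carrier (Ah h) \<cdot>\<^bsub>Ah h\<^esub> (Ah_emb h ` (PIdl\<^bsub>Rx\<^esub> f))) = nf_elem h ` ideal_mod f g"
proof -
  define G where "G = right_form h g"
  have G: "[:f:] dvd G - g"
    using right_form_cong[OF fh, of g] by (simp add: G_def)
  have Gt: "[:f:] dvd tmul h p G - p * g" for p
  proof -
    have "[:f:] dvd (tmul h p G - p * G) + p * (G - g)"
      using tmul_cong_mult[OF fh] G by (intro dvd_add dvd_mult)
    then show ?thesis by (simp add: algebra_simps)
  qed
  have "{a \<otimes>\<^bsub>Ah h\<^esub> Ah_elem h g | a. a \<in> carrier (Ah h)}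
      <+>\<^bsub>Ah h\<^esub> (carrier (Ah h) \<cdot>\<^bsub>Ah h\<^esub> (Ah_emb h ` (PIdl\<^bsub>Rx\<^esub> f))) =
    {nf_elem h (tmul h a G + s) | a s. [:f:] dvd s}"
    unfolding ideal_prod_PIdl set_add_def' Ah_elem_eq G_def[symmetric]
  proof (intro equalityI subsetI)
    fix x assume "x \<in> (\<Union>y\<in>{a \<otimes>\<^bsub>Ah h\<^esub> nf_elem h G | a. a \<in> carrier (Ah h)}.
      \<Union>z\<in>nf_elem h ` {p. [:f:] dvd p}. {y \<oplus>\<^bsub>Ah h\<^esub> z})"
    then obtain a s where "a \<in> carrier (Ah h)" "[:f:] dvd s" "x = (a \<otimes>\<^bsub>Ah h\<^esub> nf_elem h G) \<oplus>\<^bsub>Ah h\<^esub> nf_elem h s"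
      by blast
    moreover from this obtain p where "a = nf_elem h p" by (auto simp: carrier_Ah)
    ultimately have "x = nf_elem h (tmul h p G + s)" "[:f:] dvd s"
      by (simp_all add: nf_elem_mult nf_elem_add)
    then show "x \<in> {nf_elem h (tmul h a G + s) | a s. [:f:] dvd s}" by blast
  next
    fix x assume "x \<in> {nf_elem h (tmul h a G + s) | a s. [:f:] dvd s}"
    then obtain a s where x: "x = nf_elem h (tmul h a G + s)" and s: "[:f:] dvd s" by blast
    have "x = (nf_elem h a \<otimes>\<^bsub>Ah h\<^esub> nf_elem h G) \<oplus>\<^bsub>Ah h\<^esub> nf_elem h s"
      unfolding x nf_elem_mult nf_elem_add ..
    then show "x \<in> (\<Union>y\<in>{a \<otimes>\<^bsub>Ah h\<^esub> nf_elem h G | a. a \<in> carrier (Ah h)}.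
      \<Union>z\<in>nf_elem h ` {p. [:f:] dvd p}. {y \<oplus>\<^bsub>Ah h\<^esub> z})"
      using s nf_elem_closed[of h a] by blast
  qed
  also have "\<dots> = nf_elem h ` ideal_mod f g"
  proof (intro equalityI subsetI)
    fix x assume "x \<in> {nf_elem h (tmul h a G + s) | a s. [:f:] dvd s}"
    then obtain a s where x: "x = nf_elem h (tmul h a G + s)" and s: "[:f:] dvd s" by blast
    have "[:f:] dvd (tmul h a G - a * g) + s" using Gt s by (rule dvd_add)
    then have "tmul h a G + s \<in> ideal_mod f g"
      unfolding ideal_mod_def by (intro CollectI exI[of _ a]) (simp add: algebra_simps)
    then show "x \<in> nf_elem h ` ideal_mod f g" using x by blast
  next
    fix x assume "x \<in> nf_elem h ` ideal_mod f g"
    then obtain p a where x: "x = nf_elem h p" and a: "[:f:] dvd p - a * g"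
      by (auto simp: ideal_mod_def)
    have "[:f:] dvd (p - a * g) - (tmul h a G - a * g)" using a Gt by (rule dvd_diff)
    then have "[:f:] dvd p - tmul h a G" by simp
    moreover have "x = nf_elem h (tmul h a G + (p - tmul h a G))" using x by simp
    ultimately show "x \<in> {nf_elem h (tmul h a G + s) | a s. [:f:] dvd s}" by blast
  qed
  finally show ?thesis .
qed

end

section \<open>Monic primes over the residue field\<close>

context
  fixes f :: "'a::field poly"
begin

interpretation I: ideal "PIdl\<^bsub>Rx\<^esub> f" "Rx :: 'a poly ring"
  by (rule cring.cgenideal_ideal[OF cring_from_type_algebra]) simp

abbreviation (input) coset_mod where "coset_mod r \<equiv> PIdl\<^bsub>Rx\<^esub> f +>\<^bsub>Rx\<^esub> r"

abbreviation (input) quot_ring where "quot_ring \<equiv> Rx Quot (PIdl\<^bsub>Rx\<^esub> f)"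

lemma ring_quot_ring: "ring quot_ring"
  by (rule I.quotient_is_ring)

lemma carrier_quot_ring: "carrier quot_ring = range coset_mod"
  by (auto simp: FactRing_def A_RCOSETS_def')

lemma mult_quot_ring: "coset_mod r \<otimes>\<^bsub>quot_ring\<^esub> coset_mod s = coset_mod (r * s)"
  by (simp add: FactRing_def I.rcoset_mult_add[simplified])

lemma add_quot_ring: "coset_mod r \<oplus>\<^bsub>quot_ring\<^esub> coset_mod s = coset_mod (r + s)"
  by (simp add: FactRing_def I.a_rcos_sum[simplified])

lemma zero_quot_ring: "\<zero>\<^bsub>quot_ring\<^esub> = coset_mod 0"
  using I.a_rcos_const[of 0] by (simp add: FactRing_def PIdl_Rx)

lemma one_quot_ring: "\<one>\<^bsub>quot_ring\<^esub> = coset_mod 1"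
  by (simp add: FactRing_def)

lemma sum_quot_ring: "finite S \<Longrightarrow> (\<Oplus>\<^bsub>quot_ring\<^esub>i\<in>S. coset_mod (r i)) = coset_mod (\<Sum>i\<in>S. r i)"
proof (induction S rule: finite_induct)
  case empty
  interpret K: ring quot_ring by (rule ring_quot_ring)
  show ?case by (simp add: zero_quot_ring)
next
  interpret K: ring quot_ring by (rule ring_quot_ring)
  case (insert x S)
  then show ?case by (simp add: K.finsum_insert add_quot_ring carrier_quot_ring)
qed

lemma reduce_coeffs_closed: "reduce_coeffs (PIdl\<^bsub>Rx\<^esub> f) g \<in> up quot_ring"
proof (rule mem_upI)
  show "reduce_coeffs (PIdl\<^bsub>Rx\<^esub> f) g n \<in> carrier quot_ring" for n
    by (simp add: reduce_coeffs_def carrier_quot_ring)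
  show "\<exists>n. bound \<zero>\<^bsub>quot_ring\<^esub> n (reduce_coeffs (PIdl\<^bsub>Rx\<^esub> f) g)"
    by (rule exI[of _ "Polynomial.degree g"])
       (auto simp: reduce_coeffs_def zero_quot_ring coeff_eq_0 intro!: bound.intro)
qed

lemma carrier_Qm: "carrier (Qm (PIdl\<^bsub>Rx\<^esub> f)) = range (reduce_coeffs (PIdl\<^bsub>Rx\<^esub> f))"
proof (intro equalityI subsetI)
  fix p assume "p \<in> carrier (Qm (PIdl\<^bsub>Rx\<^esub> f))"
  then have p: "p \<in> up quot_ring" by (simp add: Qm_def UP_def)
  then obtain n where n: "bound \<zero>\<^bsub>quot_ring\<^esub> n p" by (auto simp: up_def)
  have "p i \<in> carrier quot_ring" for i
    using p by (auto simp: up_def)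
  then have "\<exists>c. p i = coset_mod c" for i
    unfolding carrier_quot_ring by blast
  then obtain c where c: "\<And>i. p i = coset_mod (c i)" by metis
  define g where "g = (\<Sum>i\<le>n. Polynomial.monom (c i) i)"
  have "Polynomial.coeff g i = (if i \<le> n then c i else 0)" for i
    by (simp add: g_def coeff_sum)
  moreover have "coset_mod (c i) = coset_mod 0" if "\<not> i \<le> n" for i
    using bound.bound[OF n, of i] that by (simp add: c zero_quot_ring)
  ultimately have "reduce_coeffs (PIdl\<^bsub>Rx\<^esub> f) g = p"
    by (simp add: reduce_coeffs_def fun_eq_iff c)
  then show "p \<in> range (reduce_coeffs (PIdl\<^bsub>Rx\<^esub> f))" by blast
qed (use reduce_coeffs_closed in \<open>auto simp: Qm_def UP_def\<close>)

lemma zero_Qm: "\<zero>\<^bsub>Qm (PIdl\<^bsub>Rx\<^esub> f)\<^esub> = reduce_coeffs (PIdl\<^bsub>Rx\<^esub> f) 0"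
  by (simp add: Qm_def UP_def reduce_coeffs_def zero_quot_ring)

lemma one_Qm: "\<one>\<^bsub>Qm (PIdl\<^bsub>Rx\<^esub> f)\<^esub> = reduce_coeffs (PIdl\<^bsub>Rx\<^esub> f) 1"
  by (auto simp: Qm_def UP_def reduce_coeffs_def zero_quot_ring one_quot_ring fun_eq_iff)

lemma mult_Qm:
  "reduce_coeffs (PIdl\<^bsub>Rx\<^esub> f) p \<otimes>\<^bsub>Qm (PIdl\<^bsub>Rx\<^esub> f)\<^esub> reduce_coeffs (PIdl\<^bsub>Rx\<^esub> f) q
    = reduce_coeffs (PIdl\<^bsub>Rx\<^esub> f) (p * q)"
proof -
  have "reduce_coeffs (PIdl\<^bsub>Rx\<^esub> f) p \<otimes>\<^bsub>Qm (PIdl\<^bsub>Rx\<^esub> f)\<^esub> reduce_coeffs (PIdl\<^bsub>Rx\<^esub> f) q =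
      (\<lambda>n. \<Oplus>\<^bsub>quot_ring\<^esub>i\<in>{..n}. coset_mod (Polynomial.coeff p i) \<otimes>\<^bsub>quot_ring\<^esub> coset_mod (Polynomial.coeff q (n - i)))"
    using reduce_coeffs_closed by (simp add: Qm_def UP_def reduce_coeffs_def)
  also have "\<dots> = reduce_coeffs (PIdl\<^bsub>Rx\<^esub> f) (p * q)"
    by (simp add: mult_quot_ring sum_quot_ring reduce_coeffs_def coeff_mult)
  finally show ?thesis .
qed

lemma divides_Qm:
  "reduce_coeffs (PIdl\<^bsub>Rx\<^esub> f) p divides\<^bsub>Qm (PIdl\<^bsub>Rx\<^esub> f)\<^esub> reduce_coeffs (PIdl\<^bsub>Rx\<^esub> f) q
    \<longleftrightarrow> q \<in> ideal_mod f p"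
  by (simp add: factor_def carrier_Qm mult_Qm reduce_coeffs_eq_iff ideal_mod_def mult.commute)

lemma Units_Qm:
  "reduce_coeffs (PIdl\<^bsub>Rx\<^esub> f) p \<in> Units (Qm (PIdl\<^bsub>Rx\<^esub> f)) \<longleftrightarrow> 1 \<in> ideal_mod f p"
proof -
  have "reduce_coeffs (PIdl\<^bsub>Rx\<^esub> f) p \<in> Units (Qm (PIdl\<^bsub>Rx\<^esub> f)) \<longleftrightarrow> (\<exists>q. [:f:] dvd q * p - 1)"
    by (auto simp: Units_def carrier_Qm one_Qm mult_Qm reduce_coeffs_eq_iff mult.commute)
  also have "\<dots> \<longleftrightarrow> (\<exists>q. [:f:] dvd 1 - q * p)"
    using dvd_minus_iff[of "[:f:]" "_ * p - 1"] by simp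
  finally show ?thesis by (simp add: ideal_mod_def)
qed

text \<open>The leading coefficient 1 survives in R/f because f is not a unit.\<close>

lemma deg_reduce_coeffs:
  assumes "Polynomial.lead_coeff g = 1" "\<not> is_unit f"
  shows "deg quot_ring (reduce_coeffs (PIdl\<^bsub>Rx\<^esub> f) g) = Polynomial.degree g"
proof -
  have c: "up_ring.coeff (UP quot_ring) (reduce_coeffs (PIdl\<^bsub>Rx\<^esub> f) g) = reduce_coeffs (PIdl\<^bsub>Rx\<^esub> f) g"
    using reduce_coeffs_closed by (simp add: UP_def)
  show ?thesis
    unfolding deg_def c
  proof (rule Least_equality)
    show "bound \<zero>\<^bsub>quot_ring\<^esub> (Polynomial.degree g) (reduce_coeffs (PIdl\<^bsub>Rx\<^esub> f) g)"
      by (auto simp: reduce_coeffs_def zero_quot_ring coeff_eq_0 intro!: bound.intro)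
    fix n assume n: "bound \<zero>\<^bsub>quot_ring\<^esub> n (reduce_coeffs (PIdl\<^bsub>Rx\<^esub> f) g)"
    show "Polynomial.degree g \<le> n"
    proof (rule ccontr)
      assume "\<not> Polynomial.degree g \<le> n"
      then have "coset_mod 1 = coset_mod 0"
        using bound.bound[OF n, of "Polynomial.degree g"] assms(1) by (simp add: reduce_coeffs_def zero_quot_ring)
      then show False using assms(2) by (simp add: coset_Rx_eq_iff)
    qed
  qed
qed

text \<open>Maximality makes (f, g) prime. If g = q p modulo f with p outside (f, g), then q = d g
  modulo f, so f divides g (1 - d p). As f is prime in R[Y] and does not divide g, p is a unit
  modulo f.\<close>

lemma monic_prime_reduce_coeffs:
  assumes f: "Factorial_Ring.irreducible f" and g: "Polynomial.lead_coeff g = 1"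
    and one: "1 \<notin> ideal_mod f g"
    and max: "\<And>p. p \<notin> ideal_mod f g \<Longrightarrow> \<exists>q. q * p - 1 \<in> ideal_mod f g"
  shows "monic_prime (PIdl\<^bsub>Rx\<^esub> f) (reduce_coeffs (PIdl\<^bsub>Rx\<^esub> f) g)"
proof -
  have nu: "\<not> is_unit f" using f by (rule irreducible_not_unit)
  have pf: "prime_elem [:f:]"
    using field_poly_irreducible_imp_prime[OF f] by (rule lift_prime_elem_poly)
  have g_mem: "g \<in> ideal_mod f g" by (auto simp: ideal_mod_def intro: exI[of _ 1])
  have ng: "\<not> [:f:] dvd g"
  proof
    assume "[:f:] dvd g"
    then have "f dvd Polynomial.lead_coeff g" by (simp only: const_poly_dvd_iff)
    then show False using g nu by simp
  qed
  have prime: "p \<in> ideal_mod f g \<or> q \<in> ideal_mod f g" if "p * q \<in> ideal_mod f g" for p q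
  proof (rule ccontr)
    assume neg: "\<not> (p \<in> ideal_mod f g \<or> q \<in> ideal_mod f g)"
    then obtain s where "s * p - 1 \<in> ideal_mod f g" using max by blast
    then have "q * (s * p - 1) \<in> ideal_mod f g" by (rule ideal_mod_mult)
    then have "(- 1) * (q * (s * p - 1)) \<in> ideal_mod f g" by (rule ideal_mod_mult)
    \<comment> \<open>The combination equals q, which contradicts \<open>neg\<close>.\<close>
    then have "s * (p * q) + (- 1) * (q * (s * p - 1)) \<in> ideal_mod f g"
      using ideal_mod_mult[OF that] by (rule ideal_mod_add[rotated])
    then show False using neg by (simp add: algebra_simps)
  qed
  have "irreducible (Qm (PIdl\<^bsub>Rx\<^esub> f)) (reduce_coeffs (PIdl\<^bsub>Rx\<^esub> f) g)"
  proof (rule irreducibleI)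
    show "reduce_coeffs (PIdl\<^bsub>Rx\<^esub> f) g \<notin> Units (Qm (PIdl\<^bsub>Rx\<^esub> f))"
      using one by (simp add: Units_Qm)
    fix b assume "b \<in> carrier (Qm (PIdl\<^bsub>Rx\<^esub> f))"
      and pfac: "properfactor (Qm (PIdl\<^bsub>Rx\<^esub> f)) b (reduce_coeffs (PIdl\<^bsub>Rx\<^esub> f) g)"
    then obtain p where b: "b = reduce_coeffs (PIdl\<^bsub>Rx\<^esub> f) p" by (auto simp: carrier_Qm)
    then have "g \<in> ideal_mod f p" and np: "p \<notin> ideal_mod f g"
      using pfac by (auto simp: properfactor_def divides_Qm)
    then obtain q where q: "[:f:] dvd g - q * p" by (auto simp: ideal_mod_def)
    then have "q * p \<in> ideal_mod f g" using ideal_mod_cong g_mem by blast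
    then have "q \<in> ideal_mod f g" using prime np by blast
    then obtain d where d: "[:f:] dvd q - d * g" by (auto simp: ideal_mod_def)
    have "[:f:] dvd (g - q * p) + p * (q - d * g)"
      using q dvd_mult[OF d] by (rule dvd_add)
    then have "[:f:] dvd g * (1 - d * p)" by (simp add: algebra_simps)
    then have "[:f:] dvd 1 - d * p" using pf ng by (simp add: prime_elem_dvd_mult_iff)
    then show "b \<in> Units (Qm (PIdl\<^bsub>Rx\<^esub> f))" unfolding b Units_Qm by (auto simp: ideal_mod_def)
  qed
  moreover have "reduce_coeffs (PIdl\<^bsub>Rx\<^esub> f) g \<noteq> \<zero>\<^bsub>Qm (PIdl\<^bsub>Rx\<^esub> f)\<^esub>"
    using ng by (simp add: zero_Qm reduce_coeffs_eq_iff)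
  moreover have "up_ring.coeff (Qm (PIdl\<^bsub>Rx\<^esub> f)) (reduce_coeffs (PIdl\<^bsub>Rx\<^esub> f) g) (Polynomial.degree g) = \<one>\<^bsub>quot_ring\<^esub>"
    using reduce_coeffs_closed g by (simp add: Qm_def UP_def) (simp add: reduce_coeffs_def one_quot_ring)
  ultimately show ?thesis
    unfolding monic_prime_def deg_reduce_coeffs[OF g nu] ring_irreducible_def
    by (simp add: carrier_Qm)
qed

text \<open>The image of J in the principal ideal domain (R/f)[Y] is generated by a nonzero element
  of least degree. The proof works with lifts: among the elements of J not divisible by f, one of
  least degree is made monic.\<close>

lemma maximal_ideal_generator:
  fixes J :: "'a poly poly set"
  assumes f: "Factorial_Ring.irreducible f" "[:f:] \<in> J"
    and add: "\<And>p q. p \<in> J \<Longrightarrow> q \<in> J \<Longrightarrow> p + q \<in> J" and mult: "\<And>p q. p \<in> J \<Longrightarrow> q * p \<in> J"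
    and one: "1 \<notin> J" and max: "\<And>p. p \<notin> J \<Longrightarrow> \<exists>q. q * p - 1 \<in> J"
  obtains g where "Polynomial.lead_coeff g = 1" "J = ideal_mod f g"
proof -
  have fJ: "p \<in> J" if "[:f:] dvd p" for p
    using that mult[OF f(2)] by (auto simp: dvd_def mult.commute)
  have diff: "p - q \<in> J" if "p \<in> J" "q \<in> J" for p q
    using add[OF that(1) mult[OF that(2), of "- 1"]] by simp
  \<comment> \<open>J is larger than f R[Y], because Y is not invertible modulo f: the constant
    coefficient of q Y - 1 is -1.\<close>
  have "\<exists>p. p \<in> J \<and> \<not> [:f:] dvd p"
  proof (rule ccontr)
    assume "\<nexists>p. p \<in> J \<and> \<not> [:f:] dvd p"
    then have J: "J = {p. [:f:] dvd p}" using fJ by blast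
    have nu: "\<not> is_unit f" using f(1) by (rule irreducible_not_unit)
    have "[:0, 1:] \<notin> J"
    proof
      assume "[:0, 1:] \<in> J"
      then have "f dvd Polynomial.coeff [:0, 1:] 1" unfolding J const_poly_dvd_iff by blast
      then show False using nu by simp
    qed
    then obtain q where "q * [:0, 1:] - 1 \<in> J" using max by blast
    then have "f dvd Polynomial.coeff (q * [:0, 1:] - 1) 0" unfolding J const_poly_dvd_iff by blast
    then show False using nu by (simp add: mult.commute)
  qed
  then obtain p0 where p0: "p0 \<in> J \<and> \<not> [:f:] dvd p0" by blast
  define g1 where "g1 = (ARG_MIN Polynomial.degree p. p \<in> J \<and> \<not> [:f:] dvd p)"
  have g1: "g1 \<in> J \<and> \<not> [:f:] dvd g1"
    unfolding g1_def by (rule arg_min_natI) (rule p0)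
  have min: "Polynomial.degree g1 \<le> Polynomial.degree p" if "p \<in> J" "\<not> [:f:] dvd p" for p
    unfolding g1_def by (rule arg_min_nat_le) (use that in blast)
  define n where "n = Polynomial.degree g1"
  have "\<not> f dvd Polynomial.lead_coeff g1"
  proof
    assume d: "f dvd Polynomial.lead_coeff g1"
    define p where "p = g1 - Polynomial.monom (Polynomial.lead_coeff g1) n"
    have dm: "[:f:] dvd Polynomial.monom (Polynomial.lead_coeff g1) n"
      using d by (auto simp: const_poly_dvd_iff)
    then have "[:f:] dvd g1" if "[:f:] dvd p"
      using dvd_add[OF that dm] by (simp add: p_def)
    then have p: "p \<in> J" "\<not> [:f:] dvd p"
      using g1 diff[OF _ fJ[OF dm]] by (auto simp: p_def)
    have le: "Polynomial.degree p \<le> n" 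
      unfolding p_def n_def by (intro degree_diff_le) (simp_all add: Polynomial.degree_monom_le)
    moreover have "Polynomial.coeff p n = 0" by (simp add: p_def n_def)
    ultimately have "p = 0 \<or> Polynomial.degree p < n"
      by (metis le_neq_implies_less leading_coeff_0_iff)
    then show False using p min[OF p] by (auto simp: n_def)
  qed
  then obtain u v where uv: "u * f + v * Polynomial.lead_coeff g1 = 1"
    using irreducible_poly_bezout[OF f(1)] by blast
  \<comment> \<open>Here v inverts the leading coefficient of g1 modulo f, and the summand u f Y^n,
    which lies in J, completes it to exactly 1.\<close>
  define g where "g = Polynomial.smult v g1 + Polynomial.monom (u * f) n"
  have "[:f:] dvd Polynomial.monom (u * f) n" by (auto simp: const_poly_dvd_iff)
  moreover have "Polynomial.smult v g1 \<in> J" using mult[of g1 "[:v:]"] g1 by simp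
  ultimately have gJ: "g \<in> J" unfolding g_def using add fJ by blast
  have cg: "Polynomial.coeff g n = 1" using uv by (simp add: g_def n_def add.commute)
  have "Polynomial.degree g \<le> n"
    unfolding g_def n_def
    by (intro degree_add_le) (simp_all add: Polynomial.degree_monom_le degree_smult_le)
  moreover have "n \<le> Polynomial.degree g" using cg by (intro le_degree) simp
  ultimately have deg: "Polynomial.degree g = n" by simp
  have lead: "Polynomial.lead_coeff g = 1" using cg deg by simp
  have "J = ideal_mod f g"
  proof (intro equalityI subsetI)
    fix p assume p: "p \<in> J"
    \<comment> \<open>For the monic g, pseudo-division is ordinary division. The remainder lies in J
      and has degree below n unless it is 0, so f divides it.\<close>
    obtain q r where qr: "pseudo_divmod p g = (q, r)" by (cases "pseudo_divmod p g")
    have g0: "g \<noteq> 0" using lead by auto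
    have "p = g * q + r" and r: "r = 0 \<or> Polynomial.degree r < Polynomial.degree g"
      using pseudo_divmod[OF g0 qr] lead by simp_all
    then have eq: "r = p - q * g" by (simp add: mult.commute)
    then have "r \<in> J" using p gJ diff mult by blast
    have "[:f:] dvd r"
    proof (rule ccontr)
      assume "\<not> [:f:] dvd r"
      then show False using min[OF \<open>r \<in> J\<close>] r deg by (auto simp: n_def)
    qed
    then show "p \<in> ideal_mod f g" unfolding eq ideal_mod_def by blast
  next
    fix p assume "p \<in> ideal_mod f g"
    then obtain a where "[:f:] dvd p - a * g" by (auto simp: ideal_mod_def)
    then have "(p - a * g) + a * g \<in> J" by (intro add fJ mult gJ)
    then show "p \<in> J" by simp
  qed
  then show thesis using that lead by blast
qed

end

section \<open>Primitive ideals\<close>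

lemma ideal_tmul_Ann:
  assumes "left_module (Ah h) M"
  shows "ideal_tmul h {p. nf_elem h p \<in> Ann (Ah h) M}"
proof -
  interpret M: left_module "Ah h" M by (rule assms)
  show ?thesis
  proof (unfold_locales, goal_cases)
    case (1 p q)
    then show ?case by (auto simp: Ann_def M.smult_l_distr simp flip: nf_elem_add)
  next
    case (2 p q)
    then show ?case by (auto simp: Ann_def M.smult_assoc M.smult_r_zero simp flip: nf_elem_mult)
  next
    case (3 p q)
    then show ?case by (auto simp: Ann_def M.smult_assoc M.smult_closed simp flip: nf_elem_mult)
  qed
qed

lemma zero_mem_Ann:
  assumes "left_module (Ah h) M"
  shows "\<zero>\<^bsub>Ah h\<^esub> \<in> Ann (Ah h) M"
proof -
  interpret M: left_module "Ah h" M by (rule assms)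
  show ?thesis by (auto simp: Ann_def M.smult_l_zero)
qed

text \<open>That p u \<noteq> 0 means that p lies outside A_h f. The left ideal A_h p + A_h f then
  contains 1 = q p + s f, and q takes p u back to u.\<close>

lemma irreducible_Um:
  fixes h f :: "'a::field poly"
  assumes char: "CHAR('a) = 0" and f: "Factorial_Ring.irreducible f" "\<not> f dvd h"
  shows "irreducible_module (Ah h) (Um h (PIdl\<^bsub>Rx\<^esub> f))"
proof -
  define U where "U = Um h (PIdl\<^bsub>Rx\<^esub> f)"
  obtain u where lm: "left_module (Ah h) U" and u: "u \<in> carrier U"
    and cyc: "\<And>v. v \<in> carrier U \<Longrightarrow> \<exists>p. v = nf_elem h p \<odot>\<^bsub>U\<^esub> u"
    and ann: "\<And>p. nf_elem h p \<odot>\<^bsub>U\<^esub> u = \<zero>\<^bsub>U\<^esub> \<longleftrightarrow> p \<in> range (\<lambda>q. tmul h q [:f:])"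
    using Um_cyclic[of h f] unfolding U_def by blast
  interpret U: left_module "Ah h" U by (rule lm)
  have one: "nf_elem h 1 \<odot>\<^bsub>U\<^esub> u = u" using U.smult_one[OF u] by (simp add: nf_elem_1)
  have "irreducible_module (Ah h) U"
  proof (rule U.irreducible_moduleI_cyclic[OF u])
    have "\<not> is_unit f" using f(1) by (rule irreducible_not_unit)
    then have "1 \<notin> range (\<lambda>q. tmul h q [:f:])"
      using dvd_of_const_mem_range[of 1 h f] by (auto simp: one_pCons[symmetric] simp del: one_pCons)
    then show "u \<noteq> \<zero>\<^bsub>U\<^esub>" using one ann[of 1] by metis
    fix a assume "a \<in> carrier (Ah h)" and nz: "a \<odot>\<^bsub>U\<^esub> u \<noteq> \<zero>\<^bsub>U\<^esub>"
    then obtain p where p: "a = nf_elem h p" by (auto simp: carrier_Ah)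
    then have np: "p \<notin> range (\<lambda>q. tmul h q [:f:])" using nz ann by blast
    define J where "J = {tmul h q p + tmul h s [:f:] | q s. True}"
    have J: "tmul h q p + tmul h s [:f:] \<in> J" for q s by (auto simp: J_def)
    interpret J: left_ideal_tmul h J
    proof
      fix x y assume "x \<in> J" "y \<in> J"
      then obtain q s q' s' where "x = tmul h q p + tmul h s [:f:]" "y = tmul h q' p + tmul h s' [:f:]"
        by (auto simp: J_def)
      then have "x + y = tmul h (q + q') p + tmul h (s + s') [:f:]" by (simp add: tmul_add_left)
      then show "x + y \<in> J" using J by simp
    next
      fix x t assume "x \<in> J"
      then obtain q s where "x = tmul h q p + tmul h s [:f:]" by (auto simp: J_def)
      then have "tmul h t x = tmul h (tmul h t q) p + tmul h (tmul h t s) [:f:]"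
        by (simp add: tmul_add_right tmul_assoc)
      then show "tmul h t x \<in> J" using J by simp
    qed
    have "1 \<in> J"
    proof (rule J.one_mem_of_irreducible[OF char f])
      show "[:f:] \<in> J" using J[of 0 1] by simp
      show "p \<in> J" using J[of 1 0] by simp
    qed (rule np)
    then obtain q s where qs: "1 = tmul h q p + tmul h s [:f:]" by (auto simp: J_def)
    have z: "nf_elem h (tmul h s [:f:]) \<odot>\<^bsub>U\<^esub> u = \<zero>\<^bsub>U\<^esub>" using ann by blast
    have "u = nf_elem h (tmul h q p + tmul h s [:f:]) \<odot>\<^bsub>U\<^esub> u" using one qs by simp
    also have "\<dots> = nf_elem h (tmul h q p) \<odot>\<^bsub>U\<^esub> u \<oplus>\<^bsub>U\<^esub> nf_elem h (tmul h s [:f:]) \<odot>\<^bsub>U\<^esub> u"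
      using u by (simp only: U.smult_l_distr nf_elem_closed flip: nf_elem_add)
    also have "\<dots> = nf_elem h (tmul h q p) \<odot>\<^bsub>U\<^esub> u"
      using u by (simp add: z U.smult_closed)
    also have "\<dots> = nf_elem h q \<odot>\<^bsub>U\<^esub> (a \<odot>\<^bsub>U\<^esub> u)"
      using u by (simp add: p flip: U.smult_assoc nf_elem_mult)
    finally show "\<exists>b\<in>carrier (Ah h). b \<odot>\<^bsub>U\<^esub> (a \<odot>\<^bsub>U\<^esub> u) = u" using nf_elem_closed by metis
  next
    fix w assume "w \<in> carrier U"
    then show "\<exists>a\<in>carrier (Ah h). w = a \<odot>\<^bsub>U\<^esub> u" using cyc nf_elem_closed by blast
  qed
  then show ?thesis by (simp add: U_def)
qed

text \<open>A nonzero annihilator would contain a nonzero r in R that divides delta(r). As r kills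
  the generator, it lies in A_h f, so f divides r and therefore h.\<close>

lemma Ann_Um:
  fixes h f :: "'a::field poly"
  assumes char: "CHAR('a) = 0" "h \<noteq> 0" and f: "Factorial_Ring.irreducible f" "\<not> f dvd h"
  shows "Ann (Ah h) (Um h (PIdl\<^bsub>Rx\<^esub> f)) = {\<zero>\<^bsub>Ah h\<^esub>}"
proof (rule ccontr)
  define U where "U = Um h (PIdl\<^bsub>Rx\<^esub> f)"
  obtain u where lm: "left_module (Ah h) U" and u: "u \<in> carrier U"
    and cyc: "\<And>v. v \<in> carrier U \<Longrightarrow> \<exists>p. v = nf_elem h p \<odot>\<^bsub>U\<^esub> u"
    and ann: "\<And>p. nf_elem h p \<odot>\<^bsub>U\<^esub> u = \<zero>\<^bsub>U\<^esub> \<longleftrightarrow> p \<in> range (\<lambda>q. tmul h q [:f:])"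
    using Um_cyclic[of h f] unfolding U_def by blast
  define J where "J = {p. nf_elem h p \<in> Ann (Ah h) U}"
  interpret J: ideal_tmul h J
    unfolding J_def by (rule ideal_tmul_Ann[OF lm])
  assume "Ann (Ah h) (Um h (PIdl\<^bsub>Rx\<^esub> f)) \<noteq> {\<zero>\<^bsub>Ah h\<^esub>}"
  then obtain a where a: "a \<in> Ann (Ah h) U" "a \<noteq> \<zero>\<^bsub>Ah h\<^esub>"
    using zero_mem_Ann[OF lm] by (auto simp: U_def)
  then obtain p where "a = nf_elem h p" by (auto simp: Ann_def carrier_Ah)
  then have "p \<in> J" "p \<noteq> 0" using a by (auto simp: J_def nf_elem_0)
  then obtain s where s: "[:s:] \<in> J" "s \<noteq> 0" using J.const_mem[OF char] by blast
  obtain r where r: "r \<noteq> 0" "[:r:] \<in> J" "r dvd delta h r"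
    by (rule J.const_mem_minimal[OF s]) (rule that)
  then have "nf_elem h [:r:] \<odot>\<^bsub>U\<^esub> u = \<zero>\<^bsub>U\<^esub>" using u by (simp add: J_def Ann_def)
  then have "f dvd r" using ann dvd_of_const_mem_range by blast
  then show False
    using irreducible_dvd_of_dvd_delta[OF char(1) r(1,3) f(1)] f(2) by simp
qed

text \<open>The zero ideal is invariant under delta, so m is generated by a prime f. If f divided h,
  every delta(r) = r' h would lie in m; hence f does not divide h.\<close>

lemma Ann_Um_maximal:
  fixes h :: "'a::field poly"
  assumes char: "CHAR('a) = 0" "h \<noteq> 0" and m: "maximalideal m Rx" "\<not> delta_invariant h m"
  shows "Ann (Ah h) (Um h m) = {\<zero>\<^bsub>Ah h\<^esub>}"
proof -
  interpret maximalideal m "Rx :: 'a poly ring" by (rule m(1))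
  have "m \<noteq> {0}" using m(2) by (auto simp: delta_invariant_def)
  moreover have "0 \<in> m" using additive_subgroup.zero_closed[OF additive_subgroup_axioms] by simp
  ultimately obtain s where s: "s \<in> m" "s \<noteq> 0" by blast
  obtain r where r: "r \<noteq> 0" "m = {t. r dvd t}"
  proof (rule poly_ideal_generator[OF _ _ s])
    show "p + q \<in> m" if "p \<in> m" "q \<in> m" for p q using additive_subgroup.a_closed[OF additive_subgroup_axioms that] by simp
    show "q * p \<in> m" if "p \<in> m" for p q using I_l_closed[OF that, of q] by simp
  qed
  have "\<not> is_unit r"
  proof
    assume "is_unit r"
    then have "m = UNIV" using r by (auto intro: unit_imp_dvd)
    then show False using I_notcarr by simp
  qed
  then obtain f where f: "Factorial_Ring.irreducible f" "f dvd r"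
    using irreducible_factor_exists r(1) by blast
  have "m \<subseteq> PIdl\<^bsub>Rx\<^esub> f" using r f by (auto simp: PIdl_Rx intro: dvd_trans)
  then have "PIdl\<^bsub>Rx\<^esub> f = m \<or> PIdl\<^bsub>Rx\<^esub> f = carrier Rx"
    by (intro I_maximal cring.cgenideal_ideal[OF cring_from_type_algebra]) simp_all
  moreover have "PIdl\<^bsub>Rx\<^esub> f \<noteq> carrier Rx"
    using irreducible_not_unit[OF f(1)] by (auto simp: PIdl_Rx)
  ultimately have m_eq: "m = PIdl\<^bsub>Rx\<^esub> f" by simp
  have "\<not> f dvd h"
    using m(2) by (auto simp: m_eq PIdl_Rx delta_invariant_def delta_def)
  then show ?thesis unfolding m_eq by (rule Ann_Um[OF char f(1)])
qed

text \<open>A prime factor of h + 1 exists because h is not constant, and it does not divide h, so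
  its U(m) is irreducible and faithful.\<close>

lemma primitive_ideal_zero:
  fixes h :: "'a::field poly"
  assumes char: "CHAR('a) = 0" "h \<noteq> 0" and h: "Polynomial.degree h \<noteq> 0"
  shows "primitive_ideal TYPE('a Um_carrier) (Ah h) {\<zero>\<^bsub>Ah h\<^esub>}"
proof -
  have "Polynomial.degree (h + 1) \<noteq> 0" using h by (simp add: degree_add_eq_left)
  then obtain f where f: "Factorial_Ring.irreducible f" "f dvd h + 1"
    using irreducible_factor_exists[of "h + 1"] by (metis degree_0 is_unit_iff_degree)
  have "\<not> f dvd h"
    using f irreducible_not_unit[OF f(1)] by (metis dvd_add_right_iff)
  then show ?thesis
    unfolding primitive_ideal_def
    using irreducible_Um[OF char(1) f(1)] Ann_Um[OF char f(1)] by metis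
qed

text \<open>If a prime factor f of r did not kill M, its kernel would be a proper submodule, hence
  0. With r = f s this forces s to kill M, although r, the generator of the constants that kill M,
  does not divide s.\<close>

lemma irreducible_module_const_mem_Ann:
  fixes h :: "'a::field poly"
  assumes char: "CHAR('a) = 0" "h \<noteq> 0" and M: "irreducible_module (Ah h) M"
    and nz: "Ann (Ah h) M \<noteq> {\<zero>\<^bsub>Ah h\<^esub>}"
  obtains f where "Factorial_Ring.irreducible f" "f dvd h" "nf_elem h [:f:] \<in> Ann (Ah h) M"
proof -
  have lm: "left_module (Ah h) M" using M by (simp add: irreducible_module_def)
  interpret M: left_module "Ah h" M by (rule lm)
  define J where "J = {p. nf_elem h p \<in> Ann (Ah h) M}"
  interpret J: ideal_tmul h J
    unfolding J_def by (rule ideal_tmul_Ann[OF lm])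
  have mult: "nf_elem h p \<odot>\<^bsub>M\<^esub> (nf_elem h q \<odot>\<^bsub>M\<^esub> w) = nf_elem h (tmul h p q) \<odot>\<^bsub>M\<^esub> w"
    if "w \<in> carrier M" for p q w
    using that by (simp flip: M.smult_assoc nf_elem_mult)
  have J_iff: "p \<in> J \<longleftrightarrow> (\<forall>w\<in>carrier M. nf_elem h p \<odot>\<^bsub>M\<^esub> w = \<zero>\<^bsub>M\<^esub>)" for p
    by (simp add: J_def Ann_def)
  obtain a where a: "a \<in> Ann (Ah h) M" "a \<noteq> \<zero>\<^bsub>Ah h\<^esub>"
    using zero_mem_Ann[OF lm] nz by auto
  then obtain p where "a = nf_elem h p" by (auto simp: Ann_def carrier_Ah)
  then have "p \<in> J" "p \<noteq> 0" using a by (auto simp: J_def nf_elem_0)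
  then obtain s where s: "[:s:] \<in> J" "s \<noteq> 0" using J.const_mem[OF char] by blast
  obtain r where r: "r \<noteq> 0" "[:r:] \<in> J" "r dvd delta h r" "\<And>t. [:t:] \<in> J \<Longrightarrow> r dvd t"
    by (rule J.const_mem_minimal[OF s]) (rule that; blast)
  have "1 \<notin> J"
  proof
    assume "1 \<in> J"
    then have "w = \<zero>\<^bsub>M\<^esub>" if "w \<in> carrier M" for w
      using that M.smult_one[OF that] by (simp add: J_iff nf_elem_1)
    then have "carrier M = {\<zero>\<^bsub>M\<^esub>}" by auto
    then show False using M by (simp add: irreducible_module_def)
  qed
  have "\<not> is_unit r"
  proof
    assume "is_unit r"
    then obtain t where "1 = t * r" by (metis dvdE mult.commute)
    then have "1 = Polynomial.smult t [:r:]" by (simp add: one_pCons)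
    then show False using J.smult_mem[OF r(2), of t] \<open>1 \<notin> J\<close> by metis
  qed
  then obtain f where f: "Factorial_Ring.irreducible f" "f dvd r"
    using irreducible_factor_exists r(1) by blast
  have fh: "f dvd h"
    by (rule irreducible_dvd_of_dvd_delta[OF char(1) r(1,3) f])
  have "[:f:] \<in> J"
  proof (rule ccontr)
    assume nf: "[:f:] \<notin> J"
    define N where "N = {w \<in> carrier M. nf_elem h [:f:] \<odot>\<^bsub>M\<^esub> w = \<zero>\<^bsub>M\<^esub>}"
    have "submodule N (Ah h) M"
    proof (rule M.submoduleI)
      fix a w assume "a \<in> carrier (Ah h)" and w: "w \<in> N"
      then obtain q where q: "a = nf_elem h q" by (auto simp: carrier_Ah)
      have "[:f:] dvd tmul h [:f:] q" by (rule dvdI[of _ _ q]) simp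
      then have "tmul h [:f:] q \<in> range (\<lambda>q. tmul h q [:f:])"
        unfolding range_tmul_const[OF fh] by (rule CollectI)
      then obtain q' where q': "tmul h [:f:] q = tmul h q' [:f:]" by blast
      have wM: "w \<in> carrier M" using w by (simp add: N_def)
      have "nf_elem h [:f:] \<odot>\<^bsub>M\<^esub> (a \<odot>\<^bsub>M\<^esub> w) = nf_elem h q' \<odot>\<^bsub>M\<^esub> (nf_elem h [:f:] \<odot>\<^bsub>M\<^esub> w)"
        by (simp only: q mult[OF wM] q')
      also have "\<dots> = \<zero>\<^bsub>M\<^esub>" using w by (simp add: N_def M.smult_r_zero)
      finally show "a \<odot>\<^bsub>M\<^esub> w \<in> N" using wM by (simp add: N_def q M.smult_closed)
    qed (auto simp: N_def M.smult_r_distr M.smult_r_zero)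
    then have "N = {\<zero>\<^bsub>M\<^esub>} \<or> N = carrier M" using M by (simp add: irreducible_module_def)
    moreover have "N \<noteq> carrier M" using nf by (auto simp: N_def J_iff)
    ultimately have N: "N = {\<zero>\<^bsub>M\<^esub>}" by simp
    obtain s where s: "r = f * s" using f(2) by blast
    have "[:s:] \<in> J"
      unfolding J_iff
    proof
      fix w assume w: "w \<in> carrier M"
      have "nf_elem h [:f:] \<odot>\<^bsub>M\<^esub> (nf_elem h [:s:] \<odot>\<^bsub>M\<^esub> w) = \<zero>\<^bsub>M\<^esub>"
        using r(2) w by (simp add: mult s J_iff)
      then have "nf_elem h [:s:] \<odot>\<^bsub>M\<^esub> w \<in> N" using w by (simp add: N_def M.smult_closed)
      then show "nf_elem h [:s:] \<odot>\<^bsub>M\<^esub> w = \<zero>\<^bsub>M\<^esub>" using N by simp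
    qed
    then have "f * s dvd 1 * s" using r(4) s by simp
    then have "is_unit f" using r(1) s by (simp only: dvd_times_right_cancel_iff) auto
    then show False using f(1) irreducible_not_unit by blast
  qed
  then show thesis using that f(1) fh by (simp add: J_def)
qed

text \<open>As f kills M, the elements of A_h act on M by commuting operators, so the annihilator J
  of M is already that of a single nonzero vector w. Irreducibility then makes J a maximal ideal (f,
  g) of R[Y], and L(m, g) has the same annihilator.\<close>

lemma irreducible_module_Ann_eq:
  fixes h f :: "'a::field poly"
  assumes M: "irreducible_module (Ah h) M"
    and f: "Factorial_Ring.irreducible f" "f dvd h" "nf_elem h [:f:] \<in> Ann (Ah h) M"
  obtains gbar where "monic_prime (PIdl\<^bsub>Rx\<^esub> f) gbar"
    "irreducible_module (Ah h) (Lm h (PIdl\<^bsub>Rx\<^esub> f) gbar)"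
    "Ann (Ah h) M = Ann (Ah h) (Lm h (PIdl\<^bsub>Rx\<^esub> f) gbar)"
proof -
  have lm: "left_module (Ah h) M" using M by (simp add: irreducible_module_def)
  interpret M: left_module "Ah h" M by (rule lm)
  define J where "J = {p. nf_elem h p \<in> Ann (Ah h) M}"
  interpret J: ideal_tmul h J
    unfolding J_def by (rule ideal_tmul_Ann[OF lm])
  have mult: "nf_elem h p \<odot>\<^bsub>M\<^esub> (nf_elem h q \<odot>\<^bsub>M\<^esub> w) = nf_elem h (tmul h p q) \<odot>\<^bsub>M\<^esub> w"
    if "w \<in> carrier M" for p q w
    using that by (simp flip: M.smult_assoc nf_elem_mult)
  have J_iff: "p \<in> J \<longleftrightarrow> (\<forall>w\<in>carrier M. nf_elem h p \<odot>\<^bsub>M\<^esub> w = \<zero>\<^bsub>M\<^esub>)" for p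
    by (simp add: J_def Ann_def)
  have fJ: "p \<in> J" if "[:f:] dvd p" for p
  proof -
    have "p \<in> range (\<lambda>q. tmul h q [:f:])"
      unfolding range_tmul_const[OF f(2)] using that by (rule CollectI)
    then obtain q where "p = tmul h q [:f:]" by blast
    then show ?thesis using f(3) J.left_mem by (simp add: J_def)
  qed
  have J_cong: "p \<in> J" if "q \<in> J" "[:f:] dvd p - q" for p q
    using J.add_mem[OF fJ[OF that(2)] that(1)] by simp
  obtain w where w: "w \<in> carrier M" "w \<noteq> \<zero>\<^bsub>M\<^esub>"
    using M M.zero_closed unfolding irreducible_module_def by blast
  have J_w: "p \<in> J \<longleftrightarrow> nf_elem h p \<odot>\<^bsub>M\<^esub> w = \<zero>\<^bsub>M\<^esub>" for p
  proof
    assume p: "nf_elem h p \<odot>\<^bsub>M\<^esub> w = \<zero>\<^bsub>M\<^esub>"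
    show "p \<in> J"
      unfolding J_iff
    proof
      fix v assume "v \<in> carrier M"
      then obtain a where "a \<in> carrier (Ah h)" "a \<odot>\<^bsub>M\<^esub> w = v"
        using irreducible_module_cyclic[OF M w] by blast
      then obtain q where v: "v = nf_elem h q \<odot>\<^bsub>M\<^esub> w" by (auto simp: carrier_Ah)
      \<comment> \<open>The commutator kills w, so p (q w) = q (p w) = 0.\<close>
      have "tmul h p q - tmul h q p \<in> J" by (rule fJ[OF tmul_commute_cong[OF f(2)]])
      then have z: "nf_elem h (tmul h p q - tmul h q p) \<odot>\<^bsub>M\<^esub> w = \<zero>\<^bsub>M\<^esub>"
        using w(1) by (simp add: J_iff)
      have "nf_elem h p \<odot>\<^bsub>M\<^esub> v = nf_elem h ((tmul h p q - tmul h q p) + tmul h q p) \<odot>\<^bsub>M\<^esub> w"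
        using w(1) by (simp add: v mult)
      also have "\<dots> = nf_elem h (tmul h p q - tmul h q p) \<odot>\<^bsub>M\<^esub> w \<oplus>\<^bsub>M\<^esub> nf_elem h (tmul h q p) \<odot>\<^bsub>M\<^esub> w"
        using w(1) by (simp only: M.smult_l_distr nf_elem_closed flip: nf_elem_add)
      also have "\<dots> = nf_elem h (tmul h q p) \<odot>\<^bsub>M\<^esub> w"
        using w(1) by (simp add: z M.smult_closed)
      also have "\<dots> = nf_elem h q \<odot>\<^bsub>M\<^esub> (nf_elem h p \<odot>\<^bsub>M\<^esub> w)" by (simp only: mult[OF w(1)])
      also have "\<dots> = \<zero>\<^bsub>M\<^esub>" by (simp add: p M.smult_r_zero)
      finally show "nf_elem h p \<odot>\<^bsub>M\<^esub> v = \<zero>\<^bsub>M\<^esub>" .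
    qed
  qed (use w(1) in \<open>simp add: J_iff\<close>)
  have one: "nf_elem h 1 \<odot>\<^bsub>M\<^esub> w = w" using M.smult_one[OF w(1)] by (simp add: nf_elem_1)
  have one_J: "1 \<notin> J" using one w(2) J_w by simp
  \<comment> \<open>By irreducibility some q returns p w to w. Thus q p - 1 kills w and lies in J,
    at first for the twisted product and then, modulo f, for the commutative one.\<close>
  have max: "\<exists>q. q * p - 1 \<in> J" if "p \<notin> J" for p
  proof -
    have "nf_elem h p \<odot>\<^bsub>M\<^esub> w \<noteq> \<zero>\<^bsub>M\<^esub>" using that J_w by blast
    then obtain a where "a \<in> carrier (Ah h)" "a \<odot>\<^bsub>M\<^esub> (nf_elem h p \<odot>\<^bsub>M\<^esub> w) = w"
      using irreducible_module_cyclic[OF M _ _ w(1)] w(1) by (metis M.smult_closed nf_elem_closed)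
    then obtain q where "nf_elem h q \<odot>\<^bsub>M\<^esub> (nf_elem h p \<odot>\<^bsub>M\<^esub> w) = w" by (auto simp: carrier_Ah)
    then have q: "nf_elem h (tmul h q p) \<odot>\<^bsub>M\<^esub> w = w" using mult[OF w(1)] by simp
    have "nf_elem h (tmul h q p - 1) \<odot>\<^bsub>M\<^esub> w \<oplus>\<^bsub>M\<^esub> nf_elem h 1 \<odot>\<^bsub>M\<^esub> w = nf_elem h (tmul h q p) \<odot>\<^bsub>M\<^esub> w"
      using w(1) by (simp flip: M.smult_l_distr add: nf_elem_add)
    then have "nf_elem h (tmul h q p - 1) \<odot>\<^bsub>M\<^esub> w \<oplus>\<^bsub>M\<^esub> w = \<zero>\<^bsub>M\<^esub> \<oplus>\<^bsub>M\<^esub> w"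
      using w(1) by (simp add: one q)
    then have "nf_elem h (tmul h q p - 1) \<odot>\<^bsub>M\<^esub> w = \<zero>\<^bsub>M\<^esub>"
      using M.add.right_cancel[OF w(1) _ M.zero_closed] w(1) M.smult_closed nf_elem_closed by blast
    then have "tmul h q p - 1 \<in> J" using J_w by blast
    moreover have "[:f:] dvd - (tmul h q p - q * p)"
      unfolding dvd_minus_iff by (rule tmul_cong_mult[OF f(2)])
    then have "[:f:] dvd (q * p - 1) - (tmul h q p - 1)" by simp
    ultimately show ?thesis using J_cong by blast
  qed
  obtain g where g: "Polynomial.lead_coeff g = 1" "J = ideal_mod f g"
  proof (rule maximal_ideal_generator[OF f(1)])
    show "[:f:] \<in> J" using f(3) by (simp add: J_def)
    show "q * p \<in> J" if "p \<in> J" for p q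
    proof (rule J_cong[OF J.left_mem[OF that, of q]])
      have "[:f:] dvd - (tmul h q p - q * p)"
        unfolding dvd_minus_iff by (rule tmul_cong_mult[OF f(2)])
      then show "[:f:] dvd q * p - tmul h q p" by simp
    qed
  qed (use J.add_mem one_J max in auto)
  have "Ann (Ah h) M = nf_elem h ` J" by (auto simp: J_def Ann_def carrier_Ah)
  then show thesis
    using that[of "reduce_coeffs (PIdl\<^bsub>Rx\<^esub> f) g"] monic_prime_reduce_coeffs[OF f(1) g(1)]
      irreducible_Lm[OF f(2)] Ann_Lm[OF f(2)] one_J max by (simp add: g(2))
qed

text \<open>The classification ranges over modules with elements of an arbitrary type
  \<open>'m\<close>, whereas the primitivity of 0 is witnessed at the type of the elements of U(m).
  Irreducibility of L(m, g) accompanies the equation of annihilators, so that P is exhibited as the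
  annihilator of an irreducible module.\<close>

theorem corollary5p5:
  fixes h :: "'a::field poly"
  assumes "h \<noteq> 0"
  shows
    "(CHAR('a) = 0 \<and> h \<notin> {[:c:] | c. c \<noteq> 0} \<longrightarrow>
        (\<forall>P. primitive_ideal TYPE('m) (Ah h) P \<longrightarrow>
           P = {\<zero>\<^bsub>Ah h\<^esub>} \<or>
           (\<exists>f gbar. Factorial_Ring.irreducible f \<and> f dvd h \<and>
              monic_prime (PIdl\<^bsub>Rx\<^esub> f) gbar \<and>
              irreducible_module (Ah h) (Lm h (PIdl\<^bsub>Rx\<^esub> f) gbar) \<and>
              P = Ann (Ah h) (Lm h (PIdl\<^bsub>Rx\<^esub> f) gbar))) \<and>
        primitive_ideal TYPE('a Um_carrier) (Ah h) {\<zero>\<^bsub>Ah h\<^esub>} \<and>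
        (\<forall>m. maximalideal m Rx \<and> \<not> delta_invariant h m \<longrightarrow>
           Ann (Ah h) (Um h m) = {\<zero>\<^bsub>Ah h\<^esub>})) \<and>
     (\<forall>f (g :: 'a poly poly).
        Factorial_Ring.irreducible f \<and> f dvd h \<and>
        monic_prime (PIdl\<^bsub>Rx\<^esub> f) (reduce_coeffs (PIdl\<^bsub>Rx\<^esub> f) g) \<longrightarrow>
        Ann (Ah h) (Lm h (PIdl\<^bsub>Rx\<^esub> f) (reduce_coeffs (PIdl\<^bsub>Rx\<^esub> f) g)) =
          {a \<otimes>\<^bsub>Ah h\<^esub> Ah_elem h g | a. a \<in> carrier (Ah h)}
          <+>\<^bsub>Ah h\<^esub> (carrier (Ah h) \<cdot>\<^bsub>Ah h\<^esub> (Ah_emb h ` (PIdl\<^bsub>Rx\<^esub> f))))"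
proof (intro conjI impI allI; (elim conjE)?)
  fix P
  assume char: "CHAR('a) = 0" and "primitive_ideal TYPE('m) (Ah h) P"
  then obtain M :: "('a free_algebra set, 'm) module"
    where M: "irreducible_module (Ah h) M" and P: "P = Ann (Ah h) M"
    by (auto simp: primitive_ideal_def)
  show "P = {\<zero>\<^bsub>Ah h\<^esub>} \<or>
           (\<exists>f gbar. Factorial_Ring.irreducible f \<and> f dvd h \<and>
              monic_prime (PIdl\<^bsub>Rx\<^esub> f) gbar \<and>
              irreducible_module (Ah h) (Lm h (PIdl\<^bsub>Rx\<^esub> f) gbar) \<and>
              P = Ann (Ah h) (Lm h (PIdl\<^bsub>Rx\<^esub> f) gbar))"
  proof (cases "P = {\<zero>\<^bsub>Ah h\<^esub>}")
    case False
    then have nz: "Ann (Ah h) M \<noteq> {\<zero>\<^bsub>Ah h\<^esub>}" using P by simp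
    obtain f where f: "Factorial_Ring.irreducible f" "f dvd h" "nf_elem h [:f:] \<in> Ann (Ah h) M"
      by (rule irreducible_module_const_mem_Ann[OF char assms M nz])
    obtain gbar where "monic_prime (PIdl\<^bsub>Rx\<^esub> f) gbar"
      "irreducible_module (Ah h) (Lm h (PIdl\<^bsub>Rx\<^esub> f) gbar)"
      "P = Ann (Ah h) (Lm h (PIdl\<^bsub>Rx\<^esub> f) gbar)"
      unfolding P by (rule irreducible_module_Ann_eq[OF M f])
    then show ?thesis using f(1,2) by blast
  qed simp
next
  assume char: "CHAR('a) = 0" and h: "h \<notin> {[:c:] | c. c \<noteq> 0}"
  have "Polynomial.degree h \<noteq> 0"
  proof
    assume "Polynomial.degree h = 0"
    then obtain c where "h = [:c:]" by (rule degree_eq_zeroE)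
    then show False using h assms by auto
  qed
  then show "primitive_ideal TYPE('a Um_carrier) (Ah h) {\<zero>\<^bsub>Ah h\<^esub>}"
    by (rule primitive_ideal_zero[OF char assms])
next
  fix m
  assume "CHAR('a) = 0" "maximalideal m Rx" "\<not> delta_invariant h m"
  then show "Ann (Ah h) (Um h m) = {\<zero>\<^bsub>Ah h\<^esub>}"
    using assms by (intro Ann_Um_maximal)
next
  fix f :: "'a poly" and g :: "'a poly poly"
  assume "f dvd h"
  then show "Ann (Ah h) (Lm h (PIdl\<^bsub>Rx\<^esub> f) (reduce_coeffs (PIdl\<^bsub>Rx\<^esub> f) g)) =
          {a \<otimes>\<^bsub>Ah h\<^esub> Ah_elem h g | a. a \<in> carrier (Ah h)}
          <+>\<^bsub>Ah h\<^esub> (carrier (Ah h) \<cdot>\<^bsub>Ah h\<^esub> (Ah_emb h ` (PIdl\<^bsub>Rx\<^esub> f)))"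
    by (simp only: Ann_Lm left_ideal_sum_eq)
qed

end
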